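(* For every nonempty finite subset $K\subset\mathbb Z^4$, $$\lim_{x\to\infty}\bigl(\|x\|^2\log\|x\|\bigr)\cdot P(\mathcal S_x\text{ visits }K)=\frac{1}{2\sigma^2},$$ where $\mathcal S_x$ is the branching random walk on $\mathbb Z^4$ with offspring distribution $\mu$ and jump distribution $\theta$ started from $x\in\mathbb Z^4$.
   Context: Standing assumptions: $\mu$ is a probability distribution on $\mathbb N=\{0,1,2,\dots\}$ with mean one and finite variance $\sigma^2>0$; $\theta$ is a probability distribution on $\mathbb Z^4$ with mean zero, not supported on a strict subgroup of $\mathbb Z^4$, and such that $\sum_{z\in\mathbb Z^4}\theta(z)e^{\lambda|z|}<\infty$ for some $\lambda>0$ ($|\cdot|$ the Euclidean norm). $Q$ is the covariance matrix of $\theta$ and $\|x\|=\tfrac12\sqrt{x\cdot Q^{-1}x}$. $\mathcal S_x$ (the snake from $x$): let $T$ be a Galton–Watson tree with offspring distribution $\mu$; conditionally on $T$ assign to the edges independent $\theta$-distributed variables, and for each vertex $v$ let $\mathcal S_x(v)$ be $x$ plus the sum of the variables on the edges of the unique simple path from the root to $v$. "$\mathcal S_x$ visits $K$" means that $\mathcal S_x(v)\in K$ for some vertex $v$ of $T$. *)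

theory Defs
  imports "HOL-Probability.Probability" "HOL-Algebra.Group"
begin

definition real_of_int_vec :: "int ^ 'n \<Rightarrow> real ^ 'n" where
  "real_of_int_vec z = (\<chi> i. real_of_int (z $ i))"

definition int_vec_group :: "(int ^ 'n) monoid" where
  "int_vec_group = \<lparr>carrier = UNIV, monoid.mult = (+), one = 0\<rparr>"

definition mean_vec :: "(int ^ 'n) pmf \<Rightarrow> real ^ 'n" where
  "mean_vec \<theta> = measure_pmf.expectation \<theta> real_of_int_vec"

definition cov_matrix :: "(int ^ 'n) pmf \<Rightarrow> real ^ 'n ^ 'n" where
  "cov_matrix \<theta> = (\<chi> i j. measure_pmf.expectation \<theta>
     (\<lambda>z. (real_of_int (z $ i) - mean_vec \<theta> $ i) * (real_of_int (z $ j) - mean_vec \<theta> $ j)))"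

text \<open>The factor 1/2 is 1 / sqrt d in dimension d = 4.\<close>

definition cov_norm :: "(int ^ 4) pmf \<Rightarrow> int ^ 4 \<Rightarrow> real" where
  "cov_norm \<theta> x = 1 / 2 *
     sqrt (real_of_int_vec x \<bullet> (matrix_inv (cov_matrix \<theta>) *v real_of_int_vec x))"

text \<open>Plane trees in Ulam--Harris encoding: a vertex is a list of naturals, the root is \<open>[]\<close>, and
  the children of \<open>v\<close> are \<open>v @ [0], \<dots>, v @ [N v - 1]\<close>, where \<open>N v\<close> is the number of offspring
  of \<open>v\<close>.\<close>

inductive_set offspring_tree :: "(nat list \<Rightarrow> nat) \<Rightarrow> nat list set"
  for N :: "nat list \<Rightarrow> nat" where
  root: "[] \<in> offspring_tree N"
| child: "v \<in> offspring_tree N \<Longrightarrow> i < N v \<Longrightarrow> v @ [i] \<in> offspring_tree N"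

text \<open>The value \<open>\<xi> v\<close>, for \<open>v \<noteq> []\<close>, sits on the edge joining \<open>v\<close> to its parent \<open>butlast v\<close>.
  The edges on the path from the root to \<open>v\<close> are thus indexed by the nonempty prefixes of \<open>v\<close>.\<close>

definition snake :: "int ^ 'n \<Rightarrow> (nat list \<Rightarrow> int ^ 'n) \<Rightarrow> nat list \<Rightarrow> int ^ 'n" where
  "snake x \<xi> v = x + (\<Sum>k = 1..length v. \<xi> (take k v))"

definition snake_visits ::
  "int ^ 'n \<Rightarrow> (nat list \<Rightarrow> nat) \<Rightarrow> (nat list \<Rightarrow> int ^ 'n) \<Rightarrow> (int ^ 'n) set \<Rightarrow> bool" where
  "snake_visits x N \<xi> K \<longleftrightarrow> (\<exists>v \<in> offspring_tree N. snake x \<xi> v \<in> K)"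

text \<open>Offspring numbers are i.i.d. with law \<open>\<mu>\<close>, so that \<open>offspring_tree N\<close> is a Galton--Watson tree.
  The jumps are i.i.d. with law \<open>\<theta>\<close> and independent of the offspring numbers. They are attached to
  all labels, but only those on edges of the tree enter \<open>snake_visits\<close>; conditionally on the tree,
  these are i.i.d. with law \<open>\<theta>\<close>.\<close>

definition snake_measure ::
  "nat pmf \<Rightarrow> (int ^ 'n) pmf \<Rightarrow> ((nat list \<Rightarrow> nat) \<times> (nat list \<Rightarrow> int ^ 'n)) measure" where
  "snake_measure \<mu> \<theta> =
     PiM UNIV (\<lambda>_. measure_pmf \<mu>) \<Otimes>\<^sub>M PiM UNIV (\<lambda>_. measure_pmf \<theta>)"

lemma prob_space_snake_measure: "prob_space (snake_measure \<mu> \<theta>)"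
  unfolding snake_measure_def
  by (intro prob_space_pair prob_space_PiM measure_pmf.prob_space_axioms)

lemma offspring_tree_iff:
  "v \<in> offspring_tree N \<longleftrightarrow> (\<forall>k < length v. v ! k < N (take k v))"
proof (induction v rule: rev_induct)
  case Nil
  show ?case by (simp add: offspring_tree.root)
next
  case (snoc i v)
  have "v @ [i] \<in> offspring_tree N \<longleftrightarrow> v \<in> offspring_tree N \<and> i < N v"
    by (auto intro: offspring_tree.child elim: offspring_tree.cases)
  then show ?case
    using snoc by (auto simp: nth_append less_Suc_eq)
qed

lemma measurable_snake_visits:
  "{\<omega> \<in> space (snake_measure \<mu> \<theta>). snake_visits x (fst \<omega>) (snd \<omega>) K} \<in> sets (snake_measure \<mu> \<theta>)"
proof -
  let ?M = "snake_measure \<mu> \<theta>"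
  have N: "(\<lambda>\<omega>. fst \<omega> u) \<in> ?M \<rightarrow>\<^sub>M count_space UNIV" for u
  proof -
    have "(\<lambda>\<omega>. fst \<omega> u) \<in> ?M \<rightarrow>\<^sub>M measure_pmf \<mu>"
      unfolding snake_measure_def by measurable
    then show ?thesis by (simp add: measurable_def)
  qed
  have X: "(\<lambda>\<omega>. snd \<omega> u) \<in> ?M \<rightarrow>\<^sub>M count_space UNIV" for u
  proof -
    have "(\<lambda>\<omega>. snd \<omega> u) \<in> ?M \<rightarrow>\<^sub>M measure_pmf \<theta>"
      unfolding snake_measure_def by measurable
    then show ?thesis by (simp add: measurable_def)
  qed
  have cnt: "countable (UNIV :: (int ^ 'n) set)"
  proof -
    have "countable (range (\<lambda>f. vec_lambda f :: int ^ 'n))" by (rule countable_image) simp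
    moreover have "range (\<lambda>f. vec_lambda f :: int ^ 'n) = UNIV"
      by (metis surjI vec_nth_inverse)
    ultimately show ?thesis by simp
  qed
  have S: "(\<lambda>\<omega>. \<Sum>k\<in>A. snd \<omega> (f k)) \<in> ?M \<rightarrow>\<^sub>M count_space UNIV"
    if "finite A" for A and f :: "nat \<Rightarrow> nat list"
    using that
  proof induction
    case (insert a A)
    have pair: "(\<lambda>\<omega>. (snd \<omega> (f a), \<Sum>k\<in>A. snd \<omega> (f k)))
        \<in> ?M \<rightarrow>\<^sub>M count_space UNIV \<Otimes>\<^sub>M count_space UNIV"
      by (intro measurable_Pair X insert.IH)
    have "(\<lambda>p. fst p + snd p :: int ^ 'n)
        \<in> count_space UNIV \<Otimes>\<^sub>M count_space UNIV \<rightarrow>\<^sub>M count_space UNIV"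
      by (simp add: pair_measure_countable cnt)
    from measurable_compose[OF pair this]
    have "(\<lambda>\<omega>. snd \<omega> (f a) + (\<Sum>k\<in>A. snd \<omega> (f k))) \<in> ?M \<rightarrow>\<^sub>M count_space UNIV"
      by simp
    then show ?case using insert by simp
  qed simp
  have "(\<lambda>\<omega>. snake x (snd \<omega>) v) \<in> ?M \<rightarrow>\<^sub>M count_space UNIV" for v
    unfolding snake_def by (rule measurable_compose[OF S]) auto
  then have [measurable]: "Measurable.pred ?M (\<lambda>\<omega>. snake x (snd \<omega>) v \<in> K)" for v
    by (rule measurable_compose) simp
  have [measurable]: "Measurable.pred ?M (\<lambda>\<omega>. v ! k < fst \<omega> (take k v))" for v k
    by (rule measurable_compose[OF N]) simp
  have "Measurable.pred ?M (\<lambda>\<omega>. snake_visits x (fst \<omega>) (snd \<omega>) K)"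
    unfolding snake_visits_def Bex_def offspring_tree_iff by measurable
  then show ?thesis by (simp add: pred_def)
qed

end

theory Submission
  imports Defs "HOL-Real_Asymp.Real_Asymp"
begin

text \<open>
  Write \<open>v x\<close> for the probability that the snake from \<open>x\<close> visits \<open>K\<close>. Cutting the tree at its root
  turns the problem into a deterministic one: \<open>v = 1\<close> on \<open>K\<close> and \<open>v = f (\<theta> v)\<close> off \<open>K\<close>, where
  \<open>\<theta> v x\<close> is the mean of \<open>v\<close> after one jump from \<open>x\<close> and \<open>f p = 1 - E ((1 - p) ^ N)\<close> for an offspring
  number \<open>N\<close>. Moreover \<open>v\<close> is the limit of the iteration of this equation started from \<open>0\<close>, hence its
  smallest solution. Criticality and the finite variance give
  \<open>f p = p - \<sigma>\<^sup>2 / 2 * p\<^sup>2 + o(p\<^sup>2)\<close>, so far from \<open>K\<close> the equation is a discrete form of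
  \<open>L v = \<sigma>\<^sup>2 / 2 * v\<^sup>2\<close>, where \<open>L\<close> is half the Laplacian in the coordinates that turn the covariance matrix
  \<open>Q\<close> into the identity. The equation is solved asymptotically by explicit barriers.

  In terms of \<open>t = x \<bullet> Q\<^sup>-\<^sup>1 x\<close>, which is four times the square of the norm of the theorem,
  \<open>L\<close> maps \<open>W (ln t) / t\<close> to \<open>(2 W'' - 2 W') (ln t) / t\<^sup>2\<close> in dimension four; there is no term in
  \<open>W\<close> itself, because \<open>1 / t\<close> is harmonic. For \<open>W s = a / (s - B)\<close> the leading part of this is \<open>2 a / (s - B)\<^sup>2 / t\<^sup>2\<close>, to be compared
  with \<open>\<sigma>\<^sup>2 / 2 * W\<^sup>2 / t\<^sup>2\<close>. Thus \<open>a / (t (ln t - B))\<close> is, far enough out, a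
  supersolution if \<open>a > 4 / \<sigma>\<^sup>2\<close> and a subsolution if \<open>a < 4 / \<sigma>\<^sup>2\<close>, for every \<open>B\<close>. A third order Taylor
  expansion and the moments of the jumps show that this survives the passage to the lattice walk
  as long as \<open>ln t - B\<close> is large but small compared with the square root of \<open>t\<close>
  (\<open>ex_super_scale\<close>, \<open>ex_sub_scale\<close>).

  Barriers are compared with \<open>v\<close> outside a ball, given the comparison on a shell just inside it. From above
  this follows from the minimality of \<open>v\<close> (\<open>upper_barrier\<close>). From below it follows from a maximum
  principle, since \<open>f\<close> is 1-Lipschitz and the barrier vanishes at infinity (\<open>lower_barrier\<close>).

  The free constant \<open>B\<close> makes it possible to match the shell, in two rounds. With \<open>B = 0\<close> and a very
  large, respectively very small, amplitude \<open>a\<close> the comparison on a fixed shell is trivial, and yields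
  that \<open>v\<close> is of order \<open>1 / (t ln t)\<close>. From below this needs \<open>v > 0\<close>, that is, irreducibility of the walk
  (\<open>list_sums_support\<close>). In the second round \<open>a\<close> is close to \<open>4 / \<sigma>\<^sup>2\<close>, and \<open>B\<close> is
  a suitable multiple of the logarithm of a huge starting radius, chosen such that the barrier is on the right
  side of the crude bound on the starting shell. For fixed \<open>B\<close> the barrier is equivalent to
  \<open>a / (t ln t)\<close> as \<open>t \<rightarrow> \<infinity>\<close>, which gives the sharp constant.
\<close>

section \<open>Independent marks on the vertices of a plane tree\<close>

definition label_measure :: "'c pmf \<Rightarrow> (nat list \<Rightarrow> 'c) measure" where
  "label_measure p = PiM UNIV (\<lambda>_. measure_pmf p)"

lemma prob_space_label_measure: "prob_space (label_measure p)"
  unfolding label_measure_def by (intro prob_space_PiM measure_pmf.prob_space_axioms)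

lemma space_label_measure [simp]: "space (label_measure p) = UNIV"
  by (simp add: label_measure_def space_PiM)

lemma measurable_label [measurable]: "(\<lambda>\<omega>. \<omega> v) \<in> label_measure p \<rightarrow>\<^sub>M count_space UNIV"
proof -
  have "(\<lambda>\<omega>. \<omega> v) \<in> label_measure p \<rightarrow>\<^sub>M measure_pmf p"
    unfolding label_measure_def by measurable
  then show ?thesis by (simp add: measurable_def)
qed

lemma measurable_shift [measurable]:
  "(\<lambda>\<omega> v. \<omega> (i # v)) \<in> label_measure p \<rightarrow>\<^sub>M label_measure p"
proof -
  have "(\<lambda>\<omega> v. \<omega> (i # v)) \<in> label_measure p \<rightarrow>\<^sub>M PiM UNIV (\<lambda>_. measure_pmf p)"
    by (rule measurable_PiM_single') (auto simp: space_PiM)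
  then show ?thesis by (simp add: label_measure_def)
qed

lemma measure_shift:
  assumes A: "A \<in> sets (label_measure p)"
  shows "measure (label_measure p) {\<omega>. (\<lambda>v. \<omega> (i # v)) \<in> A} = measure (label_measure p) A"
proof -
  have "distr (PiM UNIV (\<lambda>_::nat list. measure_pmf p)) (PiM UNIV (\<lambda>_. measure_pmf p))
      (\<lambda>\<omega>. \<lambda>n\<in>UNIV. \<omega> (i # n)) = PiM UNIV (\<lambda>_. measure_pmf p)"
    by (rule distr_PiM_reindex) (auto simp: measure_pmf.prob_space_axioms)
  then have "distr (label_measure p) (label_measure p) (\<lambda>\<omega> v. \<omega> (i # v)) = label_measure p"
    by (simp add: label_measure_def restrict_UNIV)
  then have "measure (label_measure p) A
      = measure (distr (label_measure p) (label_measure p) (\<lambda>\<omega> v. \<omega> (i # v))) A"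
    by (simp only:)
  also have "\<dots> = measure (label_measure p) {\<omega>. (\<lambda>v. \<omega> (i # v)) \<in> A}"
    using measure_distr[OF measurable_shift A, of i] by (simp only: vimage_def space_label_measure Int_UNIV_right)
  finally show ?thesis ..
qed

lemma measure_label: "measure (label_measure p) {\<omega>. \<omega> v = c} = pmf p c"
proof -
  have m: "(\<lambda>\<omega>. \<omega> v) \<in> label_measure p \<rightarrow>\<^sub>M measure_pmf p"
    unfolding label_measure_def by (rule measurable_component_singleton) simp
  have d: "distr (label_measure p) (measure_pmf p) (\<lambda>\<omega>. \<omega> v) = measure_pmf p"
    unfolding label_measure_def
    by (rule distr_PiM_component) (auto simp: measure_pmf.prob_space_axioms)
  have "measure (label_measure p) {\<omega>. \<omega> v = c} = measure (label_measure p) ((\<lambda>\<omega>. \<omega> v) -` {c} \<inter> space (label_measure p))"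
    by (rule arg_cong2[where f=measure]) auto
  also have "\<dots> = measure (distr (label_measure p) (measure_pmf p) (\<lambda>\<omega>. \<omega> v)) {c}"
    by (rule measure_distr[OF m, symmetric]) simp
  also have "\<dots> = pmf p c"
    unfolding d by (simp add: pmf.rep_eq)
  finally show ?thesis .
qed

lemma indep_vars_label:
  "prob_space.indep_vars (label_measure p) (\<lambda>_. measure_pmf p) (\<lambda>v \<omega>. \<omega> v) UNIV"
proof -
  interpret prob_space "label_measure p" by (rule prob_space_label_measure)
  have "distr (label_measure p) (measure_pmf p) (\<lambda>\<omega>. \<omega> v) = measure_pmf p" for v
    unfolding label_measure_def
    by (rule distr_PiM_component) (auto simp: measure_pmf.prob_space_axioms)
  moreover have "distr (label_measure p) (PiM UNIV (\<lambda>_. measure_pmf p)) (\<lambda>\<omega>. \<omega>) = label_measure p"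
    unfolding label_measure_def by (rule distr_id2) simp
  ultimately have "distr (label_measure p) (PiM UNIV (\<lambda>_. measure_pmf p)) (\<lambda>\<omega>. \<lambda>v\<in>UNIV. \<omega> v)
      = PiM UNIV (\<lambda>v. distr (label_measure p) (measure_pmf p) (\<lambda>\<omega>. \<omega> v))"
    by (simp only: restrict_UNIV) (simp add: label_measure_def)
  then show ?thesis
    by (subst indep_vars_iff_distr_eq_PiM) simp_all
qed

text \<open>The mark of the root and the families of marks above the children of the root depend on pairwise
  disjoint sets of vertices; this is the independence behind the branching property.\<close>

lemma measure_root_and_subtrees:
  assumes A: "A \<in> sets (label_measure p)"
  shows "measure (label_measure p) {\<omega>. \<omega> [] = c \<and> (\<forall>i<k. (\<lambda>v. \<omega> (i # v)) \<in> A)}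
    = pmf p c * measure (label_measure p) A ^ k"
proof -
  interpret prob_space "label_measure p" by (rule prob_space_label_measure)
  \<comment> \<open>The block \<open>None\<close> is the root, the block \<open>Some i\<close> the subtree above its \<open>i\<close>-th child.\<close>
  define K :: "nat option \<Rightarrow> nat list set" where
    "K = (\<lambda>j. case j of None \<Rightarrow> {[]} | Some i \<Rightarrow> range ((#) i))"
  define X where "X = (\<lambda>j (\<omega> :: nat list \<Rightarrow> 'a). restrict (\<lambda>v. \<omega> v) (K j))"
  define S where "S = (\<lambda>j. {f \<in> space (PiM (K j) (\<lambda>_. measure_pmf p)).
      case j of None \<Rightarrow> f [] = c | Some i \<Rightarrow> (\<lambda>v. f (i # v)) \<in> A})"
  have ind: "indep_vars (\<lambda>j. PiM (K j) (\<lambda>_. measure_pmf p)) X UNIV"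
    unfolding X_def
  proof (rule indep_vars_restrict[OF indep_vars_label])
    show "disjoint_family_on K UNIV"
      by (auto simp: disjoint_family_on_def K_def split: option.splits)
  qed simp
  have S: "S j \<in> sets (PiM (K j) (\<lambda>_. measure_pmf p))" for j
  proof (cases j)
    case None
    have "(\<lambda>f. f []) -` {c} \<inter> space (PiM (K j) (\<lambda>_. measure_pmf p)) \<in> sets (PiM (K j) (\<lambda>_. measure_pmf p))"
      by (rule measurable_sets[OF measurable_component_singleton]) (auto simp: K_def None)
    then show ?thesis by (simp add: S_def None vimage_def Int_def conj_commute)
  next
    case (Some i)
    have "(\<lambda>f v. f (i # v)) \<in> PiM (K j) (\<lambda>_. measure_pmf p) \<rightarrow>\<^sub>M label_measure p"
      unfolding label_measure_def
    proof (rule measurable_PiM_single')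
      show "(\<lambda>f. f (i # v)) \<in> PiM (K j) (\<lambda>_. measure_pmf p) \<rightarrow>\<^sub>M measure_pmf p" for v
        by (rule measurable_component_singleton) (simp add: K_def Some)
    qed (simp add: space_PiM)
    from measurable_sets[OF this A] show ?thesis
      by (simp add: S_def Some vimage_def Int_def conj_commute)
  qed
  have XS: "X None -` S None \<inter> space (label_measure p) = {\<omega>. \<omega> [] = c}"
    "X (Some i) -` S (Some i) \<inter> space (label_measure p) = {\<omega>. (\<lambda>v. \<omega> (i # v)) \<in> A}" for i
    by (auto simp: X_def S_def K_def space_PiM)
  have "{\<omega>. \<omega> [] = c \<and> (\<forall>i<k. (\<lambda>v. \<omega> (i # v)) \<in> A)} 
    = (\<Inter>j\<in>insert None (Some ` {..<k}). X j -` S j \<inter> space (label_measure p))"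
    using XS by auto
  also have "prob \<dots> = (\<Prod>j\<in>insert None (Some ` {..<k}). prob (X j -` S j \<inter> space (label_measure p)))"
    by (rule indep_varsD[OF ind]) (auto intro: S)
  also have "\<dots> = pmf p c * (\<Prod>i<k. prob {\<omega>. (\<lambda>v. \<omega> (i # v)) \<in> A})"
    by (subst prod.insert) (auto simp: prod.reindex XS[simplified] measure_label)
  finally show ?thesis by (simp add: measure_shift[OF A])
qed

lemma measurable_subtree:
  assumes "A \<in> sets (label_measure p)"
  shows "Measurable.pred (label_measure p) (\<lambda>\<omega>. (\<lambda>v. \<omega> (i # v)) \<in> A)"
proof -
  have "(\<lambda>\<omega> v. \<omega> (i # v)) -` A \<inter> space (label_measure p) \<in> sets (label_measure p)"
    by (rule measurable_sets[OF measurable_shift assms])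
  then show ?thesis by (simp add: pred_def vimage_def)
qed

lemma measurable_subtrees:
  assumes "A \<in> sets (label_measure p)"
  shows "Measurable.pred (label_measure p) (\<lambda>\<omega>. \<forall>i<k. (\<lambda>v. \<omega> (i # v)) \<in> A)"
  by (rule pred_intros_countable(1), rule pred_intros_logic(4)[OF _ measurable_subtree[OF assms]]) simp

lemma measurable_root_and_subtrees:
  fixes p :: "'c :: countable pmf"
  assumes A: "\<And>c. A c \<in> sets (label_measure p)"
  shows "{\<omega>. R (\<omega> []) \<and> (\<forall>i<k (\<omega> []). (\<lambda>v. \<omega> (i # v)) \<in> A (\<omega> []))} \<in> sets (label_measure p)"
proof -
  have "Measurable.pred (label_measure p)
      (\<lambda>\<omega>. (\<lambda>c \<omega>. \<forall>i<k c. (\<lambda>v. \<omega> (i # v)) \<in> A c) (\<omega> []) \<omega>)"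
    by (rule measurable_compose_countable[where g="\<lambda>\<omega>. \<omega> []", OF measurable_subtrees[OF A] measurable_label])
  moreover have "Measurable.pred (label_measure p) (\<lambda>\<omega>. R (\<omega> []))"
    by (rule measurable_compose[OF measurable_label]) simp
  ultimately have "Measurable.pred (label_measure p)
      (\<lambda>\<omega>. R (\<omega> []) \<and> (\<forall>i<k (\<omega> []). (\<lambda>v. \<omega> (i # v)) \<in> A (\<omega> [])))"
    by (intro pred_intros_logic(3))
  then show ?thesis by (simp add: pred_def)
qed

text \<open>The condition \<open>R\<close> on the root is kept apart from the subtree events \<open>A\<close>, because it has to be felt even when
  the root has no child.\<close>

lemma branching_property:
  fixes p :: "'c :: countable pmf"
  assumes A: "\<And>c. A c \<in> sets (label_measure p)"
  shows "measure (label_measure p) {\<omega>. R (\<omega> []) \<and> (\<forall>i<k (\<omega> []). (\<lambda>v. \<omega> (i # v)) \<in> A (\<omega> []))}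
    = measure_pmf.expectation p (\<lambda>c. of_bool (R c) * measure (label_measure p) (A c) ^ k c)"
proof -
  interpret prob_space "label_measure p" by (rule prob_space_label_measure)
  let ?E = "{\<omega>. R (\<omega> []) \<and> (\<forall>i<k (\<omega> []). (\<lambda>v. \<omega> (i # v)) \<in> A (\<omega> []))}"
  define B where "B = (\<lambda>c. {\<omega>. R c \<and> \<omega> [] = c \<and> (\<forall>i<k c. (\<lambda>v. \<omega> (i # v)) \<in> A c)})"
  have B: "B c \<in> sets (label_measure p)" for c
  proof -
    have "Measurable.pred (label_measure p) (\<lambda>\<omega>. \<omega> [] = c)"
      by measurable
    then have "Measurable.pred (label_measure p) (\<lambda>\<omega>. \<omega> [] = c \<and> (\<forall>i<k c. (\<lambda>v. \<omega> (i # v)) \<in> A c))"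
      by (rule pred_intros_logic(3)[OF _ measurable_subtrees[OF A]])
    then show ?thesis by (cases "R c") (simp_all add: pred_def B_def)
  qed
  have int: "integrable p (\<lambda>c. of_bool (R c) * prob (A c) ^ k c)"
    by (rule measure_pmf.integrable_const_bound[where B=1]) (auto simp: power_le_one)
  have "emeasure (label_measure p) ?E = emeasure (label_measure p) (\<Union>c\<in>UNIV. B c)"
    by (rule arg_cong2[where f=emeasure]) (auto simp: B_def)
  also have "\<dots> = (\<integral>\<^sup>+c. emeasure (label_measure p) (B c) \<partial>count_space UNIV)"
  proof (rule emeasure_UN_countable)
    show "disjoint_family_on B UNIV"
      by (auto simp: disjoint_family_on_def B_def)
  qed (simp_all add: B)
  also have "\<dots> = (\<integral>\<^sup>+c. ennreal (pmf p c) * ennreal (of_bool (R c) * prob (A c) ^ k c) \<partial>count_space UNIV)"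
  proof (rule nn_integral_cong)
    fix c
    show "emeasure (label_measure p) (B c)
        = ennreal (pmf p c) * ennreal (of_bool (R c) * prob (A c) ^ k c)"
      unfolding B_def emeasure_eq_measure
      by (cases "R c") (simp_all add: measure_root_and_subtrees[OF A] ennreal_mult)
  qed
  also have "\<dots> = (\<integral>\<^sup>+c. ennreal (of_bool (R c) * prob (A c) ^ k c) \<partial>measure_pmf p)"
    by (simp add: nn_integral_measure_pmf)
  also have "\<dots> = ennreal (measure_pmf.expectation p (\<lambda>c. of_bool (R c) * prob (A c) ^ k c))"
    by (rule nn_integral_eq_integral[OF int]) auto
  finally show ?thesis
    by (simp add: emeasure_eq_measure integral_nonneg_AE)
qed

lemma expectation_pair_pmf:
  fixes f :: "'a \<times> 'b \<Rightarrow> real"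
  assumes f: "\<And>x. 0 \<le> f x" "\<And>x. f x \<le> 1"
  shows "measure_pmf.expectation (pair_pmf p q) f
    = measure_pmf.expectation p (\<lambda>a. measure_pmf.expectation q (\<lambda>b. f (a, b)))"
proof -
  have int: "integrable (measure_pmf r) g" if "\<And>x. 0 \<le> g x" "\<And>x. g x \<le> 1"
    for g :: "'d \<Rightarrow> real" and r
    by (rule measure_pmf.integrable_const_bound[where B=1]) (auto simp: that)
  have q: "0 \<le> measure_pmf.expectation q (\<lambda>b. f (a, b))"
    "measure_pmf.expectation q (\<lambda>b. f (a, b)) \<le> 1" for a
    using measure_pmf.integral_le_const[OF int[of "\<lambda>b. f (a, b)" q], of 1]
    by (auto intro!: integral_nonneg_AE simp: f)
  have "ennreal (measure_pmf.expectation (pair_pmf p q) f) = (\<integral>\<^sup>+x. ennreal (f x) \<partial>pair_pmf p q)"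
    by (intro nn_integral_eq_integral[symmetric] int f) (simp add: f)
  also have "\<dots> = (\<integral>\<^sup>+a. \<integral>\<^sup>+b. ennreal (f (a, b)) \<partial>q \<partial>p)"
    by (rule nn_integral_pair_pmf')
  also have "\<dots> = (\<integral>\<^sup>+a. ennreal (measure_pmf.expectation q (\<lambda>b. f (a, b))) \<partial>p)"
    by (intro nn_integral_cong nn_integral_eq_integral int f) (simp add: f)
  also have "\<dots> = ennreal (measure_pmf.expectation p (\<lambda>a. measure_pmf.expectation q (\<lambda>b. f (a, b))))"
    by (intro nn_integral_eq_integral int q) (simp add: q)
  finally show ?thesis
    by (subst (asm) ennreal_inj) (auto intro!: integral_nonneg_AE simp: f q)
qed

lemma measurable_to_label_measure:
  fixes \<theta> :: "(int ^ 'n) pmf"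
  shows "(\<lambda>(N, \<xi>) v. (\<xi> v, N v)) \<in> snake_measure \<mu> \<theta> \<rightarrow>\<^sub>M label_measure (pair_pmf \<theta> \<mu>)"
proof -
  have eq: "snake_measure \<mu> \<theta> = label_measure \<mu> \<Otimes>\<^sub>M label_measure \<theta>"
    by (simp add: snake_measure_def label_measure_def)
  have h1: "(\<lambda>\<omega>. (\<lambda>(N, \<xi>) v :: nat list. (\<xi> v, N v)) \<omega> v) \<in> snake_measure \<mu> \<theta> \<rightarrow>\<^sub>M measure_pmf (pair_pmf \<theta> \<mu>)" for v
  proof -
    have "(\<lambda>\<omega>. snd \<omega> v) \<in> snake_measure \<mu> \<theta> \<rightarrow>\<^sub>M count_space UNIV"
      unfolding eq by (rule measurable_compose[OF measurable_snd measurable_label])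
    moreover have "(\<lambda>\<omega>. fst \<omega> v) \<in> snake_measure \<mu> \<theta> \<rightarrow>\<^sub>M count_space UNIV"
      unfolding eq by (rule measurable_compose[OF measurable_fst measurable_label])
    ultimately have "(\<lambda>\<omega>. (snd \<omega> v, fst \<omega> v)) \<in> snake_measure \<mu> \<theta> \<rightarrow>\<^sub>M count_space UNIV \<Otimes>\<^sub>M count_space UNIV"
      by (rule measurable_Pair)
    then have "(\<lambda>\<omega>. (snd \<omega> v, fst \<omega> v)) \<in> snake_measure \<mu> \<theta> \<rightarrow>\<^sub>M count_space (UNIV \<times> UNIV)"
      by (simp only: pair_measure_countable[OF countableI_type countableI_type])
    then show ?thesis
      by (simp only: case_prod_unfold UNIV_Times_UNIV measurable_pmf_measure2)
  qed
  show ?thesis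
    unfolding label_measure_def by (rule measurable_PiM_single'[OF h1]) auto
qed

text \<open>The two independent families of the snake form a single family of independent pairs of marks. The jump
  is listed first, so that integrals over the pair become an expectation over the jump
  of an expectation over the offspring number.\<close>

lemma distr_snake_measure:
  fixes \<theta> :: "(int ^ 'n) pmf"
  shows "distr (snake_measure \<mu> \<theta>) (label_measure (pair_pmf \<theta> \<mu>)) (\<lambda>(N, \<xi>) v. (\<xi> v, N v))
    = label_measure (pair_pmf \<theta> \<mu>)"
proof -
  interpret M: prob_space "label_measure \<mu>" by (rule prob_space_label_measure)
  interpret T: prob_space "label_measure \<theta>" by (rule prob_space_label_measure)
  interpret P: pair_prob_space "label_measure \<mu>" "label_measure \<theta>" ..
  interpret L: product_prob_space "\<lambda>_::nat list. measure_pmf (pair_pmf \<theta> \<mu>)" UNIV ..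
  have eq: "snake_measure \<mu> \<theta> = label_measure \<mu> \<Otimes>\<^sub>M label_measure \<theta>"
    by (simp add: snake_measure_def label_measure_def)
  let ?h = "\<lambda>(N, \<xi>) v :: nat list. (\<xi> v, N v)"
  have h: "?h \<in> snake_measure \<mu> \<theta> \<rightarrow>\<^sub>M PiM UNIV (\<lambda>_. measure_pmf (pair_pmf \<theta> \<mu>))"
    unfolding label_measure_def[symmetric] by (rule measurable_to_label_measure)
  have "distr (snake_measure \<mu> \<theta>) (label_measure (pair_pmf \<theta> \<mu>)) ?h
      = PiM UNIV (\<lambda>_. measure_pmf (pair_pmf \<theta> \<mu>))"
  proof (rule L.PiM_eq)
    fix J :: "nat list set" and F :: "nat list \<Rightarrow> ((int ^ 'n) \<times> nat) set"
    assume J: "finite J"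
    define E where "E = prod_emb UNIV (\<lambda>_. measure_pmf (pair_pmf \<theta> \<mu>)) J (Pi\<^sub>E J F)"
    have E: "E \<in> sets (PiM UNIV (\<lambda>_. measure_pmf (pair_pmf \<theta> \<mu>)))"
      unfolding E_def by (rule sets_PiM_I) (auto simp: J)
    have E_iff: "\<omega> \<in> E \<longleftrightarrow> (\<forall>j\<in>J. \<omega> j \<in> F j)" for \<omega>
      by (auto simp: E_def prod_emb_def)
    define E' where "E' = ?h -` E \<inter> space (snake_measure \<mu> \<theta>)"
    have E': "E' \<in> sets (label_measure \<mu> \<Otimes>\<^sub>M label_measure \<theta>)"
      unfolding E'_def eq[symmetric] by (rule measurable_sets[OF h E])
    have slice: "emeasure (label_measure \<theta>) (Pair N -` E') = (\<Prod>j\<in>J. emeasure \<theta> {z. (z, N j) \<in> F j})" for N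
    proof -
      have "Pair N -` E' = prod_emb UNIV (\<lambda>_. measure_pmf \<theta>) J (\<Pi>\<^sub>E j\<in>J. {z. (z, N j) \<in> F j})"
        by (auto simp: E'_def E_iff eq space_pair_measure prod_emb_def)
      then show ?thesis
        unfolding label_measure_def
        by (simp add: emeasure_PiM_emb measure_pmf.prob_space_axioms J)
    qed
    have "emeasure (distr (snake_measure \<mu> \<theta>) (label_measure (pair_pmf \<theta> \<mu>)) ?h) E
        = emeasure (snake_measure \<mu> \<theta>) E'"
      unfolding E'_def label_measure_def by (rule emeasure_distr[OF h E])
    also have "\<dots> = (\<integral>\<^sup>+N. emeasure (label_measure \<theta>) (Pair N -` E') \<partial>label_measure \<mu>)"
      unfolding eq by (rule T.emeasure_pair_measure_alt[OF E'])
    also have "\<dots> = (\<integral>\<^sup>+N. (\<Prod>j\<in>J. emeasure \<theta> {z. (z, N j) \<in> F j}) \<partial>label_measure \<mu>)"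
      by (simp add: slice)
    also have "\<dots> = (\<Prod>j\<in>J. \<integral>\<^sup>+N. emeasure \<theta> {z. (z, N j) \<in> F j} \<partial>label_measure \<mu>)"
    proof (rule M.indep_vars_nn_integral[OF J])
      have "M.indep_vars (\<lambda>_. measure_pmf \<mu>) (\<lambda>v \<omega>. \<omega> v) J"
        by (rule M.indep_vars_subset[OF indep_vars_label]) simp
      then show "M.indep_vars (\<lambda>_. borel) (\<lambda>j N. emeasure \<theta> {z. (z, N j) \<in> F j}) J"
        by (rule M.indep_vars_compose2[where Y="\<lambda>j n. emeasure \<theta> {z. (z, n) \<in> F j}"]) simp
    qed simp
    also have "\<dots> = (\<Prod>j\<in>J. emeasure (pair_pmf \<theta> \<mu>) (F j))"
    proof (rule prod.cong[OF refl])
      fix j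
      have d: "distr (label_measure \<mu>) (measure_pmf \<mu>) (\<lambda>\<omega>. \<omega> j) = measure_pmf \<mu>"
        unfolding label_measure_def
        by (rule distr_PiM_component) (auto simp: measure_pmf.prob_space_axioms)
      have m: "(\<lambda>\<omega>. \<omega> j) \<in> label_measure \<mu> \<rightarrow>\<^sub>M measure_pmf \<mu>"
        unfolding label_measure_def by (rule measurable_component_singleton) simp
      have "(\<integral>\<^sup>+N. emeasure \<theta> {z. (z, N j) \<in> F j} \<partial>label_measure \<mu>)
          = (\<integral>\<^sup>+n. emeasure \<theta> {z. (z, n) \<in> F j} \<partial>distr (label_measure \<mu>) (measure_pmf \<mu>) (\<lambda>\<omega>. \<omega> j))"
        by (rule nn_integral_distr[OF m, symmetric]) simp
      also have "\<dots> = (\<integral>\<^sup>+n. \<integral>\<^sup>+z. indicator (F j) (z, n) \<partial>\<theta> \<partial>\<mu>)"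
      proof -
        have "indicator (F j) (z, n) = (indicator {z. (z, n) \<in> F j} z :: ennreal)" for z n
          by (simp add: indicator_def)
        then show ?thesis unfolding d by simp
      qed
      also have "\<dots> = (\<integral>\<^sup>+x. indicator (F j) (prod.swap x) \<partial>pair_pmf \<mu> \<theta>)"
        by (simp add: nn_integral_pair_pmf')
      also have "\<dots> = (\<integral>\<^sup>+x. indicator (F j) x \<partial>pair_pmf \<theta> \<mu>)"
        by (subst pair_commute_pmf[of \<theta> \<mu>]) (simp add: case_prod_unfold prod.swap_def)
      finally show "(\<integral>\<^sup>+N. emeasure \<theta> {z. (z, N j) \<in> F j} \<partial>label_measure \<mu>)
          = emeasure (pair_pmf \<theta> \<mu>) (F j)" by simp
    qed
    finally show "emeasure (distr (snake_measure \<mu> \<theta>) (label_measure (pair_pmf \<theta> \<mu>)) ?h)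
        (prod_emb UNIV (\<lambda>_. measure_pmf (pair_pmf \<theta> \<mu>)) J (Pi\<^sub>E J F))
      = (\<Prod>j\<in>J. emeasure (measure_pmf (pair_pmf \<theta> \<mu>)) (F j))" by (simp add: E_def)
  qed (simp add: label_measure_def)
  then show ?thesis unfolding label_measure_def .
qed

section \<open>The recursion for the visiting probabilities\<close>

text \<open>The probability that at least one of \<open>N\<close> independent trials succeeds, if each does so with probability \<open>p\<close>
  and \<open>N\<close> has law \<open>\<mu>\<close>.\<close>

definition visit_fun :: "nat pmf \<Rightarrow> real \<Rightarrow> real" where
  "visit_fun \<mu> p = 1 - measure_pmf.expectation \<mu> (\<lambda>k. (1 - p) ^ k)"

definition jump_mean :: "'a::plus pmf \<Rightarrow> ('a \<Rightarrow> real) \<Rightarrow> 'a \<Rightarrow> real" where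
  "jump_mean \<theta> h x = measure_pmf.expectation \<theta> (\<lambda>z. h (x + z))"

text \<open>The probability of visiting \<open>K\<close> before generation \<open>n\<close>; see \<open>measure_avoids\<close>.\<close>

fun visit_iter :: "nat pmf \<Rightarrow> 'a::plus pmf \<Rightarrow> 'a set \<Rightarrow> nat \<Rightarrow> 'a \<Rightarrow> real" where
  "visit_iter \<mu> \<theta> K 0 x = 0"
| "visit_iter \<mu> \<theta> K (Suc n) x =
    (if x \<in> K then 1 else visit_fun \<mu> (jump_mean \<theta> (visit_iter \<mu> \<theta> K n) x))"

lemma offspring_tree_Cons:
  "i # w \<in> offspring_tree N \<longleftrightarrow> i < N [] \<and> w \<in> offspring_tree (\<lambda>v. N (i # v))"
  by (auto simp: offspring_tree_iff nth_Cons' gr0_conv_Suc less_Suc_eq_0_disj)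

lemma snake_Cons: "snake x \<xi> (i # w) = snake (x + \<xi> [i]) (\<lambda>v. \<xi> (i # v)) w"
proof -
  have "(\<Sum>k = 1..length (i # w). \<xi> (take k (i # w))) = \<xi> [i] + (\<Sum>k = Suc 1..Suc (length w). \<xi> (take k (i # w)))"
    using sum.atLeast_Suc_atMost[of 1 "Suc (length w)" "\<lambda>k. \<xi> (take k (i # w))"] by simp
  also have "(\<Sum>k = Suc 1..Suc (length w). \<xi> (take k (i # w))) = (\<Sum>k = 1..length w. \<xi> (i # take k w))"
    by (subst sum.shift_bounds_cl_Suc_ivl) simp
  finally show ?thesis by (simp add: snake_def add.assoc)
qed

primrec avoids ::
  "(int ^ 'n) set \<Rightarrow> nat \<Rightarrow> int ^ 'n \<Rightarrow> (nat list \<Rightarrow> (int ^ 'n) \<times> nat) \<Rightarrow> bool" where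
  "avoids K 0 x \<omega> \<longleftrightarrow> True"
| "avoids K (Suc n) x \<omega> \<longleftrightarrow> x \<notin> K \<and>
    (\<forall>i < snd (\<omega> []). avoids K n (x + fst (\<omega> [i])) (\<lambda>v. \<omega> (i # v)))"

text \<open>The recursion unfolds the first generation, whereas the definition of a snake sums along the whole branch.\<close>

lemma avoids_iff:
  "avoids K n x \<omega> \<longleftrightarrow>
    (\<forall>v \<in> offspring_tree (\<lambda>v. snd (\<omega> v)). length v < n \<longrightarrow> snake x (\<lambda>v. fst (\<omega> v)) v \<notin> K)"
proof (induction n arbitrary: x \<omega>)
  case (Suc n)
  let ?P = "\<lambda>v. length v < Suc n \<longrightarrow> snake x (\<lambda>v. fst (\<omega> v)) v \<notin> K"
  have "(\<forall>v \<in> offspring_tree (\<lambda>v. snd (\<omega> v)). ?P v)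
    \<longleftrightarrow> ?P [] \<and> (\<forall>i w. i # w \<in> offspring_tree (\<lambda>v. snd (\<omega> v)) \<longrightarrow> ?P (i # w))"
    by (metis list.exhaust offspring_tree.root)
  also have "\<dots> \<longleftrightarrow> x \<notin> K \<and> (\<forall>i < snd (\<omega> []). \<forall>w \<in> offspring_tree (\<lambda>v. snd (\<omega> (i # v))).
      length w < n \<longrightarrow> snake (x + fst (\<omega> [i])) (\<lambda>v. fst (\<omega> (i # v))) w \<notin> K)"
    by (auto simp: offspring_tree_Cons snake_Cons) (auto simp: snake_def)
  finally show ?case
    by (simp add: Suc.IH)
qed simp

lemma snake_visits_iff_not_avoids:
  "snake_visits x (\<lambda>v. snd (\<omega> v)) (\<lambda>v. fst (\<omega> v)) K \<longleftrightarrow> (\<exists>n. \<not> avoids K n x \<omega>)"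
  unfolding snake_visits_def avoids_iff by blast

lemma avoids_decseq: "decseq (\<lambda>n. {\<omega>. avoids K n x \<omega>})"
  by (auto simp: decseq_def avoids_iff)

lemma jump_mean_bounds:
  assumes "\<And>y. 0 \<le> h y" "\<And>y. h y \<le> 1"
  shows "0 \<le> jump_mean \<theta> h x" "jump_mean \<theta> h x \<le> 1"
proof -
  have int: "integrable (measure_pmf \<theta>) (\<lambda>z. h (x + z))"
    by (rule measure_pmf.integrable_const_bound[where B=1]) (auto simp: assms)
  show "0 \<le> jump_mean \<theta> h x"
    unfolding jump_mean_def by (rule integral_nonneg_AE) (simp add: assms)
  show "jump_mean \<theta> h x \<le> 1"
    unfolding jump_mean_def by (rule measure_pmf.integral_le_const[OF int]) (simp add: assms)
qed

lemma visit_fun_bounds: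
  assumes "0 \<le> p" "p \<le> 1"
  shows "0 \<le> visit_fun \<mu> p" "visit_fun \<mu> p \<le> 1"
proof -
  have int: "integrable (measure_pmf \<mu>) (\<lambda>k. (1 - p) ^ k)"
    by (rule measure_pmf.integrable_const_bound[where B=1]) (auto simp: assms power_le_one)
  show "0 \<le> visit_fun \<mu> p"
    unfolding visit_fun_def using measure_pmf.integral_le_const[OF int, of 1]
    by (simp add: assms power_le_one)
  show "visit_fun \<mu> p \<le> 1"
    unfolding visit_fun_def by (simp add: assms integral_nonneg_AE)
qed

lemma visit_iter_bounds: "0 \<le> visit_iter \<mu> \<theta> K n x" "visit_iter \<mu> \<theta> K n x \<le> 1"
proof -
  have "0 \<le> visit_iter \<mu> \<theta> K n x \<and> visit_iter \<mu> \<theta> K n x \<le> 1"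
    by (induction n arbitrary: x) (auto intro: visit_fun_bounds jump_mean_bounds)
  then show "0 \<le> visit_iter \<mu> \<theta> K n x" "visit_iter \<mu> \<theta> K n x \<le> 1" by auto
qed

lemma one_minus_jump_mean:
  assumes "\<And>y. 0 \<le> h y" "\<And>y. h y \<le> 1"
  shows "jump_mean \<theta> (\<lambda>y. 1 - h y) x = 1 - jump_mean \<theta> h x"
proof -
  have int: "integrable (measure_pmf \<theta>) (\<lambda>z. h (x + z))"
    by (rule measure_pmf.integrable_const_bound[where B=1]) (auto simp: assms)
  then show ?thesis by (simp add: jump_mean_def)
qed

text \<open>The induction is run simultaneously for the snake from \<open>x\<close> and for the snake that starts with a jump from
  \<open>x\<close>, namely the mark that the root carries: the subtrees at the children of the root are
  of the second kind, and in this form they involve disjoint sets of marks.\<close>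

lemma measure_avoids:
  fixes \<theta> :: "(int ^ 'n) pmf" and \<mu> :: "nat pmf"
  defines "P \<equiv> label_measure (pair_pmf \<theta> \<mu>)"
  shows "{\<omega>. avoids K n (x + fst (\<omega> [])) \<omega>} \<in> sets P \<and> {\<omega>. avoids K n x \<omega>} \<in> sets P \<and>
    measure P {\<omega>. avoids K n (x + fst (\<omega> [])) \<omega>} = 1 - jump_mean \<theta> (visit_iter \<mu> \<theta> K n) x \<and>
    measure P {\<omega>. avoids K n x \<omega>} = 1 - visit_iter \<mu> \<theta> K n x"
proof (induction n arbitrary: x)
  case 0
  interpret prob_space P unfolding P_def by (rule prob_space_label_measure)
  have sp: "UNIV = space P" by (simp add: P_def)
  show ?case
    by (simp add: jump_mean_def) (simp add: sp prob_space)
next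
  case (Suc n)
  define A where "A y = {\<omega>. avoids K n (y + fst (\<omega> [])) \<omega>}" for y
  let ?h = "jump_mean \<theta> (visit_iter \<mu> \<theta> K n)"
  have A: "A y \<in> sets P" "measure P (A y) = 1 - ?h y" for y
    using Suc.IH by (auto simp: A_def)
  have q: "measure_pmf.expectation \<mu> (\<lambda>k. of_bool (y \<notin> K) * (1 - ?h y) ^ k)
      = 1 - visit_iter \<mu> \<theta> K (Suc n) y" for y
    by (cases "y \<in> K") (simp_all add: visit_fun_def)
  have eq1: "{\<omega>. avoids K (Suc n) x \<omega>}
    = {\<omega>. x \<notin> K \<and> (\<forall>i < snd (\<omega> []). (\<lambda>v. \<omega> (i # v)) \<in> A x)}"
    by (simp add: A_def)
  have eq2: "{\<omega>. avoids K (Suc n) (x + fst (\<omega> [])) \<omega>}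
    = {\<omega>. x + fst (\<omega> []) \<notin> K \<and> (\<forall>i < snd (\<omega> []). (\<lambda>v. \<omega> (i # v)) \<in> A (x + fst (\<omega> [])))}"
    by (simp add: A_def)
  have m1: "{\<omega>. avoids K (Suc n) x \<omega>} \<in> sets P"
    unfolding eq1 P_def
    by (rule measurable_root_and_subtrees[where R="\<lambda>_. x \<notin> K" and k=snd and A="\<lambda>_. A x"])
      (use A in \<open>simp add: P_def\<close>)
  have m2: "{\<omega>. avoids K (Suc n) (x + fst (\<omega> [])) \<omega>} \<in> sets P"
    unfolding eq2 P_def
    by (rule measurable_root_and_subtrees[where R="\<lambda>c. x + fst c \<notin> K" and k=snd
          and A="\<lambda>c. A (x + fst c)"]) (use A in \<open>simp add: P_def\<close>)
  have hb: "0 \<le> ?h y" "?h y \<le> 1" for y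
    by (intro jump_mean_bounds visit_iter_bounds)+
  have "measure P {\<omega>. avoids K (Suc n) x \<omega>}
      = measure_pmf.expectation (pair_pmf \<theta> \<mu>) (\<lambda>c. of_bool (x \<notin> K) * measure P (A x) ^ snd c)"
    unfolding eq1 P_def
    by (rule branching_property[where R="\<lambda>_. x \<notin> K" and k=snd and A="\<lambda>_. A x"])
      (use A in \<open>simp add: P_def\<close>)
  also have "\<dots> = 1 - visit_iter \<mu> \<theta> K (Suc n) x"
    unfolding A(2) expectation_pair_pmf_snd[of \<theta> \<mu> "\<lambda>k. of_bool (x \<notin> K) * (1 - ?h x) ^ k"]
    by (rule q)
  finally have e1: "measure P {\<omega>. avoids K (Suc n) x \<omega>} = 1 - visit_iter \<mu> \<theta> K (Suc n) x" .
  have "measure P {\<omega>. avoids K (Suc n) (x + fst (\<omega> [])) \<omega>}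
      = measure_pmf.expectation (pair_pmf \<theta> \<mu>)
          (\<lambda>c. of_bool (x + fst c \<notin> K) * measure P (A (x + fst c)) ^ snd c)"
    unfolding eq2 P_def
    by (rule branching_property[where R="\<lambda>c. x + fst c \<notin> K" and k=snd and A="\<lambda>c. A (x + fst c)"])
      (use A in \<open>simp add: P_def\<close>)
  also have "\<dots> = measure_pmf.expectation \<theta> (\<lambda>z. measure_pmf.expectation \<mu>
      (\<lambda>k. of_bool (x + z \<notin> K) * (1 - ?h (x + z)) ^ k))"
    unfolding A(2) by (subst expectation_pair_pmf) (auto simp: hb power_le_one)
  also have "\<dots> = jump_mean \<theta> (\<lambda>y. 1 - visit_iter \<mu> \<theta> K (Suc n) y) x"
    unfolding jump_mean_def[of \<theta> "\<lambda>y. 1 - visit_iter \<mu> \<theta> K (Suc n) y"] q ..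
  also have "\<dots> = 1 - jump_mean \<theta> (visit_iter \<mu> \<theta> K (Suc n)) x"
    by (rule one_minus_jump_mean) (rule visit_iter_bounds)+
  finally show ?case using m1 m2 e1 by blast
qed

lemma visit_iter_tendsto_visit_prob:
  fixes \<theta> :: "(int ^ 'n) pmf"
  shows "(\<lambda>n. visit_iter \<mu> \<theta> K n x) \<longlonglongrightarrow>
    \<P>(\<omega> in snake_measure \<mu> \<theta>. snake_visits x (fst \<omega>) (snd \<omega>) K)"
proof -
  let ?P = "label_measure (pair_pmf \<theta> \<mu>)"
  interpret P: prob_space ?P by (rule prob_space_label_measure)
  interpret S: prob_space "snake_measure \<mu> \<theta>" by (rule prob_space_snake_measure)
  let ?h = "\<lambda>(N :: nat list \<Rightarrow> nat, \<xi> :: nat list \<Rightarrow> int ^ 'n) v :: nat list. (\<xi> v, N v)"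
  define A where "A = (\<Inter>n. {\<omega>. avoids K n x \<omega>})"
  have sets: "{\<omega>. avoids K n x \<omega>} \<in> sets ?P" for n
    using measure_avoids[of K n x \<theta> \<mu>] by blast
  have "(\<lambda>n. P.prob {\<omega>. avoids K n x \<omega>}) \<longlonglongrightarrow> P.prob A"
    unfolding A_def by (rule P.finite_Lim_measure_decseq) (auto simp: sets avoids_decseq)
  then have lim: "(\<lambda>n. 1 - visit_iter \<mu> \<theta> K n x) \<longlonglongrightarrow> P.prob A"
    using measure_avoids[of K _ x \<theta> \<mu>] by simp
  have A_sets: "A \<in> sets ?P"
    unfolding A_def using sets by auto
  let ?V = "{\<omega> \<in> space (snake_measure \<mu> \<theta>). snake_visits x (fst \<omega>) (snd \<omega>) K}"
  have pre: "?h -` A \<inter> space (snake_measure \<mu> \<theta>) = space (snake_measure \<mu> \<theta>) - ?V"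
    using snake_visits_iff_not_avoids[of x "?h _" K]
    by (auto simp: A_def case_prod_unfold)
  have h: "?h \<in> snake_measure \<mu> \<theta> \<rightarrow>\<^sub>M ?P"
    by (rule measurable_to_label_measure)
  have "P.prob A = measure (distr (snake_measure \<mu> \<theta>) ?P ?h) A"
    unfolding distr_snake_measure ..
  also have "\<dots> = S.prob (?h -` A \<inter> space (snake_measure \<mu> \<theta>))"
    by (rule measure_distr[OF h A_sets])
  also have "\<dots> = 1 - S.prob ?V"
    unfolding pre by (rule S.prob_compl) (rule measurable_snake_visits)
  finally have "P.prob A = 1 - S.prob ?V" .
  then have "(\<lambda>n. 1 - (1 - visit_iter \<mu> \<theta> K n x)) \<longlonglongrightarrow> 1 - (1 - S.prob ?V)"
    using tendsto_diff[OF tendsto_const lim, of 1] by simp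
  then show ?thesis by simp
qed

section \<open>The nonlinearity of a critical offspring law\<close>

text \<open>The gap in Bernoulli's inequality. Its expectation is the loss \<open>p - visit_fun \<mu> p\<close> caused by
  several children succeeding at once, so that bounds on the gap become bounds on the nonlinearity.\<close>

definition bernoulli_gap :: "real \<Rightarrow> nat \<Rightarrow> real" where
  "bernoulli_gap p k = (1 - p) ^ k - 1 + real k * p"

lemma bernoulli_gap_Suc: "bernoulli_gap p (Suc k) = bernoulli_gap p k + p * (1 - (1 - p) ^ k)"
  by (simp add: bernoulli_gap_def algebra_simps)

lemma bernoulli_gap_nonneg: "0 \<le> p \<Longrightarrow> p \<le> 1 \<Longrightarrow> 0 \<le> bernoulli_gap p k"
  by (induction k) (simp add: bernoulli_gap_def, simp add: bernoulli_gap_Suc power_le_one)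

lemma bernoulli_gap_upper:
  assumes "0 \<le> p" "p \<le> 1"
  shows "bernoulli_gap p k \<le> real k * (real k - 1) / 2 * p\<^sup>2"
proof (induction k)
  case (Suc k)
  have "1 - (1 - p) ^ k \<le> real k * p"
    using bernoulli_gap_nonneg[OF assms, of k] by (simp add: bernoulli_gap_def)
  then have "p * (1 - (1 - p) ^ k) \<le> p * (real k * p)"
    using assms by (intro mult_left_mono)
  with Suc.IH show ?case
    unfolding bernoulli_gap_Suc by (simp add: field_simps power2_eq_square)
qed (simp add: bernoulli_gap_def)

lemma bernoulli_gap_lower:
  assumes "0 \<le> p" "p \<le> 1"
  shows "bernoulli_gap p k \<ge> real k * (real k - 1) / 2 * p\<^sup>2 - real k ^ 3 * p ^ 3"
proof (induction k)
  case (Suc k)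
  have "real k * p - real k * (real k - 1) / 2 * p\<^sup>2 \<le> 1 - (1 - p) ^ k"
    using bernoulli_gap_upper[OF assms, of k] by (simp add: bernoulli_gap_def)
  then have 1: "p * (real k * p - real k * (real k - 1) / 2 * p\<^sup>2) \<le> p * (1 - (1 - p) ^ k)"
    using assms by (intro mult_left_mono)
  have "real k ^ 3 + real k * (real k - 1) / 2 \<le> real (Suc k) ^ 3"
    by (simp add: field_simps power3_eq_cube)
  then have "(real k ^ 3 + real k * (real k - 1) / 2) * p ^ 3 \<le> real (Suc k) ^ 3 * p ^ 3"
    using assms by (intro mult_right_mono) simp_all
  with Suc.IH 1 show ?case
    unfolding bernoulli_gap_Suc
    by (simp add: algebra_simps power2_eq_square power3_eq_cube) argo
qed (simp add: bernoulli_gap_def)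

lemma bernoulli_gap_lower_square:
  assumes "0 \<le> p" "p \<le> 1" "2 \<le> k"
  shows "p\<^sup>2 \<le> bernoulli_gap p k"
  using assms(3)
proof (induction k rule: dec_induct)
  case base
  show ?case by (simp add: bernoulli_gap_def power2_eq_square algebra_simps)
next
  case (step k)
  then show ?case using assms by (simp add: bernoulli_gap_Suc power_le_one add_increasing2)
qed

locale critical_offspring =
  fixes \<mu> :: "nat pmf" and \<sigma> :: real
  assumes integrable_offspring: "integrable (measure_pmf \<mu>) real"
    and mean_offspring: "measure_pmf.expectation \<mu> real = 1"
    and square_integrable_offspring: "integrable (measure_pmf \<mu>) (\<lambda>k. (real k)\<^sup>2)"
    and variance_offspring: "measure_pmf.variance \<mu> real = \<sigma>\<^sup>2"
    and variance_pos: "\<sigma>\<^sup>2 > 0"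
begin

lemma factorial_moment:
  "integrable (measure_pmf \<mu>) (\<lambda>k. real k * (real k - 1))"
  "measure_pmf.expectation \<mu> (\<lambda>k. real k * (real k - 1)) = \<sigma>\<^sup>2"
proof -
  have eq: "(\<lambda>k. real k * (real k - 1)) = (\<lambda>k. (real k)\<^sup>2 - real k)"
    by (simp add: algebra_simps power2_eq_square)
  show "integrable (measure_pmf \<mu>) (\<lambda>k. real k * (real k - 1))"
    unfolding eq by (intro Bochner_Integration.integrable_diff integrable_offspring square_integrable_offspring)
  have "\<sigma>\<^sup>2 = measure_pmf.expectation \<mu> (\<lambda>k. (real k)\<^sup>2) - 1"
    using measure_pmf.variance_eq[OF integrable_offspring square_integrable_offspring]
      variance_offspring
    by (simp add: mean_offspring)
  then show "measure_pmf.expectation \<mu> (\<lambda>k. real k * (real k - 1)) = \<sigma>\<^sup>2"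
    unfolding eq using integrable_offspring square_integrable_offspring by (simp add: mean_offspring)
qed

lemma integrable_power:
  fixes p :: real
  assumes "0 \<le> p" "p \<le> 1"
  shows "integrable (measure_pmf \<mu>) (\<lambda>k. (1 - p) ^ k)"
  by (rule measure_pmf.integrable_const_bound[where B=1]) (auto simp: assms power_le_one)

lemma visit_fun_eq:
  assumes "0 \<le> p" "p \<le> 1"
  shows "integrable (measure_pmf \<mu>) (bernoulli_gap p)"
    "visit_fun \<mu> p = p - measure_pmf.expectation \<mu> (bernoulli_gap p)"
  using integrable_power[OF assms] integrable_offspring
  by (simp_all add: bernoulli_gap_def[abs_def] visit_fun_def mean_offspring)

lemma visit_fun_mono:
  assumes "0 \<le> p" "p \<le> q" "q \<le> 1"
  shows "visit_fun \<mu> p \<le> visit_fun \<mu> q"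
proof -
  have "measure_pmf.expectation \<mu> (\<lambda>k. (1 - q) ^ k) \<le> measure_pmf.expectation \<mu> (\<lambda>k. (1 - p) ^ k)"
    using assms by (intro integral_mono integrable_power power_mono) auto
  then show ?thesis by (simp add: visit_fun_def)
qed

lemma visit_fun_Lipschitz:
  assumes "0 \<le> p" "p \<le> q" "q \<le> 1"
  shows "visit_fun \<mu> q - visit_fun \<mu> p \<le> q - p"
proof -
  have "bernoulli_gap p k \<le> bernoulli_gap q k" for k
  proof (induction k)
    case (Suc k)
    have "p * (1 - (1 - p) ^ k) \<le> q * (1 - (1 - q) ^ k)"
      using assms by (intro mult_mono diff_left_mono power_mono) (auto simp: power_le_one)
    with Suc show ?case by (simp add: bernoulli_gap_Suc)
  qed (simp add: bernoulli_gap_def)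
  then have "measure_pmf.expectation \<mu> (bernoulli_gap p) \<le> measure_pmf.expectation \<mu> (bernoulli_gap q)"
    using assms by (intro integral_mono visit_fun_eq) auto
  with assms show ?thesis by (simp add: visit_fun_eq)
qed

lemma visit_fun_le:
  assumes "0 \<le> p" "p \<le> 1"
  shows "visit_fun \<mu> p \<le> p"
proof -
  have "0 \<le> measure_pmf.expectation \<mu> (bernoulli_gap p)"
    using assms by (intro integral_nonneg_AE) (auto simp: bernoulli_gap_nonneg)
  with assms show ?thesis by (simp add: visit_fun_eq)
qed

lemma visit_fun_ge:
  assumes "0 \<le> p" "p \<le> 1"
  shows "visit_fun \<mu> p \<ge> p - \<sigma>\<^sup>2 / 2 * p\<^sup>2"
proof -
  have "measure_pmf.expectation \<mu> (bernoulli_gap p)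
      \<le> measure_pmf.expectation \<mu> (\<lambda>k. real k * (real k - 1) * (p\<^sup>2 / 2))"
    using bernoulli_gap_upper[OF assms]
    by (intro integral_mono visit_fun_eq assms integrable_mult_left factorial_moment) (simp add: mult.commute)
  also have "\<dots> = \<sigma>\<^sup>2 * (p\<^sup>2 / 2)"
    using factorial_moment by simp
  finally show ?thesis
    using assms by (simp add: visit_fun_eq)
qed

text \<open>A gap of at least \<open>p\<^sup>2\<close> occurs as soon as there are two children, which has positive
  probability. The constant is not sharp, but the bound holds on all of the unit interval; it is used where
  no smallness of \<open>p\<close> is known yet.\<close>

lemma visit_fun_le_global:
  obtains c where "0 < c" "\<And>p. 0 \<le> p \<Longrightarrow> p \<le> 1 \<Longrightarrow> visit_fun \<mu> p \<le> p - c * p\<^sup>2"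
proof
  let ?c = "measure_pmf.prob \<mu> {2..}"
  show "0 < ?c"
  proof (rule ccontr)
    assume "\<not> 0 < ?c"
    then have "?c = 0" by (simp add: measure_pmf.prob_eq_0 measure_nonneg order_antisym not_less)
    then have "set_pmf \<mu> \<inter> {2..} = {}" by (simp add: measure_pmf_zero_iff)
    then have "k < 2" if "k \<in> set_pmf \<mu>" for k
      using that by (metis Int_iff atLeast_iff empty_iff not_less)
    then have "k = 0 \<or> k = 1" if "k \<in> set_pmf \<mu>" for k
      using that by (fastforce simp: less_2_cases_iff)
    then have "measure_pmf.expectation \<mu> (\<lambda>k. real k * (real k - 1)) = measure_pmf.expectation \<mu> (\<lambda>k. 0)"
      by (intro integral_cong_AE) (auto simp: AE_measure_pmf_iff)
    with factorial_moment(2) variance_pos show False by simp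
  qed
  fix p :: real assume p: "0 \<le> p" "p \<le> 1"
  have "measure_pmf.expectation \<mu> (\<lambda>k. p\<^sup>2 * indicator {2..} k) \<le> measure_pmf.expectation \<mu> (bernoulli_gap p)"
  proof (rule integral_mono)
    show "integrable (measure_pmf \<mu>) (\<lambda>k. p\<^sup>2 * indicator {2..} k)"
      by (rule measure_pmf.integrable_const_bound[where B="p\<^sup>2"]) (auto simp: indicator_def)
    show "p\<^sup>2 * indicator {2..} k \<le> bernoulli_gap p k" for k
      using p by (cases "2 \<le> k") (auto simp: bernoulli_gap_lower_square bernoulli_gap_nonneg)
  qed (rule visit_fun_eq[OF p])
  then show "visit_fun \<mu> p \<le> p - ?c * p\<^sup>2"
    using p by (simp add: visit_fun_eq mult.commute)
qed

text \<open>Only second moments are available, so the cubic error of the expansion is applied to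
  offspring numbers up to a truncation level \<open>M\<close>; the rest contributes a nonnegative gap.\<close>

lemma visit_fun_le_local:
  assumes "\<kappa> < \<sigma>\<^sup>2 / 2"
  obtains p\<^sub>0 where "0 < p\<^sub>0" "p\<^sub>0 \<le> 1"
    "\<And>p. 0 \<le> p \<Longrightarrow> p \<le> p\<^sub>0 \<Longrightarrow> visit_fun \<mu> p \<le> p - \<kappa> * p\<^sup>2"
proof -
  let ?g = "\<lambda>M k. indicator {..M} k * (real k * (real k - 1))"
  have g_int: "integrable (measure_pmf \<mu>) (?g M)" for M
    using factorial_moment(1)
    by (rule Bochner_Integration.integrable_bound) (auto simp: indicator_def)
  have "(\<lambda>M. measure_pmf.expectation \<mu> (?g M)) \<longlonglongrightarrow> measure_pmf.expectation \<mu> (\<lambda>k. real k * (real k - 1))"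
  proof (rule integral_dominated_convergence[where w="\<lambda>k. real k * (real k - 1)"])
    have "(\<lambda>M. ?g M k) \<longlonglongrightarrow> real k * (real k - 1)" for k
      by (rule tendsto_eventually) (auto simp: eventually_at_top_linorder indicator_def intro!: exI[of _ k])
    then show "AE k in measure_pmf \<mu>. (\<lambda>M. ?g M k) \<longlonglongrightarrow> real k * (real k - 1)" by simp
    have "norm (?g M k) \<le> real k * (real k - 1)" for M k
      by (cases k) (auto simp: indicator_def)
    then show "AE k in measure_pmf \<mu>. norm (?g M k) \<le> real k * (real k - 1)" for M by simp
  qed (auto simp: factorial_moment)
  then have "\<forall>\<^sub>F M in sequentially. measure_pmf.expectation \<mu> (?g M) > 2 * \<kappa>"
  proof (rule order_tendstoD(1))
    show "2 * \<kappa> < measure_pmf.expectation \<mu> (\<lambda>k. real k * (real k - 1))"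
      using assms by (simp add: factorial_moment(2))
  qed
  then obtain M where M: "measure_pmf.expectation \<mu> (?g M) > 2 * \<kappa>"
    by (auto simp: eventually_at_top_linorder)
  define \<delta> where "\<delta> = measure_pmf.expectation \<mu> (?g M) / 2 - \<kappa>"
  define p0 where "p0 = min 1 (\<delta> / (real M ^ 3 + 1))"
  have \<delta>: "\<delta> > 0" using M by (simp add: \<delta>_def)
  show ?thesis
  proof
    show "0 < p0" "p0 \<le> 1" using \<delta> by (simp_all add: p0_def add_nonneg_pos)
    fix p :: real assume p: "0 \<le> p" "p \<le> p0"
    then have p1: "p \<le> 1" by (simp add: p0_def)
    have "measure_pmf.expectation \<mu> (\<lambda>k. ?g M k * (p\<^sup>2 / 2) - real M ^ 3 * p ^ 3)
        \<le> measure_pmf.expectation \<mu> (bernoulli_gap p)"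
    proof (rule integral_mono)
      show "integrable (measure_pmf \<mu>) (\<lambda>k. ?g M k * (p\<^sup>2 / 2) - real M ^ 3 * p ^ 3)"
        by (intro Bochner_Integration.integrable_diff integrable_mult_left g_int) simp
      show "?g M k * (p\<^sup>2 / 2) - real M ^ 3 * p ^ 3 \<le> bernoulli_gap p k" for k
      proof (cases "k \<le> M")
        case True
        have "real k ^ 3 * p ^ 3 \<le> real M ^ 3 * p ^ 3"
          using True p by (intro mult_right_mono power_mono) auto
        with True bernoulli_gap_lower[OF p(1) p1, of k] show ?thesis by simp
      next
        case False
        have "0 \<le> real M ^ 3 * p ^ 3" using p by simp
        with False bernoulli_gap_nonneg[OF p(1) p1, of k] show ?thesis by simp
      qed
    qed (rule visit_fun_eq[OF p(1) p1])
    then have gap: "(\<delta> + \<kappa>) * p\<^sup>2 - real M ^ 3 * p ^ 3 \<le> measure_pmf.expectation \<mu> (bernoulli_gap p)"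
      using g_int[of M] by (simp add: \<delta>_def)
    have "p * (real M ^ 3 + 1) \<le> \<delta>"
      using p by (simp add: p0_def pos_le_divide_eq add_nonneg_pos)
    then have "real M ^ 3 * p \<le> \<delta>" using p by (simp add: algebra_simps)
    then have "real M ^ 3 * p * p\<^sup>2 \<le> \<delta> * p\<^sup>2" by (intro mult_right_mono) auto
    then have "real M ^ 3 * p ^ 3 \<le> \<delta> * p\<^sup>2" by (simp add: power2_eq_square power3_eq_cube mult.assoc)
    with gap show "visit_fun \<mu> p \<le> p - \<kappa> * p\<^sup>2"
      using p p1 by (simp add: visit_fun_eq algebra_simps)
  qed
qed

end

section \<open>The minimal solution of the visiting equation\<close>

lemma jump_mean_mono:
  assumes "\<And>y. 0 \<le> g y" "\<And>y. g y \<le> h y" "\<And>y. h y \<le> 1"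
  shows "jump_mean \<theta> g x \<le> jump_mean \<theta> h x"
proof -
  have "0 \<le> h y" "g y \<le> 1" for y using assms(1)[of y] assms(2)[of y] assms(3)[of y] by linarith+
  with assms show ?thesis
    unfolding jump_mean_def
    by (intro integral_mono measure_pmf.integrable_const_bound[where B=1]) auto
qed

definition visit_lim :: "nat pmf \<Rightarrow> 'a::plus pmf \<Rightarrow> 'a set \<Rightarrow> 'a \<Rightarrow> real" where
  "visit_lim \<mu> \<theta> K x = (SUP n. visit_iter \<mu> \<theta> K n x)"

context critical_offspring
begin

lemma visit_iter_le_Suc: "visit_iter \<mu> \<theta> K n x \<le> visit_iter \<mu> \<theta> K (Suc n) x"
proof (induction n arbitrary: x)
  case 0
  show ?case by (simp only: visit_iter.simps(1) visit_iter_bounds(1))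
next
  case (Suc n)
  have "jump_mean \<theta> (visit_iter \<mu> \<theta> K n) x \<le> jump_mean \<theta> (visit_iter \<mu> \<theta> K (Suc n)) x"
    by (intro jump_mean_mono visit_iter_bounds Suc.IH)
  then show ?case
    unfolding visit_iter.simps(2)[of \<mu> \<theta> K n x] visit_iter.simps(2)[of \<mu> \<theta> K "Suc n" x]
    using visit_fun_mono[OF jump_mean_bounds(1)[of "visit_iter \<mu> \<theta> K n", OF visit_iter_bounds] _
        jump_mean_bounds(2)[of "visit_iter \<mu> \<theta> K (Suc n)", OF visit_iter_bounds]]
    by (simp only: split: if_split) blast
qed

lemma visit_iter_incseq: "incseq (\<lambda>n. visit_iter \<mu> \<theta> K n x)"
  by (rule incseq_SucI) (rule visit_iter_le_Suc)

lemma visit_iter_LIMSEQ: "(\<lambda>n. visit_iter \<mu> \<theta> K n x) \<longlonglongrightarrow> visit_lim \<mu> \<theta> K x"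
  unfolding visit_lim_def
  by (rule LIMSEQ_incseq_SUP) (auto intro: visit_iter_incseq bdd_aboveI2[where M=1] visit_iter_bounds)

lemma visit_iter_le_visit_lim: "visit_iter \<mu> \<theta> K n x \<le> visit_lim \<mu> \<theta> K x"
  by (rule incseq_le[OF visit_iter_incseq visit_iter_LIMSEQ])

lemma visit_lim_bounds: "0 \<le> visit_lim \<mu> \<theta> K x" "visit_lim \<mu> \<theta> K x \<le> 1"
  using visit_iter_LIMSEQ[of \<theta> K x] visit_iter_bounds[of \<mu> \<theta> K]
  by (auto intro: LIMSEQ_le_const LIMSEQ_le_const2)

lemma visit_lim_on: "x \<in> K \<Longrightarrow> visit_lim \<mu> \<theta> K x = 1"
  using visit_iter_le_visit_lim[of \<theta> K 1 x] visit_lim_bounds(2)[of \<theta> K x] by simp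

lemma visit_lim_ge:
  assumes "x \<notin> K"
  shows "visit_fun \<mu> (jump_mean \<theta> (visit_lim \<mu> \<theta> K) x) \<le> visit_lim \<mu> \<theta> K x"
proof -
  let ?v = "visit_lim \<mu> \<theta> K" and ?J = "\<lambda>n. jump_mean \<theta> (visit_iter \<mu> \<theta> K n) x"
  have "?J \<longlonglongrightarrow> jump_mean \<theta> ?v x"
    unfolding jump_mean_def
    by (rule integral_dominated_convergence[where w="\<lambda>_. 1"])
      (auto intro: visit_iter_LIMSEQ simp: visit_iter_bounds abs_of_nonneg)
  then have lim: "(\<lambda>n. ?v x + (jump_mean \<theta> ?v x - ?J n)) \<longlonglongrightarrow> ?v x + (jump_mean \<theta> ?v x - jump_mean \<theta> ?v x)"
    by (intro tendsto_intros)
  have "visit_fun \<mu> (jump_mean \<theta> ?v x) \<le> ?v x + (jump_mean \<theta> ?v x - ?J n)" for n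
  proof -
    have "visit_fun \<mu> (jump_mean \<theta> ?v x) - visit_fun \<mu> (?J n) \<le> jump_mean \<theta> ?v x - ?J n"
      by (intro visit_fun_Lipschitz jump_mean_bounds jump_mean_mono visit_iter_bounds
          visit_lim_bounds visit_iter_le_visit_lim)
    moreover have "visit_fun \<mu> (?J n) \<le> ?v x"
      using visit_iter_le_visit_lim[of \<theta> K "Suc n" x] assms by simp
    ultimately show ?thesis by simp
  qed
  then have "visit_fun \<mu> (jump_mean \<theta> ?v x) \<le> ?v x + (jump_mean \<theta> ?v x - jump_mean \<theta> ?v x)"
    by (intro LIMSEQ_le_const[OF lim]) auto
  then show ?thesis by simp
qed

text \<open>All iterates stay below a supersolution. The alternative \<open>v \<le> u\<close> in the
  hypothesis allows \<open>u\<close> to be glued from \<open>v\<close> itself, near \<open>K\<close>, and an explicit function far away.\<close>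

lemma visit_lim_le_supersolution:
  assumes K: "\<And>x. x \<in> K \<Longrightarrow> 1 \<le> u x"
    and u: "\<And>x. 0 \<le> u x" "\<And>x. u x \<le> 1"
    and super: "\<And>x. x \<notin> K \<Longrightarrow> visit_lim \<mu> \<theta> K x \<le> u x \<or> visit_fun \<mu> (jump_mean \<theta> u x) \<le> u x"
  shows "visit_lim \<mu> \<theta> K x \<le> u x"
proof -
  have "visit_iter \<mu> \<theta> K n x \<le> u x" for n
  proof (induction n arbitrary: x)
    case (Suc n)
    show ?case
    proof (cases "x \<in> K")
      case False
      have "visit_fun \<mu> (jump_mean \<theta> (visit_iter \<mu> \<theta> K n) x) \<le> visit_fun \<mu> (jump_mean \<theta> u x)"
        by (intro visit_fun_mono jump_mean_bounds jump_mean_mono visit_iter_bounds u Suc.IH)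
      moreover have "visit_iter \<mu> \<theta> K (Suc n) x \<le> visit_lim \<mu> \<theta> K x"
        by (rule visit_iter_le_visit_lim)
      ultimately show ?thesis using super[OF False] False by auto
    qed (simp add: K)
  qed (simp add: u)
  then show ?thesis by (intro LIMSEQ_le_const2[OF visit_iter_LIMSEQ]) auto
qed

end

section \<open>Walks with a covariance form and the maximum principle\<close>

text \<open>What the analysis needs of the walk: a positive form in which the walk is
  isotropic with unit variance in each direction. The trace condition is where the dimension, four, enters.\<close>

locale walk_form =
  fixes \<theta> :: "'a::ab_group_add pmf" and \<beta> :: "'a \<Rightarrow> 'a \<Rightarrow> real"
  assumes form_add: "\<beta> (x + z) (x + z) = \<beta> x x + 2 * \<beta> x z + \<beta> z z"
    and form_nonneg: "0 \<le> \<beta> x x"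
    and form_Cauchy_Schwarz: "\<bar>\<beta> x z\<bar> \<le> sqrt (\<beta> x x) * sqrt (\<beta> z z)"
    and finite_sublevel: "finite {x. \<beta> x x \<le> M}"
    and moments: "integrable (measure_pmf \<theta>) (\<lambda>z. sqrt (\<beta> z z) ^ k)"
    and form_integrable: "integrable (measure_pmf \<theta>) (\<beta> x)"
    and form_mean: "measure_pmf.expectation \<theta> (\<beta> x) = 0"
    and form_sq_integrable: "integrable (measure_pmf \<theta>) (\<lambda>z. (\<beta> x z)\<^sup>2)"
    and form_variance: "measure_pmf.expectation \<theta> (\<lambda>z. (\<beta> x z)\<^sup>2) = \<beta> x x"
    and form_trace: "measure_pmf.expectation \<theta> (\<lambda>z. \<beta> z z) = 4"
begin

lemma integrable_form: "integrable (measure_pmf \<theta>) (\<lambda>z. \<beta> z z)"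
  using moments[of 2] by (simp add: form_nonneg)

text \<open>The maximum is attained on a finite set. At the point of this set with the largest form, every jump would have to
  stay in the set and hence not increase the form, contradicting that the form increases by \<open>4\<close> on average.\<close>

lemma subharmonic_vanishing:
  assumes D: "\<And>x. 0 \<le> D x" "\<And>x. D x \<le> 1"
    and sub: "\<And>x. D x \<le> jump_mean \<theta> D x"
    and decay: "\<And>e. e > 0 \<Longrightarrow> finite {x. e \<le> D x}"
  shows "D x = 0"
proof (rule ccontr)
  assume "D x \<noteq> 0"
  with D(1)[of x] have x: "D x > 0" by simp
  let ?A = "{y. D x \<le> D y}"
  define m where "m = Max (D ` ?A)"
  have fin: "finite ?A" by (rule decay[OF x])
  have "m \<in> D ` ?A" unfolding m_def using fin by (intro Max_in) auto
  moreover have mmax: "D y \<le> m" for y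
  proof (cases "y \<in> ?A")
    case True
    then show ?thesis unfolding m_def using fin by (intro Max_ge) auto
  next
    case False
    have "D x \<le> m" unfolding m_def using fin by (intro Max_ge) auto
    with False show ?thesis by simp
  qed
  moreover have "0 < m" using x mmax[of x] by simp
  define B where "B = {y. D y = m}"
  have "finite B" unfolding B_def by (rule finite_subset[OF _ decay[OF \<open>0 < m\<close>]]) auto
  ultimately have "B \<noteq> {}" by (auto simp: B_def)
  with \<open>finite B\<close> have "Max ((\<lambda>y. \<beta> y y) ` B) \<in> (\<lambda>y. \<beta> y y) ` B"
    by (intro Max_in) auto
  then obtain y where yB: "y \<in> B" and ymax: "Max ((\<lambda>y. \<beta> y y) ` B) = \<beta> y y" by auto
  have "\<beta> y' y' \<le> \<beta> y y" if "y' \<in> B" for y'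
    unfolding ymax[symmetric] using \<open>finite B\<close> that by (intro Max_ge) auto
  note y = yB this
  have int: "integrable (measure_pmf \<theta>) (\<lambda>z. D (y + z))"
    by (rule measure_pmf.integrable_const_bound[where B=1]) (auto simp: D)
  have "measure_pmf.expectation \<theta> (\<lambda>z. m - D (y + z)) \<le> 0"
    using sub[of y] y(1) int by (simp add: jump_mean_def B_def)
  moreover have "0 \<le> measure_pmf.expectation \<theta> (\<lambda>z. m - D (y + z))"
    by (intro integral_nonneg_AE) (simp add: mmax)
  ultimately have "measure_pmf.expectation \<theta> (\<lambda>z. m - D (y + z)) = 0" by simp
  then have "AE z in measure_pmf \<theta>. m - D (y + z) = 0"
    by (subst (asm) integral_nonneg_eq_0_iff_AE) (auto simp: mmax int)
  then have "AE z in measure_pmf \<theta>. 2 * \<beta> y z + \<beta> z z \<le> 0"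
  proof eventually_elim
    case (elim z)
    then have "\<beta> (y + z) (y + z) \<le> \<beta> y y" by (intro y(2)) (simp add: B_def)
    then show ?case by (simp add: form_add)
  qed
  then have "measure_pmf.expectation \<theta> (\<lambda>z. 2 * \<beta> y z + \<beta> z z) \<le> measure_pmf.expectation \<theta> (\<lambda>z. 0)"
    by (intro integral_mono_AE Bochner_Integration.integrable_add integrable_mult_right
        form_integrable integrable_form) auto
  then show False
    using form_integrable[of y] integrable_form by (simp add: form_mean form_trace)
qed

end

section \<open>The radial barrier\<close>

definition barrier :: "real \<Rightarrow> real \<Rightarrow> real" where
  "barrier B t = 1 / (t * (ln t - B))"

definition barrier1 :: "real \<Rightarrow> real \<Rightarrow> real" where
  "barrier1 B t = - (1 / (ln t - B) + 1 / (ln t - B)\<^sup>2) / t\<^sup>2"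

definition barrier2 :: "real \<Rightarrow> real \<Rightarrow> real" where
  "barrier2 B t = (2 / (ln t - B) + 3 / (ln t - B)\<^sup>2 + 2 / (ln t - B) ^ 3) / t ^ 3"

definition barrier3 :: "real \<Rightarrow> real \<Rightarrow> real" where
  "barrier3 B t = - (6 / (ln t - B) + 11 / (ln t - B)\<^sup>2 + 12 / (ln t - B) ^ 3 + 6 / (ln t - B) ^ 4) / t ^ 4"

lemma DERIV_barrier:
  assumes "0 < t" "B < ln t"
  shows "(barrier B has_real_derivative barrier1 B t) (at t)"
    "(barrier1 B has_real_derivative barrier2 B t) (at t)"
    "(barrier2 B has_real_derivative barrier3 B t) (at t)"
proof -
  define s where "s = ln t - B"
  have s: "s \<noteq> 0" "t \<noteq> 0" "B = ln t - s" using assms by (auto simp: s_def)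
  show "(barrier B has_real_derivative barrier1 B t) (at t)"
    unfolding barrier_def[abs_def] barrier1_def
    using assms(1) s
    by (auto intro!: derivative_eq_intros) (simp add: field_simps power2_eq_square)
  show "(barrier1 B has_real_derivative barrier2 B t) (at t)"
    unfolding barrier1_def[abs_def] barrier2_def
    using assms(1) s
    by (auto intro!: derivative_eq_intros) (simp add: field_simps eval_nat_numeral)
  show "(barrier2 B has_real_derivative barrier3 B t) (at t)"
    unfolding barrier2_def[abs_def] barrier3_def
    using assms(1) s
    by (auto intro!: derivative_eq_intros) (simp add: field_simps eval_nat_numeral)
qed

lemma barrier_bounds:
  assumes "0 < t" "1 \<le> ln t - B"
  shows "\<bar>barrier1 B t\<bar> \<le> 2 / ((ln t - B) * t\<^sup>2)"
    "\<bar>barrier2 B t\<bar> \<le> 7 / ((ln t - B) * t ^ 3)"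
    "\<bar>barrier3 B t\<bar> \<le> 35 / ((ln t - B) * t ^ 4)"
proof -
  define s where "s = ln t - B"
  have s: "1 \<le> s" "ln t - B = s" using assms by (auto simp: s_def)
  have i: "1 / s ^ k \<le> 1 / s" if "1 \<le> k" for k
    using s(1) self_le_power[of s k] that by (intro divide_left_mono) auto
  have n: "0 \<le> 1 / s ^ k" for k using s by simp
  have 1: "c / s ^ k \<le> c / s" if "1 \<le> k" "0 \<le> c" for c k
    using mult_left_mono[OF i[OF that(1)] that(2)] by simp
  show "\<bar>barrier1 B t\<bar> \<le> 2 / ((ln t - B) * t\<^sup>2)"
  proof -
    have "\<bar>barrier1 B t\<bar> = (1 / s + 1 / s\<^sup>2) / t\<^sup>2"
      unfolding barrier1_def s(2) minus_divide_left[symmetric] abs_minus_cancel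
      by (rule abs_of_nonneg) (use s in simp)
    also have "\<dots> \<le> (2 / s) / t\<^sup>2"
      using 1[of 2 1] assms by (intro divide_right_mono) auto
    finally show ?thesis by (simp add: s)
  qed
  show "\<bar>barrier2 B t\<bar> \<le> 7 / ((ln t - B) * t ^ 3)"
  proof -
    have "\<bar>barrier2 B t\<bar> = (2 / s + 3 / s\<^sup>2 + 2 / s ^ 3) / t ^ 3"
      using s assms by (simp add: barrier2_def abs_divide abs_of_nonneg)
    also have "\<dots> \<le> (7 / s) / t ^ 3"
      using 1[of 2 3] 1[of 3 2] assms by (intro divide_right_mono) auto
    finally show ?thesis by (simp add: s)
  qed
  show "\<bar>barrier3 B t\<bar> \<le> 35 / ((ln t - B) * t ^ 4)"
  proof -
    have "\<bar>barrier3 B t\<bar> = (6 / s + 11 / s\<^sup>2 + 12 / s ^ 3 + 6 / s ^ 4) / t ^ 4"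
      unfolding barrier3_def s(2) minus_divide_left[symmetric] abs_minus_cancel
      by (rule abs_of_nonneg) (use s in simp)
    also have "\<dots> \<le> (35 / s) / t ^ 4"
      using 1[of 2 11] 1[of 3 12] 1[of 4 6] assms by (intro divide_right_mono) auto
    finally show ?thesis by (simp add: s)
  qed
qed

lemma ln_ge_of_quarter:
  assumes "0 < t" "t / 4 \<le> \<tau>"
  shows "ln t - 2 \<le> ln (\<tau> :: real)"
proof -
  have "ln (2 :: real) \<le> 1" using ln_le_minus_one[of "2 :: real"] by simp
  moreover have "ln (4 :: real) = 2 * ln 2" using ln_realpow[of 2 2] by simp
  ultimately have "ln t - 2 \<le> ln t - ln 4" by simp
  also have "\<dots> = ln (t / 4)" using assms by (simp add: ln_div)
  also have "\<dots> \<le> ln \<tau>" using assms by simp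
  finally show ?thesis .
qed

text \<open>The remainder is evaluated at a point which is at least \<open>t / 4\<close>, where \<open>ln - B\<close> has not
  dropped below half of its value at \<open>t\<close>.\<close>

lemma barrier_Taylor:
  assumes t: "0 < t" "4 \<le> ln t - B" and t': "t / 4 \<le> t'"
  shows "\<bar>barrier B t' - (barrier B t + barrier1 B t * (t' - t) + barrier2 B t / 2 * (t' - t)\<^sup>2)\<bar>
    \<le> 3000 * \<bar>t' - t\<bar> ^ 3 / (t ^ 4 * (ln t - B))"
proof (cases "t' = t")
  case False
  define diff where "diff = (\<lambda>m :: nat. if m = 0 then barrier B else if m = 1 then barrier1 B
    else if m = 2 then barrier2 B else barrier3 B)"
  have pos: "0 < \<tau>" "(ln t - B) / 2 \<le> ln \<tau> - B" if "t / 4 \<le> \<tau>" for \<tau>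
  proof -
    show "0 < \<tau>" using t that by linarith
    show "(ln t - B) / 2 \<le> ln \<tau> - B" using ln_ge_of_quarter[OF t(1) that] t by argo
  qed
  have "\<exists>\<tau>. (if t' < t then t' < \<tau> \<and> \<tau> < t else t < \<tau> \<and> \<tau> < t') \<and>
      barrier B t' = (\<Sum>m<3. diff m t / fact m * (t' - t) ^ m) + diff 3 \<tau> / fact 3 * (t' - t) ^ 3"
  proof (rule Taylor[where a="min t t'" and b="max t t'"])
    show "\<forall>m \<tau>. m < 3 \<and> min t t' \<le> \<tau> \<and> \<tau> \<le> max t t' \<longrightarrow> DERIV (diff m) \<tau> :> diff (Suc m) \<tau>"
    proof (intro allI impI, elim conjE)
      fix m :: nat and \<tau> :: real assume m: "m < 3" "min t t' \<le> \<tau>"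
      then have "t / 4 \<le> \<tau>" using t t' by linarith
      from pos[OF this] t have "0 < \<tau>" "B < ln \<tau>" by auto
      from DERIV_barrier[OF this] m show "DERIV (diff m) \<tau> :> diff (Suc m) \<tau>"
        by (auto simp: diff_def less_Suc_eq numeral_3_eq_3 numeral_2_eq_2)
    qed
  qed (use False in \<open>auto simp: diff_def\<close>)
  then obtain \<tau> where \<tau>: "if t' < t then t' < \<tau> \<and> \<tau> < t else t < \<tau> \<and> \<tau> < t'"
    and eq: "barrier B t' = (\<Sum>m<3. diff m t / fact m * (t' - t) ^ m) + diff 3 \<tau> / fact 3 * (t' - t) ^ 3"
    by blast
  have \<tau>4: "t / 4 \<le> \<tau>" using \<tau> t t' by (auto split: if_splits)
  note p = pos[OF \<tau>4]
  have "\<bar>barrier3 B \<tau>\<bar> \<le> 35 / ((ln \<tau> - B) * \<tau> ^ 4)"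
    using p t by (intro barrier_bounds) auto
  also have "\<dots> \<le> 35 / ((ln t - B) / 2 * (t / 4) ^ 4)"
    using p t \<tau>4 by (intro divide_left_mono mult_mono power_mono mult_pos_pos zero_less_power) auto
  also have "\<dots> = 17920 / (t ^ 4 * (ln t - B))"
    by (simp add: field_simps)
  finally have b3: "\<bar>barrier3 B \<tau>\<bar> \<le> 17920 / (t ^ 4 * (ln t - B))" .
  have "barrier B t' - (barrier B t + barrier1 B t * (t' - t) + barrier2 B t / 2 * (t' - t)\<^sup>2)
      = barrier3 B \<tau> / 6 * (t' - t) ^ 3"
    unfolding eq by (simp add: diff_def numeral_3_eq_3 numeral_2_eq_2)
  also have "\<bar>\<dots>\<bar> = \<bar>barrier3 B \<tau>\<bar> / 6 * \<bar>t' - t\<bar> ^ 3"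
    by (simp add: abs_mult power_abs)
  also have "\<dots> \<le> (17920 / (t ^ 4 * (ln t - B))) / 6 * \<bar>t' - t\<bar> ^ 3"
    using b3 by (intro mult_right_mono divide_right_mono) auto
  also have "\<dots> \<le> 3000 / (t ^ 4 * (ln t - B)) * \<bar>t' - t\<bar> ^ 3"
    using t by (intro mult_right_mono) (auto simp: divide_simps)
  finally show ?thesis by simp
qed simp

section \<open>The mean of the barrier after one jump\<close>

context walk_form
begin

abbreviation radius :: "'a \<Rightarrow> real" where
  "radius x \<equiv> sqrt (\<beta> x x)"

text \<open>The second order Taylor polynomial of the barrier in the increment \<open>2 * \<beta> x z + \<beta> z z\<close> of the form,
  except that only the leading part of the squared increment is kept, which makes its mean explicit.\<close>

definition Taylor_poly :: "real \<Rightarrow> 'a \<Rightarrow> 'a \<Rightarrow> real" where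
  "Taylor_poly B x z = barrier B (\<beta> x x) + barrier1 B (\<beta> x x) * (2 * \<beta> x z + \<beta> z z)
    + 2 * barrier2 B (\<beta> x x) * (\<beta> x z)\<^sup>2"

lemma radius_add_ge:
  assumes "radius z \<le> radius x / 2"
  shows "\<beta> x x / 4 \<le> \<beta> (x + z) (x + z)"
proof -
  let ?r = "radius x" and ?n = "radius z"
  have "(?r / 2)\<^sup>2 \<le> (?r - ?n)\<^sup>2"
    using assms by (intro power_mono) (auto simp: form_nonneg)
  also have "\<dots> = ?r\<^sup>2 - 2 * (?r * ?n) + ?n\<^sup>2"
    by (simp add: power2_eq_square algebra_simps)
  also have "\<dots> \<le> \<beta> x x + 2 * \<beta> x z + \<beta> z z"
    using form_Cauchy_Schwarz[of x z] by (simp add: form_nonneg)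
  finally show ?thesis by (simp add: form_nonneg form_add power_divide)
qed

lemma Taylor_poly_small:
  assumes r: "1 \<le> radius x" "4 \<le> ln (\<beta> x x) - B" and z: "radius z \<le> radius x / 2"
  shows "\<bar>barrier B (\<beta> (x + z) (x + z)) - Taylor_poly B x z\<bar>
    \<le> 100000 * (radius z ^ 3 + radius z ^ 4) / ((ln (\<beta> x x) - B) * radius x ^ 5)"
proof -
  define r where "r = radius x"
  define n where "n = radius z"
  define s where "s = ln (\<beta> x x) - B"
  define b where "b = \<beta> x z"
  have rn: "1 \<le> r" "0 \<le> n" "n \<le> r / 2" "4 \<le> s" using r z by (auto simp: r_def n_def s_def form_nonneg)
  have sq: "\<beta> x x = r\<^sup>2" "\<beta> z z = n\<^sup>2" by (simp_all add: r_def n_def form_nonneg)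
  have b: "\<bar>b\<bar> \<le> r * n" using form_Cauchy_Schwarz[of x z] by (simp add: b_def r_def n_def)
  define \<Delta> where "\<Delta> = 2 * b + n\<^sup>2"
  have t': "\<beta> (x + z) (x + z) = r\<^sup>2 + \<Delta>" by (simp add: form_add sq \<Delta>_def b_def)
  have s: "ln (r\<^sup>2) - B = s" by (simp add: s_def sq)
  have nn: "n\<^sup>2 \<le> r * n / 2"
    using mult_right_mono[OF rn(3) rn(2)] by (simp add: power2_eq_square)
  have "\<bar>\<Delta>\<bar> \<le> 2 * \<bar>b\<bar> + n\<^sup>2"
    using abs_triangle_ineq[of "2 * b" "n\<^sup>2"] by (simp add: \<Delta>_def)
  also have "\<dots> \<le> 3 * (r * n)" using b nn rn by (simp add: mult_nonneg_nonneg)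
  finally have \<Delta>: "\<bar>\<Delta>\<bar> \<le> 3 * (r * n)" .
  have "\<bar>barrier B (r\<^sup>2 + \<Delta>) - (barrier B (r\<^sup>2) + barrier1 B (r\<^sup>2) * \<Delta> + barrier2 B (r\<^sup>2) / 2 * \<Delta>\<^sup>2)\<bar>
      \<le> 3000 * \<bar>\<Delta>\<bar> ^ 3 / ((r\<^sup>2) ^ 4 * s)"
    using barrier_Taylor[of "r\<^sup>2" B "r\<^sup>2 + \<Delta>"] rn radius_add_ge[OF z] s by (simp add: t' sq)
  also have "\<dots> \<le> 3000 * (3 * (r * n)) ^ 3 / ((r\<^sup>2) ^ 4 * s)"
    using \<Delta> rn by (intro divide_right_mono mult_left_mono power_mono) auto
  also have "\<dots> = 81000 * n ^ 3 / (s * r ^ 5)"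
    using rn by (simp add: field_simps eval_nat_numeral)
  finally have 1: "\<bar>barrier B (r\<^sup>2 + \<Delta>) - (barrier B (r\<^sup>2) + barrier1 B (r\<^sup>2) * \<Delta> + barrier2 B (r\<^sup>2) / 2 * \<Delta>\<^sup>2)\<bar>
      \<le> 81000 * n ^ 3 / (s * r ^ 5)" .
  have "\<bar>barrier2 B (r\<^sup>2) / 2 * \<Delta>\<^sup>2 - 2 * barrier2 B (r\<^sup>2) * b\<^sup>2\<bar>
      = \<bar>barrier2 B (r\<^sup>2)\<bar> * (\<bar>4 * b * n\<^sup>2 + n ^ 4\<bar> / 2)"
  proof -
    have "barrier2 B (r\<^sup>2) / 2 * \<Delta>\<^sup>2 - 2 * barrier2 B (r\<^sup>2) * b\<^sup>2
        = barrier2 B (r\<^sup>2) * ((4 * b * n\<^sup>2 + n ^ 4) / 2)"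
      by (simp add: \<Delta>_def power2_eq_square power4_eq_xxxx field_simps)
    then show ?thesis by (simp only: abs_mult abs_divide abs_numeral)
  qed
  also have "\<dots> \<le> (7 / (s * (r\<^sup>2) ^ 3)) * (4 * (r * n ^ 3 + r * n ^ 4) / 2)"
  proof (intro mult_mono divide_right_mono)
    show "\<bar>barrier2 B (r\<^sup>2)\<bar> \<le> 7 / (s * (r\<^sup>2) ^ 3)"
      using barrier_bounds(2)[of "r\<^sup>2" B] rn s by simp
    have "\<bar>4 * b * n\<^sup>2 + n ^ 4\<bar> \<le> 4 * \<bar>b\<bar> * n\<^sup>2 + n ^ 4"
      using rn abs_triangle_ineq[of "4 * b * n\<^sup>2" "n ^ 4"] by (simp add: abs_mult)
    also have "\<dots> \<le> 4 * (r * n) * n\<^sup>2 + 4 * (r * n ^ 4)"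
    proof (intro add_mono mult_right_mono mult_left_mono b)
      have "n ^ 4 \<le> r * n ^ 4" using rn by (simp add: mult_le_cancel_right1)
      also have "\<dots> \<le> 4 * (r * n ^ 4)" using rn by simp
      finally show "n ^ 4 \<le> 4 * (r * n ^ 4)" .
    qed auto
    finally show "\<bar>4 * b * n\<^sup>2 + n ^ 4\<bar> \<le> 4 * (r * n ^ 3 + r * n ^ 4)"
      by (simp add: power2_eq_square power3_eq_cube algebra_simps)
  qed (use rn in auto)
  also have "\<dots> = 14 * (n ^ 3 + n ^ 4) / (s * r ^ 5)"
    using rn by (simp add: field_simps eval_nat_numeral)
  finally have 2: "\<bar>barrier2 B (r\<^sup>2) / 2 * \<Delta>\<^sup>2 - 2 * barrier2 B (r\<^sup>2) * b\<^sup>2\<bar>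
      \<le> 14 * (n ^ 3 + n ^ 4) / (s * r ^ 5)" .
  have T: "Taylor_poly B x z = barrier B (r\<^sup>2) + barrier1 B (r\<^sup>2) * \<Delta> + 2 * barrier2 B (r\<^sup>2) * b\<^sup>2"
    by (simp add: Taylor_poly_def sq \<Delta>_def b_def)
  have "\<bar>barrier B (\<beta> (x + z) (x + z)) - Taylor_poly B x z\<bar>
      \<le> 81000 * n ^ 3 / (s * r ^ 5) + 14 * (n ^ 3 + n ^ 4) / (s * r ^ 5)"
    unfolding t' T using 1 2 by linarith
  also have "\<dots> = (81000 * n ^ 3 + 14 * (n ^ 3 + n ^ 4)) / (s * r ^ 5)"
    by (simp add: add_divide_distrib)
  also have "\<dots> \<le> 100000 * (n ^ 3 + n ^ 4) / (s * r ^ 5)"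
    using rn by (intro divide_right_mono) auto
  finally show ?thesis by (simp add: n_def r_def s_def)
qed

text \<open>For large jumps the polynomial is as small as the error allowed for small jumps, because the missing
  factors are supplied by powers of \<open>2 * radius z / radius x > 1\<close>. Hence both cases can be integrated together.\<close>

lemma Taylor_poly_large:
  assumes r: "1 \<le> radius x" "4 \<le> ln (\<beta> x x) - B" and z: "radius x / 2 < radius z"
  shows "\<bar>Taylor_poly B x z\<bar>
    \<le> 100000 * (radius z ^ 3 + radius z ^ 4) / ((ln (\<beta> x x) - B) * radius x ^ 5)"
proof -
  define r where "r = radius x"
  define n where "n = radius z"
  define s where "s = ln (\<beta> x x) - B"
  define b where "b = \<beta> x z"
  have rn: "1 \<le> r" "0 \<le> n" "r \<le> 2 * n" "4 \<le> s" using r z by (auto simp: r_def n_def s_def form_nonneg)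
  have sq: "\<beta> x x = r\<^sup>2" "\<beta> z z = n\<^sup>2" by (simp_all add: r_def n_def form_nonneg)
  have b: "\<bar>b\<bar> \<le> r * n" using form_Cauchy_Schwarz[of x z] by (simp add: b_def r_def n_def)
  have s: "ln (r\<^sup>2) - B = s" by (simp add: s_def sq)
  have "\<bar>Taylor_poly B x z\<bar> \<le> \<bar>barrier B (r\<^sup>2)\<bar> + \<bar>barrier1 B (r\<^sup>2)\<bar> * \<bar>2 * b + n\<^sup>2\<bar> + 2 * \<bar>barrier2 B (r\<^sup>2)\<bar> * b\<^sup>2"
    unfolding Taylor_poly_def sq b_def[symmetric]
    by (rule order_trans[OF abs_triangle_ineq] order_trans[OF add_right_mono[OF abs_triangle_ineq]])+
      (simp add: abs_mult)
  also have "\<dots> \<le> 1 / (r\<^sup>2 * s) + 2 / (s * (r\<^sup>2)\<^sup>2) * (2 * (r * n) + n\<^sup>2) + 2 * (7 / (s * (r\<^sup>2) ^ 3)) * (r * n)\<^sup>2"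
  proof (intro add_mono mult_mono)
    show "\<bar>barrier B (r\<^sup>2)\<bar> \<le> 1 / (r\<^sup>2 * s)" using rn by (simp add: barrier_def s)
    show "\<bar>barrier1 B (r\<^sup>2)\<bar> \<le> 2 / (s * (r\<^sup>2)\<^sup>2)"
      using barrier_bounds(1)[of "r\<^sup>2" B] rn s by simp
    show "\<bar>barrier2 B (r\<^sup>2)\<bar> \<le> 7 / (s * (r\<^sup>2) ^ 3)"
      using barrier_bounds(2)[of "r\<^sup>2" B] rn s by simp
    show "\<bar>2 * b + n\<^sup>2\<bar> \<le> 2 * (r * n) + n\<^sup>2"
      using b abs_triangle_ineq[of "2 * b" "n\<^sup>2"] by simp
    show "b\<^sup>2 \<le> (r * n)\<^sup>2" using power_mono[OF b, of 2] by simp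
  qed (use rn in auto)
  also have "\<dots> = (r ^ 3 + 4 * (r\<^sup>2 * n) + 16 * (r * n\<^sup>2)) / (s * r ^ 5)"
    using rn by (simp add: field_simps eval_nat_numeral)
  also have "\<dots> \<le> 100000 * (n ^ 3 + n ^ 4) / (s * r ^ 5)"
  proof (intro divide_right_mono)
    have "r ^ 3 \<le> (2 * n) ^ 3" "r\<^sup>2 * n \<le> (2 * n)\<^sup>2 * n" "r * n\<^sup>2 \<le> 2 * n * n\<^sup>2"
      using rn power_mono[OF rn(3), of 3] power_mono[OF rn(3), of 2] by (auto intro!: mult_right_mono)
    then have "r ^ 3 + 4 * (r\<^sup>2 * n) + 16 * (r * n\<^sup>2) \<le> 56 * n ^ 3"
      by (simp add: power2_eq_square power3_eq_cube)
    also have "\<dots> \<le> 100000 * (n ^ 3 + n ^ 4)" using rn by simp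
    finally show "r ^ 3 + 4 * (r\<^sup>2 * n) + 16 * (r * n\<^sup>2) \<le> 100000 * (n ^ 3 + n ^ 4)" .
  qed (use rn in auto)
  finally show ?thesis by (simp add: n_def r_def s_def)
qed

text \<open>The first order part contributes \<open>4 * barrier1\<close> and the second order part \<open>2 * \<beta> x x * barrier2\<close>. The
  terms of order \<open>1 / (ln - B)\<close> cancel, which reflects that \<open>1 / t\<close> is harmonic in dimension four.\<close>

lemma expectation_Taylor_poly:
  assumes "1 \<le> radius x" "4 \<le> ln (\<beta> x x) - B"
  shows "integrable (measure_pmf \<theta>) (Taylor_poly B x)"
    "measure_pmf.expectation \<theta> (Taylor_poly B x) = barrier B (\<beta> x x)
      + (2 / (ln (\<beta> x x) - B)\<^sup>2 + 4 / (ln (\<beta> x x) - B) ^ 3) / radius x ^ 4"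
proof -
  note ints = form_integrable[of x] integrable_form form_sq_integrable[of x]
  show "integrable (measure_pmf \<theta>) (Taylor_poly B x)"
    unfolding Taylor_poly_def[abs_def]
    by (intro Bochner_Integration.integrable_add integrable_mult_right ints) simp
  have r4: "radius x ^ 4 = (\<beta> x x)\<^sup>2"
    using form_nonneg[of x] by (simp add: power4_eq_xxxx power2_eq_square)
  have pos: "\<beta> x x > 0" using assms(1) by (metis form_nonneg less_eq_real_def not_one_le_zero real_sqrt_zero)
  define s where "s = ln (\<beta> x x) - B"
  have s: "s \<noteq> 0" using assms(2) by (simp add: s_def)
  have "measure_pmf.expectation \<theta> (Taylor_poly B x)
      = barrier B (\<beta> x x) + (4 * barrier1 B (\<beta> x x) + 2 * \<beta> x x * barrier2 B (\<beta> x x))"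
    unfolding Taylor_poly_def[abs_def] using ints
    by (simp add: form_mean form_variance form_trace)
  also have "4 * barrier1 B (\<beta> x x) + 2 * \<beta> x x * barrier2 B (\<beta> x x) = (2 / s\<^sup>2 + 4 / s ^ 3) / radius x ^ 4"
    unfolding barrier1_def barrier2_def r4 s_def[symmetric] using pos s
    by (simp add: field_simps eval_nat_numeral)
  finally show "measure_pmf.expectation \<theta> (Taylor_poly B x) = barrier B (\<beta> x x)
      + (2 / (ln (\<beta> x x) - B)\<^sup>2 + 4 / (ln (\<beta> x x) - B) ^ 3) / radius x ^ 4"
    by (simp add: s_def)
qed

definition error_const :: real where
  "error_const = 100000 * measure_pmf.expectation \<theta> (\<lambda>z. radius z ^ 3 + radius z ^ 4)
    + 256 * measure_pmf.expectation \<theta> (\<lambda>z. radius z ^ 8)"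

lemma error_const_nonneg: "0 \<le> error_const"
  unfolding error_const_def
  by (intro add_nonneg_nonneg mult_nonneg_nonneg integral_nonneg_AE) (auto simp: form_nonneg)

text \<open>The function \<open>u\<close> has to lie below the barrier only at points reached by small jumps; for the others the bound \<open>u \<le> 1\<close>
  costs the probability of a large jump, estimated by the eighth moment.\<close>

lemma jump_mean_le_barrier:
  assumes r: "1 \<le> radius x" "4 \<le> ln (\<beta> x x) - B" and a: "0 \<le> a"
    and u: "\<And>y. 0 \<le> u y" "\<And>y. u y \<le> 1"
    and ub: "\<And>z. radius z \<le> radius x / 2 \<Longrightarrow> u (x + z) \<le> a * barrier B (\<beta> (x + z) (x + z))"
  shows "jump_mean \<theta> u x \<le> a * (barrier B (\<beta> x x)
    + (2 / (ln (\<beta> x x) - B)\<^sup>2 + 4 / (ln (\<beta> x x) - B) ^ 3) / radius x ^ 4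
    + error_const / ((ln (\<beta> x x) - B) * radius x ^ 5)) + error_const / radius x ^ 8"
proof -
  let ?s = "ln (\<beta> x x) - B" and ?r = "radius x"
  let ?E = "\<lambda>z. 100000 / (?s * ?r ^ 5) * (radius z ^ 3 + radius z ^ 4)"
  let ?g = "\<lambda>z. a * (Taylor_poly B x z + ?E z) + 256 / ?r ^ 8 * radius z ^ 8"
  have E: "?E z = 100000 * (radius z ^ 3 + radius z ^ 4) / (?s * ?r ^ 5)" for z by simp
  have le: "u (x + z) \<le> ?g z" for z
  proof (cases "radius z \<le> ?r / 2")
    case True
    have "a * barrier B (\<beta> (x + z) (x + z)) \<le> a * (Taylor_poly B x z + ?E z)"
      using Taylor_poly_small[OF r True] a unfolding E by (intro mult_left_mono) auto
    moreover have "0 \<le> 256 / ?r ^ 8 * radius z ^ 8" by (simp add: form_nonneg)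
    ultimately show ?thesis using ub[OF True] by linarith
  next
    case False
    then have "0 \<le> Taylor_poly B x z + ?E z"
      using Taylor_poly_large[OF r, of z] unfolding E by simp
    then have "0 \<le> a * (Taylor_poly B x z + ?E z)" using a by simp
    moreover have "?r ^ 8 \<le> (2 * radius z) ^ 8"
      using False form_nonneg r by (intro power_mono) auto
    then have "1 \<le> 256 / ?r ^ 8 * radius z ^ 8"
      using r by (simp add: field_simps power_mult_distrib)
    ultimately show ?thesis using u(2)[of "x + z"] by linarith
  qed
  have int1: "integrable (measure_pmf \<theta>) ?E"
    by (intro integrable_mult_right Bochner_Integration.integrable_add moments)
  have int2: "integrable (measure_pmf \<theta>) (\<lambda>z. 256 / ?r ^ 8 * radius z ^ 8)"
    by (intro integrable_mult_right moments)
  have int3: "integrable (measure_pmf \<theta>) (\<lambda>z. Taylor_poly B x z + ?E z)"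
    by (intro Bochner_Integration.integrable_add expectation_Taylor_poly(1)[OF r] int1)
  have "jump_mean \<theta> u x \<le> measure_pmf.expectation \<theta> ?g"
    unfolding jump_mean_def
  proof (rule integral_mono)
    show "integrable (measure_pmf \<theta>) (\<lambda>z. u (x + z))"
      by (rule measure_pmf.integrable_const_bound[where B=1]) (auto simp: u)
    show "integrable (measure_pmf \<theta>) ?g"
      by (intro Bochner_Integration.integrable_add integrable_mult_right int3 moments)
  qed (rule le)
  also have "\<dots> = a * (measure_pmf.expectation \<theta> (Taylor_poly B x) + measure_pmf.expectation \<theta> ?E)
      + measure_pmf.expectation \<theta> (\<lambda>z. 256 / ?r ^ 8 * radius z ^ 8)"
    using int1 int2 int3 expectation_Taylor_poly(1)[OF r]
    by (simp del: integral_mult_right_zero)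
  also have "measure_pmf.expectation \<theta> ?E
      = 100000 * measure_pmf.expectation \<theta> (\<lambda>z. radius z ^ 3 + radius z ^ 4) / (?s * ?r ^ 5)"
    by (subst integral_mult_right_zero) simp
  also have "\<dots> \<le> error_const / (?s * ?r ^ 5)"
    unfolding error_const_def using r by (intro divide_right_mono) (auto intro!: integral_nonneg_AE simp: form_nonneg)
  also have "measure_pmf.expectation \<theta> (\<lambda>z. 256 / ?r ^ 8 * radius z ^ 8)
      = 256 * measure_pmf.expectation \<theta> (\<lambda>z. radius z ^ 8) / ?r ^ 8"
    by simp
  also have "\<dots> \<le> error_const / ?r ^ 8"
    unfolding error_const_def using r by (intro divide_right_mono) (auto intro!: integral_nonneg_AE simp: form_nonneg)
  finally show ?thesis
    using a unfolding expectation_Taylor_poly(2)[OF r] by (simp add: mult_left_mono)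
qed

text \<open>For large jumps \<open>u \<ge> 0\<close> suffices, since there the Taylor polynomial is an error term.\<close>

lemma jump_mean_ge_barrier:
  assumes r: "1 \<le> radius x" "4 \<le> ln (\<beta> x x) - B" and a: "0 \<le> a"
    and u: "\<And>y. 0 \<le> u y" "\<And>y. u y \<le> 1"
    and lb: "\<And>z. radius z \<le> radius x / 2 \<Longrightarrow> a * barrier B (\<beta> (x + z) (x + z)) \<le> u (x + z)"
  shows "a * (barrier B (\<beta> x x) + 2 / (ln (\<beta> x x) - B)\<^sup>2 / radius x ^ 4
    - error_const / ((ln (\<beta> x x) - B) * radius x ^ 5)) \<le> jump_mean \<theta> u x"
proof -
  let ?s = "ln (\<beta> x x) - B" and ?r = "radius x"
  let ?E = "\<lambda>z. 100000 / (?s * ?r ^ 5) * (radius z ^ 3 + radius z ^ 4)"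
  let ?g = "\<lambda>z. a * (Taylor_poly B x z - ?E z)"
  have E: "?E z = 100000 * (radius z ^ 3 + radius z ^ 4) / (?s * ?r ^ 5)" for z by simp
  have le: "?g z \<le> u (x + z)" for z
  proof (cases "radius z \<le> ?r / 2")
    case True
    have "a * (Taylor_poly B x z - ?E z) \<le> a * barrier B (\<beta> (x + z) (x + z))"
      using Taylor_poly_small[OF r True] a unfolding E by (intro mult_left_mono) auto
    then show ?thesis using lb[OF True] by linarith
  next
    case False
    then have "Taylor_poly B x z - ?E z \<le> 0"
      using Taylor_poly_large[OF r, of z] unfolding E by simp
    then have "a * (Taylor_poly B x z - ?E z) \<le> 0" using a by (simp add: mult_nonneg_nonpos)
    then show ?thesis using u(1)[of "x + z"] by linarith
  qed
  have int1: "integrable (measure_pmf \<theta>) ?E"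
    by (intro integrable_mult_right Bochner_Integration.integrable_add moments)
  have int3: "integrable (measure_pmf \<theta>) (\<lambda>z. Taylor_poly B x z - ?E z)"
    by (intro Bochner_Integration.integrable_diff expectation_Taylor_poly(1)[OF r] int1)
  have E_le: "measure_pmf.expectation \<theta> ?E \<le> error_const / (?s * ?r ^ 5)"
  proof -
    have "measure_pmf.expectation \<theta> ?E
        = 100000 * measure_pmf.expectation \<theta> (\<lambda>z. radius z ^ 3 + radius z ^ 4) / (?s * ?r ^ 5)"
      by (subst integral_mult_right_zero) simp
    also have "\<dots> \<le> error_const / (?s * ?r ^ 5)"
      unfolding error_const_def using r
      by (intro divide_right_mono) (auto intro!: integral_nonneg_AE simp: form_nonneg)
    finally show ?thesis .
  qed
  have "2 / ?s\<^sup>2 / ?r ^ 4 \<le> (2 / ?s\<^sup>2 + 4 / ?s ^ 3) / ?r ^ 4"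
    using r by (intro divide_right_mono) auto
  then have "a * (barrier B (\<beta> x x) + 2 / ?s\<^sup>2 / ?r ^ 4 - error_const / (?s * ?r ^ 5))
      \<le> a * (measure_pmf.expectation \<theta> (Taylor_poly B x) - measure_pmf.expectation \<theta> ?E)"
    using a E_le unfolding expectation_Taylor_poly(2)[OF r] by (intro mult_left_mono) auto
  also have "\<dots> = measure_pmf.expectation \<theta> ?g"
    using int1 int3 expectation_Taylor_poly(1)[OF r]
    by (simp del: integral_mult_right_zero)
  also have "\<dots> \<le> jump_mean \<theta> u x"
    unfolding jump_mean_def
  proof (rule integral_mono)
    show "integrable (measure_pmf \<theta>) (\<lambda>z. u (x + z))"
      by (rule measure_pmf.integrable_const_bound[where B=1]) (auto simp: u)
    show "integrable (measure_pmf \<theta>) ?g"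
      by (intro integrable_mult_right int3)
  qed (rule le)
  finally show ?thesis .
qed

text \<open>At such points both error sources, the lower order terms in \<open>ln - B\<close> and the discreteness of the walk,
  are small compared with the main term \<open>2 / (ln - B)\<^sup>2\<close>.\<close>

definition far :: "real \<Rightarrow> real \<Rightarrow> 'a \<Rightarrow> bool" where
  "far \<epsilon> B x \<longleftrightarrow> 1 \<le> radius x \<and> 1 / \<epsilon> \<le> ln (\<beta> x x) - B \<and> ln (\<beta> x x) - B \<le> \<epsilon> * radius x"

lemma far_barrier:
  assumes "far \<epsilon> B x" "0 < \<epsilon>" "\<epsilon> \<le> 1 / 4"
  shows "1 \<le> radius x" "4 \<le> ln (\<beta> x x) - B"
    "barrier B (\<beta> x x) = 1 / ((radius x)\<^sup>2 * (ln (\<beta> x x) - B))"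
    "0 < barrier B (\<beta> x x)" "barrier B (\<beta> x x) \<le> \<epsilon>" "barrier B (\<beta> x x) \<le> 1 / \<beta> x x"
proof -
  have s: "1 / \<epsilon> \<le> ln (\<beta> x x) - B" and r: "1 \<le> radius x" using assms by (auto simp: far_def)
  show "1 \<le> radius x" by (rule r)
  have "4 \<le> 1 / \<epsilon>" using assms by (simp add: field_simps)
  with s show s4: "4 \<le> ln (\<beta> x x) - B" by linarith
  show eq: "barrier B (\<beta> x x) = 1 / ((radius x)\<^sup>2 * (ln (\<beta> x x) - B))"
    by (simp add: barrier_def form_nonneg)
  have r2: "1 \<le> (radius x)\<^sup>2" using r by (simp add: one_le_power)
  show "0 < barrier B (\<beta> x x)" unfolding eq using r2 s4 by (intro divide_pos_pos mult_pos_pos) auto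
  have "1 / ((radius x)\<^sup>2 * (ln (\<beta> x x) - B)) \<le> 1 / (1 * (1 / \<epsilon>))"
    using r2 s s4 assms by (intro divide_left_mono mult_mono mult_pos_pos) auto
  then show "barrier B (\<beta> x x) \<le> \<epsilon>" unfolding eq by simp
  have "1 / ((radius x)\<^sup>2 * (ln (\<beta> x x) - B)) \<le> 1 / ((radius x)\<^sup>2 * 1)"
    using r2 s4 by (intro divide_left_mono mult_left_mono mult_pos_pos) auto
  then show "barrier B (\<beta> x x) \<le> 1 / \<beta> x x" unfolding eq by (simp add: form_nonneg)
qed

text \<open>At points that are far in the sense of \<open>\<epsilon>\<close>, the mean after one jump of a function below the
  barrier exceeds the barrier value \<open>G\<close> by at most \<open>(2 + \<eta>) / a * G\<^sup>2\<close>. The lower bound \<open>a\<^sub>0\<close> on the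
  amplitude serves to absorb the large jumps, whose contribution is not proportional to \<open>a\<close>.\<close>

definition super_scale :: "real \<Rightarrow> real \<Rightarrow> real \<Rightarrow> bool" where
  "super_scale \<eta> a\<^sub>0 \<epsilon> \<longleftrightarrow> 0 < \<epsilon> \<and> \<epsilon> \<le> 1 / 4 \<and>
    (\<forall>x B a u. far \<epsilon> B x \<and> a\<^sub>0 \<le> a \<and> (\<forall>y. 0 \<le> u y \<and> u y \<le> 1) \<and>
      (\<forall>z. radius z \<le> radius x / 2 \<longrightarrow> u (x + z) \<le> a * barrier B (\<beta> (x + z) (x + z))) \<longrightarrow>
      jump_mean \<theta> u x \<le> a * barrier B (\<beta> x x) + (2 + \<eta>) / a * (a * barrier B (\<beta> x x))\<^sup>2)"

text \<open>All errors are measured in the unit \<open>w = a / (radius x ^ 4 * (ln - B)\<^sup>2)\<close>, which is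
  the square of the barrier value \<open>a * barrier B (\<beta> x x)\<close> divided by \<open>a\<close>.\<close>

lemma ex_super_scale:
  assumes \<eta>: "0 < \<eta>" and a0: "0 < a\<^sub>0"
  shows "\<exists>\<epsilon>. super_scale \<eta> a\<^sub>0 \<epsilon>"
proof -
  let ?C = error_const
  have den: "0 < 4 + ?C + ?C / a\<^sub>0" using error_const_nonneg a0 by (simp add: add_pos_nonneg)
  define \<epsilon> where "\<epsilon> = min (1 / 4) (\<eta> / (4 + ?C + ?C / a\<^sub>0))"
  have \<epsilon>: "0 < \<epsilon>" "\<epsilon> \<le> 1 / 4" using \<eta> den by (simp_all only: \<epsilon>_def min.cobounded1) simp
  have "\<epsilon> \<le> \<eta> / (4 + ?C + ?C / a\<^sub>0)" by (simp add: \<epsilon>_def)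
  then have \<epsilon>\<eta>: "\<epsilon> * (4 + ?C + ?C / a\<^sub>0) \<le> \<eta>" using den by (simp add: pos_le_divide_eq)
  have "jump_mean \<theta> u x \<le> a * barrier B (\<beta> x x) + (2 + \<eta>) / a * (a * barrier B (\<beta> x x))\<^sup>2"
    if far: "far \<epsilon> B x" and a: "a\<^sub>0 \<le> a" and u: "\<And>y. 0 \<le> u y" "\<And>y. u y \<le> 1"
      and ub: "\<And>z. radius z \<le> radius x / 2 \<Longrightarrow> u (x + z) \<le> a * barrier B (\<beta> (x + z) (x + z))"
    for x B a u
  proof -
    define r where "r = radius x"
    define s where "s = ln (\<beta> x x) - B"
    have \<epsilon>': "0 < \<epsilon>" "\<epsilon> \<le> 1 / 4" using \<epsilon> by (auto simp: super_scale_def)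
    note fb = far_barrier[OF far \<epsilon>']
    have r: "1 \<le> r" and s: "4 \<le> s" using fb by (auto simp: r_def s_def)
    have bar: "barrier B (\<beta> x x) = 1 / (r\<^sup>2 * s)" using fb by (simp add: r_def s_def)
    have s\<epsilon>: "1 / \<epsilon> \<le> s" and sr: "s \<le> \<epsilon> * r" using far by (auto simp: far_def r_def s_def)
    have apos: "0 < a" using a a0 by simp
    define w where "w = a / (r ^ 4 * s\<^sup>2)"
    have w: "0 < w" using apos r s by (simp add: w_def)
    have "a * (4 / s ^ 3 / r ^ 4) = 4 / s * w"
      using r s by (simp add: w_def field_simps eval_nat_numeral)
    also have "\<dots> \<le> 4 * \<epsilon> * w"
      using s\<epsilon> \<epsilon> s w by (intro mult_right_mono) (auto simp: field_simps)
    finally have 1: "a * (4 / s ^ 3 / r ^ 4) \<le> 4 * \<epsilon> * w" .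
    have sr': "s / r \<le> \<epsilon>" using sr r by (simp add: field_simps)
    have "a * (?C / (s * r ^ 5)) = ?C * (s / r) * w"
      using r s by (simp add: w_def field_simps eval_nat_numeral)
    also have "\<dots> \<le> ?C * \<epsilon> * w"
      using sr' error_const_nonneg w by (intro mult_right_mono mult_left_mono) auto
    finally have 2: "a * (?C / (s * r ^ 5)) \<le> ?C * \<epsilon> * w" .
    have "?C / r ^ 8 = ?C / a * ((s / r)\<^sup>2 * (1 / r\<^sup>2)) * w"
      using r s apos by (simp add: w_def field_simps eval_nat_numeral)
    also have "\<dots> \<le> ?C / a\<^sub>0 * (\<epsilon> * 1) * w"
    proof (intro mult_right_mono mult_mono)
      show "?C / a \<le> ?C / a\<^sub>0" using a a0 error_const_nonneg by (intro divide_left_mono) auto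
      have "(s / r)\<^sup>2 \<le> \<epsilon>\<^sup>2" using sr' r s by (intro power_mono) auto
      also have "\<dots> \<le> \<epsilon>" using \<epsilon> by (simp add: power2_eq_square mult_le_cancel_left1)
      finally show "(s / r)\<^sup>2 \<le> \<epsilon>" .
      show "1 / r\<^sup>2 \<le> 1" using r by (simp add: one_le_power)
    qed (use w \<epsilon> r a0 error_const_nonneg in auto)
    finally have 3: "?C / r ^ 8 \<le> ?C / a\<^sub>0 * \<epsilon> * w" by simp
    have "jump_mean \<theta> u x \<le> a * (1 / (r\<^sup>2 * s) + (2 / s\<^sup>2 + 4 / s ^ 3) / r ^ 4 + ?C / (s * r ^ 5)) + ?C / r ^ 8"
      using jump_mean_le_barrier[OF fb(1,2) _ u ub] apos by (simp add: bar r_def[symmetric] s_def[symmetric])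
    also have "\<dots> = a * (1 / (r\<^sup>2 * s)) + 2 * w + a * (4 / s ^ 3 / r ^ 4) + a * (?C / (s * r ^ 5)) + ?C / r ^ 8"
      using r s by (simp add: w_def algebra_simps add_divide_distrib)
    also have "\<dots> \<le> a * (1 / (r\<^sup>2 * s)) + 2 * w + (\<epsilon> * (4 + ?C + ?C / a\<^sub>0)) * w"
      using 1 2 3 by (simp add: algebra_simps)
    also have "\<dots> \<le> a * (1 / (r\<^sup>2 * s)) + 2 * w + \<eta> * w"
      using \<epsilon>\<eta> w by simp
    also have "\<dots> = a * barrier B (\<beta> x x) + (2 + \<eta>) / a * (a * barrier B (\<beta> x x))\<^sup>2"
      using r s apos by (simp add: bar w_def field_simps eval_nat_numeral)
    finally show ?thesis .
  qed
  with \<epsilon> show ?thesis unfolding super_scale_def by blast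
qed

definition sub_scale :: "real \<Rightarrow> real \<Rightarrow> bool" where
  "sub_scale \<eta> \<epsilon> \<longleftrightarrow> 0 < \<epsilon> \<and> \<epsilon> \<le> 1 / 4 \<and>
    (\<forall>x B a u. far \<epsilon> B x \<and> 0 < a \<and> (\<forall>y. 0 \<le> u y \<and> u y \<le> 1) \<and>
      (\<forall>z. radius z \<le> radius x / 2 \<longrightarrow> a * barrier B (\<beta> (x + z) (x + z)) \<le> u (x + z)) \<longrightarrow>
      a * barrier B (\<beta> x x) + (2 - \<eta>) / a * (a * barrier B (\<beta> x x))\<^sup>2 \<le> jump_mean \<theta> u x)"

lemma ex_sub_scale:
  assumes \<eta>: "0 < \<eta>" and e: "0 < e"
  shows "\<exists>\<epsilon>\<le>e. sub_scale \<eta> \<epsilon>"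
proof -
  let ?C = error_const
  define \<epsilon> where "\<epsilon> = min e (min (1 / 4) (\<eta> / (1 + ?C)))"
  have den: "0 < 1 + ?C" using error_const_nonneg by simp
  have \<epsilon>: "0 < \<epsilon>" "\<epsilon> \<le> 1 / 4" "\<epsilon> \<le> e" "\<epsilon> \<le> \<eta> / (1 + ?C)"
    using \<eta> e den by (simp add: \<epsilon>_def) (unfold \<epsilon>_def, linarith+)
  then have \<epsilon>\<eta>: "?C * \<epsilon> \<le> \<eta>" using den by (simp add: pos_le_divide_eq algebra_simps)
  have "a * barrier B (\<beta> x x) + (2 - \<eta>) / a * (a * barrier B (\<beta> x x))\<^sup>2 \<le> jump_mean \<theta> u x"
    if far: "far \<epsilon> B x" and a: "0 < a" and u: "\<And>y. 0 \<le> u y" "\<And>y. u y \<le> 1"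
      and lb: "\<And>z. radius z \<le> radius x / 2 \<Longrightarrow> a * barrier B (\<beta> (x + z) (x + z)) \<le> u (x + z)"
    for x B a u
  proof -
    define r where "r = radius x"
    define s where "s = ln (\<beta> x x) - B"
    note fb = far_barrier[OF far \<epsilon>(1,2)]
    have r: "1 \<le> r" and s: "4 \<le> s" using fb by (auto simp: r_def s_def)
    have bar: "barrier B (\<beta> x x) = 1 / (r\<^sup>2 * s)" using fb by (simp add: r_def s_def)
    have sr: "s \<le> \<epsilon> * r" using far by (auto simp: far_def r_def s_def)
    define w where "w = a / (r ^ 4 * s\<^sup>2)"
    have w: "0 < w" using a r s by (simp add: w_def)
    have sr': "s / r \<le> \<epsilon>" using sr r by (simp add: field_simps)
    have "a * (?C / (s * r ^ 5)) = ?C * (s / r) * w"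
      using r s by (simp add: w_def field_simps eval_nat_numeral)
    also have "\<dots> \<le> ?C * \<epsilon> * w"
      using sr' error_const_nonneg w by (intro mult_right_mono mult_left_mono) auto
    also have "\<dots> \<le> \<eta> * w" using \<epsilon>\<eta> w by simp
    finally have 2: "a * (?C / (s * r ^ 5)) \<le> \<eta> * w" .
    have "a * barrier B (\<beta> x x) + (2 - \<eta>) / a * (a * barrier B (\<beta> x x))\<^sup>2
        = a * (1 / (r\<^sup>2 * s)) + 2 * w - \<eta> * w"
      using r s a by (simp add: bar w_def field_simps eval_nat_numeral)
    also have "\<dots> \<le> a * (1 / (r\<^sup>2 * s)) + 2 * w - a * (?C / (s * r ^ 5))"
      using 2 by simp
    also have "\<dots> = a * (1 / (r\<^sup>2 * s) + 2 / s\<^sup>2 / r ^ 4 - ?C / (s * r ^ 5))"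
      using r s by (simp add: w_def algebra_simps)
    also have "\<dots> \<le> jump_mean \<theta> u x"
      using jump_mean_ge_barrier[OF fb(1,2) _ u lb] a by (simp add: bar r_def[symmetric] s_def[symmetric])
    finally show ?thesis .
  qed
  with \<epsilon> show ?thesis unfolding sub_scale_def by blast
qed

end

section \<open>Asymptotics of the visiting probability\<close>

locale critical_snake = critical_offspring \<mu> \<sigma> + walk_form \<theta> \<beta>
  for \<mu> :: "nat pmf" and \<sigma> :: real and \<theta> :: "'a::ab_group_add pmf" and \<beta>
begin

text \<open>The supersolution is \<open>v\<close> inside the ball and the smaller of \<open>1\<close> and the barrier outside. One jump
  raises the barrier value \<open>G\<close> to a mean \<open>p\<close> of at most \<open>G + \<kappa> * G\<^sup>2\<close>, and \<open>f\<close> takes off \<open>\<kappa> * p\<^sup>2\<close>, which is at least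
  \<open>\<kappa> * G\<^sup>2\<close> unless \<open>p\<close> is below \<open>G\<close> already. The shell between \<open>R / 4\<close> and
  \<open>R\<close> is as far as a small jump from outside the ball can reach into it.\<close>

lemma upper_barrier:
  assumes \<epsilon>: "super_scale \<eta> a\<^sub>0 \<epsilon>" and \<eta>: "0 < \<eta>" "\<eta> \<le> 1" and a0: "0 < a\<^sub>0"
    and a: "a\<^sub>0 \<le> a" and \<kappa>: "2 + \<eta> \<le> \<kappa> * a" and K: "K \<subseteq> {x. \<beta> x x < R}"
    and far: "\<And>x. R \<le> \<beta> x x \<Longrightarrow> far \<epsilon> B x"
    and shell: "\<And>x. R / 4 \<le> \<beta> x x \<Longrightarrow> \<beta> x x < R \<Longrightarrow> visit_lim \<mu> \<theta> K x \<le> a * barrier B (\<beta> x x)"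
    and f: "\<And>p. 0 \<le> p \<Longrightarrow> p \<le> p\<^sub>0 \<Longrightarrow> visit_fun \<mu> p \<le> p - \<kappa> * p\<^sup>2"
    and p0: "1 \<le> p\<^sub>0 \<or> (\<forall>x. R \<le> \<beta> x x \<longrightarrow> 2 * (a * barrier B (\<beta> x x)) \<le> p\<^sub>0)"
    and x: "R \<le> \<beta> x x"
  shows "visit_lim \<mu> \<theta> K x \<le> a * barrier B (\<beta> x x)"
proof -
  let ?v = "visit_lim \<mu> \<theta> K" and ?G = "\<lambda>x. a * barrier B (\<beta> x x)"
  have apos: "0 < a" using a a0 by simp
  have \<epsilon>': "0 < \<epsilon>" "\<epsilon> \<le> 1 / 4" using \<epsilon> by (auto simp: super_scale_def)
  note fb = far_barrier[OF far \<epsilon>']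
  define u where "u x = (if \<beta> x x < R then ?v x else min 1 (?G x))" for x
  have u: "0 \<le> u y" "u y \<le> 1" for y
    using visit_lim_bounds[of \<theta> K y] fb(4)[of y] apos by (auto simp: u_def)
  have "?v y \<le> u y \<or> visit_fun \<mu> (jump_mean \<theta> u y) \<le> u y" for y
  proof (cases "\<beta> y y < R \<or> 1 \<le> ?G y")
    case True
    then show ?thesis using visit_lim_bounds(2)[of \<theta> K y] by (auto simp: u_def)
  next
    case False
    then have yR: "R \<le> \<beta> y y" and uy: "u y = ?G y" by (auto simp: u_def)
    let ?p = "jump_mean \<theta> u y"
    have p01: "0 \<le> ?p" "?p \<le> 1" by (intro jump_mean_bounds u)+
    have Gpos: "0 < ?G y" using fb(4)[OF yR] apos by simp
    have ub: "u (y + z) \<le> ?G (y + z)" if "radius z \<le> radius y / 2" for z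
      using shell[of "y + z"] radius_add_ge[OF that] yR by (auto simp: u_def)
    have p: "?p \<le> ?G y + (2 + \<eta>) / a * (?G y)\<^sup>2"
      using \<epsilon> far[OF yR] a u ub unfolding super_scale_def by blast
    have "(2 + \<eta>) / a * (?G y)\<^sup>2 = (2 + \<eta>) * barrier B (\<beta> y y) * ?G y"
      using apos by (simp add: power2_eq_square)
    also have "\<dots> \<le> 1 * ?G y"
    proof (intro mult_right_mono)
      have "(2 + \<eta>) * barrier B (\<beta> y y) \<le> 3 * \<epsilon>"
        using fb(4,5)[OF yR] \<eta> by (intro mult_mono) auto
      then show "(2 + \<eta>) * barrier B (\<beta> y y) \<le> 1" using \<epsilon>' by simp
    qed (use Gpos in simp)
    finally have "?p \<le> 2 * ?G y" using p by simp
    then have pp0: "?p \<le> p\<^sub>0" using p0 yR p01 by force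
    have "visit_fun \<mu> ?p \<le> ?G y"
    proof (cases "?p \<le> ?G y")
      case True
      then show ?thesis using visit_fun_le[OF p01] by simp
    next
      case False
      have "0 < \<kappa> * a" using \<kappa> \<eta> by linarith
      then have \<kappa>0: "0 < \<kappa>" using apos by (simp add: zero_less_mult_iff)
      have "(2 + \<eta>) / a * (?G y)\<^sup>2 \<le> \<kappa> * (?G y)\<^sup>2"
        using \<kappa> apos by (intro mult_right_mono) (auto simp: pos_divide_le_eq)
      also have "\<dots> \<le> \<kappa> * ?p\<^sup>2"
        using False Gpos \<kappa>0 by (intro mult_left_mono power_mono) auto
      finally show ?thesis using f[OF p01(1) pp0] p by linarith
    qed
    then show ?thesis by (simp add: uy)
  qed
  moreover have "1 \<le> u y" if "y \<in> K" for y
    using that K by (auto simp: u_def visit_lim_on)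
  ultimately have "?v x \<le> u x"
    by (intro visit_lim_le_supersolution u)
  with x show "?v x \<le> ?G x" by (auto simp: u_def)
qed

text \<open>The comparison function is \<open>v\<close> inside the ball and the barrier outside. There one jump raises the
  barrier by at least as much as \<open>f\<close> takes off afterwards: as \<open>\<epsilon>\<close> bounds the function \<open>barrier B\<close> at far points, the
  bound \<open>\<sigma>\<^sup>2 / 8\<close> keeps the multiple by \<open>a\<close> in the unit interval, and \<open>\<eta> / 12\<close> makes room for the mean after one jump
  being larger than the barrier value. As \<open>f\<close> is 1-Lipschitz, the positive part of the
  difference with \<open>v\<close> is subharmonic for the walk, and it vanishes at infinity with the barrier.\<close>

lemma lower_barrier:
  assumes \<epsilon>: "sub_scale \<eta> \<epsilon>" "\<epsilon> \<le> \<sigma>\<^sup>2 / 8" "\<epsilon> \<le> \<eta> / 12" and \<eta>: "0 < \<eta>" "\<eta> \<le> 1"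
    and a: "0 < a" and \<kappa>a: "\<sigma>\<^sup>2 / 2 * a \<le> 2 - 2 * \<eta>" and K: "K \<subseteq> {x. \<beta> x x < R}"
    and far: "\<And>x. R \<le> \<beta> x x \<Longrightarrow> far \<epsilon> B x"
    and shell: "\<And>x. R / 4 \<le> \<beta> x x \<Longrightarrow> \<beta> x x < R \<Longrightarrow> a * barrier B (\<beta> x x) \<le> visit_lim \<mu> \<theta> K x"
    and x: "R \<le> \<beta> x x"
  shows "a * barrier B (\<beta> x x) \<le> visit_lim \<mu> \<theta> K x"
proof -
  define \<kappa> where "\<kappa> = \<sigma>\<^sup>2 / 2"
  have \<kappa>: "0 < \<kappa>" using variance_pos by (simp add: \<kappa>_def)
  have \<epsilon>': "0 < \<epsilon>" "\<epsilon> \<le> 1 / 4" "\<epsilon> \<le> \<kappa> / 4" using \<epsilon> by (auto simp: sub_scale_def \<kappa>_def)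
  let ?v = "visit_lim \<mu> \<theta> K" and ?G = "\<lambda>x. a * barrier B (\<beta> x x)"
  note fb = far_barrier[OF far \<epsilon>'(1,2)]
  note v = visit_lim_bounds[of \<theta> K]
  have \<kappa>a': "\<kappa> * a \<le> 2 - 2 * \<eta>" using \<kappa>a by (simp add: \<kappa>_def)
  have G: "0 < ?G y" "?G y \<le> 1 / 2" if "R \<le> \<beta> y y" for y
  proof -
    show "0 < ?G y" using fb(4)[OF that] a by simp
    have "?G y \<le> a * (\<kappa> / 4)" using fb(5)[OF that] a \<epsilon>' by (intro mult_left_mono) auto
    then show "?G y \<le> 1 / 2" using \<kappa>a' \<eta> by (simp add: mult.commute)
  qed
  define u where "u y = (if \<beta> y y < R then ?v y else ?G y)" for y
  have u: "0 \<le> u y" "u y \<le> 1" for y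
    using v[of y] G[of y] by (auto simp: u_def)
  have Gu: "?G y \<le> visit_fun \<mu> (jump_mean \<theta> u y)" if yR: "R \<le> \<beta> y y" for y
  proof -
    let ?p = "jump_mean \<theta> u y"
    have p01: "0 \<le> ?p" "?p \<le> 1" by (intro jump_mean_bounds u)+
    have lb: "?G (y + z) \<le> u (y + z)" if "radius z \<le> radius y / 2" for z
      using shell[of "y + z"] radius_add_ge[OF that] yR by (auto simp: u_def)
    \<comment> \<open>The mean after one jump is at least \<open>q\<close>, which exceeds the barrier by the factor \<open>1 + t\<close>.\<close>
    define t where "t = (2 - \<eta>) * barrier B (\<beta> y y)"
    define q where "q = ?G y * (1 + t)"
    have t: "0 \<le> t" "6 * t \<le> \<eta>"
    proof -
      show "0 \<le> t" using fb(4)[OF yR] \<eta> by (simp add: t_def)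
      have "t \<le> 2 * (\<eta> / 12)"
        unfolding t_def using fb(4,5)[OF yR] \<eta> \<epsilon> by (intro mult_mono) auto
      then show "6 * t \<le> \<eta>" by simp
    qed
    have q_eq: "q = ?G y + (2 - \<eta>) / a * (?G y)\<^sup>2"
      using a by (simp add: q_def t_def power2_eq_square field_simps)
    have qp: "q \<le> ?p" unfolding q_eq
      using \<epsilon>(1) far[OF yR] a u lb unfolding sub_scale_def by blast
    have q0: "0 \<le> q" using G(1)[OF yR] t by (simp add: q_def)
    have q1: "q \<le> 1" using qp p01 by linarith
    have t1: "t \<le> 1" using t \<eta> by simp
    have "(1 + t)\<^sup>2 \<le> 1 + 3 * t"
      using mult_left_mono[OF t1 t(1)] by (simp add: power2_eq_square algebra_simps)
    then have "\<kappa> * a * (1 + t)\<^sup>2 \<le> (2 - 2 * \<eta>) * (1 + 3 * t)"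
      using \<kappa>a' \<kappa> a t \<eta> by (intro mult_mono) auto
    also have "\<dots> \<le> 2 - \<eta>"
    proof -
      have "(2 - 2 * \<eta>) * (1 + 3 * t) = 2 - 2 * \<eta> + 6 * t - 6 * (\<eta> * t)" by (simp add: algebra_simps)
      moreover have "0 \<le> \<eta> * t" using \<eta> t by simp
      ultimately show ?thesis using t by linarith
    qed
    finally have "\<kappa> * (1 + t)\<^sup>2 \<le> (2 - \<eta>) / a" using a by (simp add: pos_le_divide_eq mult.commute mult.left_commute)
    then have "\<kappa> * (1 + t)\<^sup>2 * (?G y)\<^sup>2 \<le> (2 - \<eta>) / a * (?G y)\<^sup>2"
      by (rule mult_right_mono) simp
    moreover have "\<kappa> * q\<^sup>2 = \<kappa> * (1 + t)\<^sup>2 * (?G y)\<^sup>2"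
      unfolding q_def power_mult_distrib by (simp only: mult_ac)
    ultimately have "\<kappa> * q\<^sup>2 \<le> (2 - \<eta>) / a * (?G y)\<^sup>2" by (simp only:)
    then have "?G y \<le> q - \<sigma>\<^sup>2 / 2 * q\<^sup>2" by (simp add: q_eq[symmetric] \<kappa>_def) (simp add: q_eq)
    also have "\<dots> \<le> visit_fun \<mu> q" by (rule visit_fun_ge[OF q0 q1])
    also have "\<dots> \<le> visit_fun \<mu> ?p" by (rule visit_fun_mono[OF q0 qp p01(2)])
    finally show ?thesis .
  qed
  define D where "D y = max 0 (u y - ?v y)" for y
  have D: "0 \<le> D y" "D y \<le> 1" for y using u[of y] v[of y] by (auto simp: D_def)
  have "D x = 0"
  proof (rule subharmonic_vanishing[OF D])
    show "D y \<le> jump_mean \<theta> D y" for y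
    proof (cases "u y \<le> ?v y")
      case True
      then have "D y = 0" by (simp add: D_def)
      then show ?thesis using jump_mean_bounds(1)[of D \<theta> y, OF D] by simp
    next
      case False
      then have yR: "R \<le> \<beta> y y" by (auto simp: u_def split: if_splits)
      then have yK: "y \<notin> K" using K by auto
      let ?p = "jump_mean \<theta> u y" and ?q = "jump_mean \<theta> ?v y"
      have p01: "0 \<le> ?p" "?p \<le> 1" "0 \<le> ?q" "?q \<le> 1" by (intro jump_mean_bounds u v)+
      have int: "integrable (measure_pmf \<theta>) (\<lambda>z. h (y + z))" if "\<And>y. 0 \<le> h y" "\<And>y. h y \<le> 1" for h :: "'a \<Rightarrow> real"
        by (rule measure_pmf.integrable_const_bound[where B=1]) (auto simp: that)
      have "D y = ?G y - ?v y" using False yR by (simp add: D_def u_def)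
      also have "\<dots> \<le> visit_fun \<mu> ?p - visit_fun \<mu> ?q"
        using Gu[OF yR] visit_lim_ge[OF yK, of \<theta>] by linarith
      also have "\<dots> \<le> jump_mean \<theta> D y"
      proof (cases "?q \<le> ?p")
        case True
        have "visit_fun \<mu> ?p - visit_fun \<mu> ?q \<le> ?p - ?q"
          by (rule visit_fun_Lipschitz[OF p01(3) True p01(2)])
        also have "\<dots> = measure_pmf.expectation \<theta> (\<lambda>z. u (y + z) - ?v (y + z))"
          unfolding jump_mean_def
          by (rule Bochner_Integration.integral_diff[symmetric]) (intro int u v)+
        also have "\<dots> \<le> jump_mean \<theta> D y"
          unfolding jump_mean_def
        proof (rule integral_mono)
          show "integrable (measure_pmf \<theta>) (\<lambda>z. u (y + z) - ?v (y + z))"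
            by (intro Bochner_Integration.integrable_diff int u v)
          show "integrable (measure_pmf \<theta>) (\<lambda>z. D (y + z))"
            by (intro int D)
        qed (simp add: D_def)
        finally show ?thesis .
      next
        case False
        then have "visit_fun \<mu> ?p \<le> visit_fun \<mu> ?q"
          by (intro visit_fun_mono p01) simp
        then show ?thesis using jump_mean_bounds(1)[of D \<theta> y, OF D] by simp
      qed
      finally show ?thesis .
    qed
    fix e :: real assume e: "0 < e"
    have "{y. e \<le> D y} \<subseteq> {y. \<beta> y y \<le> max R (a / e)}"
    proof (safe)
      fix y assume ey: "e \<le> D y"
      show "\<beta> y y \<le> max R (a / e)"
      proof (cases "R \<le> \<beta> y y")
        case True
        have "e \<le> ?G y" using ey e v[of y] True by (auto simp: D_def u_def max_def split: if_splits)
        also have "\<dots> \<le> a * (1 / \<beta> y y)" using fb(6)[OF True] a by (intro mult_left_mono) auto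
        finally have "e \<le> a / \<beta> y y" by simp
        moreover have "0 < \<beta> y y" using fb(1)[OF True] by (metis form_nonneg less_eq_real_def not_one_le_zero real_sqrt_zero)
        ultimately have "\<beta> y y \<le> a / e" using e by (simp add: field_simps)
        then show ?thesis by simp
      qed simp
    qed
    then show "finite {y. e \<le> D y}" by (rule finite_subset[OF _ finite_sublevel])
  qed
  then show "?G x \<le> ?v x" using x by (simp add: D_def u_def max_def split: if_splits)
qed

end

lemma eventually_const_le_mult_ln:
  fixes c k :: real
  assumes "0 < c"
  shows "eventually (\<lambda>t. k \<le> c * ln t) at_top"
proof -
  have "filterlim (\<lambda>t. c * ln t) at_top at_top"
    using assms by real_asymp
  then show ?thesis by (simp add: filterlim_at_top)
qed

lemma eventually_mult_ln_le_sqrt: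
  fixes c e :: real
  assumes "0 < c" "0 < e"
  shows "eventually (\<lambda>t. c * ln t \<le> e * sqrt t) at_top"
  using assms by real_asymp

context critical_snake
begin

lemma far_iff:
  "far \<epsilon> B x \<longleftrightarrow> 1 \<le> \<beta> x x \<and> 1 / \<epsilon> \<le> ln (\<beta> x x) - B \<and> ln (\<beta> x x) - B \<le> \<epsilon> * sqrt (\<beta> x x)"
  by (simp add: far_def)

lemma ex_form_bound:
  assumes "finite K"
  obtains M where "K \<subseteq> {x. \<beta> x x < M}"
proof -
  have "bdd_above ((\<lambda>x. \<beta> x x) ` K)" using assms by simp
  then obtain M where "\<And>x. x \<in> K \<Longrightarrow> \<beta> x x \<le> M" by (auto simp: bdd_above_def)
  then have "K \<subseteq> {x. \<beta> x x < M + 1}" by force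
  then show ?thesis by (rule that)
qed

text \<open>Take \<open>B = 0\<close> and an amplitude for which the barrier exceeds \<open>1\<close> on a fixed shell. The barrier is not
  small there, which is why the global bound on \<open>f\<close> is used.\<close>

lemma visit_lim_upper_crude:
  assumes "finite K"
  obtains a R where "0 < a" "8 \<le> R" "\<And>x. R \<le> \<beta> x x \<Longrightarrow> visit_lim \<mu> \<theta> K x \<le> a * barrier 0 (\<beta> x x)"
proof -
  obtain c where c: "0 < c" "\<And>p. 0 \<le> p \<Longrightarrow> p \<le> 1 \<Longrightarrow> visit_fun \<mu> p \<le> p - c * p\<^sup>2"
    using visit_fun_le_global by metis
  obtain M where M: "K \<subseteq> {x. \<beta> x x < M}" using ex_form_bound[OF assms] .
  have a0: "0 < 3 / c" using c by simp
  obtain \<epsilon> where scale: "super_scale 1 (3 / c) \<epsilon>"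
    using ex_super_scale[OF zero_less_one a0] by blast
  then have \<epsilon>: "0 < \<epsilon>" "\<epsilon> \<le> 1 / 4" by (auto simp: super_scale_def)
  have "eventually (\<lambda>t. 8 \<le> t \<and> M \<le> t \<and> 1 / \<epsilon> \<le> 1 * ln t \<and> 1 * ln t \<le> \<epsilon> * sqrt t) at_top"
    using \<epsilon> by (intro eventually_conj eventually_ge_at_top eventually_const_le_mult_ln eventually_mult_ln_le_sqrt) auto
  then obtain R where R: "\<And>t. R \<le> t \<Longrightarrow> 8 \<le> t \<and> M \<le> t \<and> 1 / \<epsilon> \<le> 1 * ln t \<and> 1 * ln t \<le> \<epsilon> * sqrt t"
    by (auto simp: eventually_at_top_linorder)
  have R8: "8 \<le> R" "M \<le> R" using R[of R] by auto
  define a where "a = max (3 / c) (R * ln R)"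
  have a: "3 / c \<le> a" "R * ln R \<le> a" by (auto simp: a_def)
  then have "0 < a" using a0 by linarith
  have "visit_lim \<mu> \<theta> K x \<le> a * barrier 0 (\<beta> x x)" if x: "R \<le> \<beta> x x" for x
  proof (rule upper_barrier[where R=R and p\<^sub>0=1, OF scale zero_less_one order_refl a0 a(1)])
    show "2 + 1 \<le> c * a" using a(1) c by (simp add: pos_divide_le_eq mult.commute)
    show "K \<subseteq> {x. \<beta> x x < R}" using M R8 by auto
    show "far \<epsilon> 0 y" if "R \<le> \<beta> y y" for y
      using R[OF that] by (simp add: far_iff)
    fix y assume y: "R / 4 \<le> \<beta> y y" "\<beta> y y < R"
    have y2: "2 \<le> \<beta> y y" using y R8 by simp
    then have "0 < ln (\<beta> y y)" by simp
    moreover have "\<beta> y y * ln (\<beta> y y) \<le> R * ln R"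
      using y y2 by (intro mult_mono) auto
    ultimately have "1 \<le> a * barrier 0 (\<beta> y y)"
      using a(2) y2 by (simp add: barrier_def)
    then show "visit_lim \<mu> \<theta> K y \<le> a * barrier 0 (\<beta> y y)"
      using visit_lim_bounds(2)[of \<theta> K y] by linarith
  qed (use c x in auto)
  with \<open>0 < a\<close> R8 show ?thesis using that by blast
qed

text \<open>With \<open>\<gamma> = A / a \<le> 1\<close>, where \<open>a\<close> is the larger of \<open>A\<close> and the crude amplitude, and \<open>B = (1 - \<gamma>) * ln R\<close>, the inequality
  \<open>a / ln t \<le> A / (ln t - B)\<close> holds for \<open>t \<le> R\<close>. At the same time \<open>ln t - B \<ge> \<gamma> * ln t\<close> for \<open>t \<ge> R\<close>, so the
  scale condition holds outside the ball if \<open>R\<close> is large.\<close>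

lemma visit_lim_upper:
  assumes K: "finite K" and A: "4 / \<sigma>\<^sup>2 < A"
  obtains B R where "\<And>x. R \<le> \<beta> x x \<Longrightarrow> visit_lim \<mu> \<theta> K x \<le> A * barrier B (\<beta> x x)"
proof -
  obtain a1 R1 where a1: "0 < a1" "8 \<le> R1"
    and crude: "\<And>x. R1 \<le> \<beta> x x \<Longrightarrow> visit_lim \<mu> \<theta> K x \<le> a1 * barrier 0 (\<beta> x x)"
    using visit_lim_upper_crude[OF K] by metis
  obtain M where M: "K \<subseteq> {x. \<beta> x x < M}" using ex_form_bound[OF K] .
  have Apos: "0 < A" using A variance_pos by (smt (verit) divide_pos_pos)
  have "2 / A < \<sigma>\<^sup>2 / 2" using A Apos variance_pos by (simp add: field_simps)
  then obtain \<kappa> where \<kappa>: "2 / A < \<kappa>" "\<kappa> < \<sigma>\<^sup>2 / 2" using dense by blast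
  obtain p0 where p0: "0 < p0" "p0 \<le> 1" "\<And>p. 0 \<le> p \<Longrightarrow> p \<le> p0 \<Longrightarrow> visit_fun \<mu> p \<le> p - \<kappa> * p\<^sup>2"
    using visit_fun_le_local[OF \<kappa>(2)] by metis
  define \<eta> where "\<eta> = min 1 (\<kappa> * A - 2)"
  have \<eta>: "0 < \<eta>" "\<eta> \<le> 1" "2 + \<eta> \<le> \<kappa> * A"
    using \<kappa> Apos by (auto simp: \<eta>_def pos_divide_less_eq)
  obtain \<epsilon> where scale: "super_scale \<eta> A \<epsilon>"
    using ex_super_scale[OF \<eta>(1) Apos] by blast
  then have \<epsilon>: "0 < \<epsilon>" "\<epsilon> \<le> 1 / 4" by (auto simp: super_scale_def)
  define a where "a = max a1 A"
  define \<gamma> where "\<gamma> = A / a"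
  have a: "0 < a" "a1 \<le> a" "A \<le> a" using Apos by (auto simp: a_def)
  have \<gamma>: "0 < \<gamma>" "\<gamma> \<le> 1" "A = \<gamma> * a" using a Apos by (auto simp: \<gamma>_def)
  have "eventually (\<lambda>t. 4 * R1 \<le> t \<and> M \<le> t \<and> 2 * A / p0 \<le> t \<and> 1 / \<epsilon> \<le> \<gamma> * ln t \<and> 3 \<le> \<gamma> * ln t
      \<and> 1 * ln t \<le> \<epsilon> * sqrt t) at_top"
    using \<epsilon> \<gamma> by (intro eventually_conj eventually_ge_at_top eventually_const_le_mult_ln eventually_mult_ln_le_sqrt) auto
  then obtain R where R: "\<And>t. R \<le> t \<Longrightarrow> 4 * R1 \<le> t \<and> M \<le> t \<and> 2 * A / p0 \<le> t \<and> 1 / \<epsilon> \<le> \<gamma> * ln t \<and> 3 \<le> \<gamma> * ln t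
      \<and> 1 * ln t \<le> \<epsilon> * sqrt t"
    by (auto simp: eventually_at_top_linorder)
  note RR = R[OF order_refl]
  have Rpos: "32 \<le> R" using RR a1 by linarith
  define B where "B = (1 - \<gamma>) * ln R"
  have B0: "0 \<le> B" using \<gamma> Rpos by (auto simp: B_def)
  have far: "far \<epsilon> B y" if y: "R \<le> \<beta> y y" for y
  proof -
    have "ln R \<le> ln (\<beta> y y)" using y Rpos by simp
    moreover have "ln R - B = \<gamma> * ln R" by (simp add: B_def algebra_simps)
    ultimately have "1 / \<epsilon> \<le> ln (\<beta> y y) - B" using RR by linarith
    moreover have "ln (\<beta> y y) - B \<le> \<epsilon> * sqrt (\<beta> y y)" using R[OF y] B0 by linarith
    ultimately show ?thesis using y Rpos by (simp add: far_iff)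
  qed
  note fb = far_barrier[OF far \<epsilon>]
  have "visit_lim \<mu> \<theta> K x \<le> A * barrier B (\<beta> x x)" if x: "R \<le> \<beta> x x" for x
  proof (rule upper_barrier[where R=R and p\<^sub>0=p0 and \<kappa>=\<kappa>, OF scale \<eta>(1,2) Apos order_refl])
    show "K \<subseteq> {x. \<beta> x x < R}" using M RR by auto
    have "2 * (A * barrier B (\<beta> y y)) \<le> p0" if y: "R \<le> \<beta> y y" for y
    proof -
      have "A * barrier B (\<beta> y y) \<le> A * (1 / \<beta> y y)"
        using fb(6)[OF y] Apos by (intro mult_left_mono) auto
      moreover have "2 * A \<le> p0 * \<beta> y y" using R[OF y] p0 by (simp add: pos_divide_le_eq mult.commute)
      then have "2 * (A * (1 / \<beta> y y)) \<le> p0" using y Rpos by (simp add: pos_divide_le_eq)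
      ultimately show ?thesis by linarith
    qed
    then show "1 \<le> p0 \<or> (\<forall>x. R \<le> \<beta> x x \<longrightarrow> 2 * (A * barrier B (\<beta> x x)) \<le> p0)" by blast
    fix y assume y: "R / 4 \<le> \<beta> y y" "\<beta> y y < R"
    let ?t = "\<beta> y y"
    have t: "8 \<le> ?t" "R1 \<le> ?t" using y RR a1 by linarith+
    have lt: "0 < ln ?t" "ln ?t \<le> ln R" using t y by auto
    have "ln R - 2 \<le> ln ?t" using ln_ge_of_quarter[of R ?t] y Rpos by simp
    moreover have "ln R - B = \<gamma> * ln R" by (simp add: B_def algebra_simps)
    ultimately have sB: "0 < ln ?t - B" using RR by linarith
    have "ln ?t - B \<le> \<gamma> * ln ?t"
      using mult_left_mono[OF lt(2), of "1 - \<gamma>"] \<gamma> by (simp add: B_def algebra_simps)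
    from mult_right_mono[OF this, of a] have "(ln ?t - B) * a \<le> A * ln ?t"
      using a(1) by (simp add: \<gamma>(3) mult.commute mult.left_commute)
    then have "a / ln ?t \<le> A / (ln ?t - B)"
      using lt sB by (simp add: divide_simps mult.commute)
    then have "a / ln ?t / ?t \<le> A / (ln ?t - B) / ?t"
      using t by (intro divide_right_mono) auto
    then have "a * barrier 0 ?t \<le> A * barrier B ?t"
      by (simp add: barrier_def mult.commute)
    moreover have "a1 * barrier 0 ?t \<le> a * barrier 0 ?t"
      using a t lt by (intro mult_right_mono) (auto simp: barrier_def)
    ultimately show "visit_lim \<mu> \<theta> K y \<le> A * barrier B ?t" using crude[OF t(2)] by linarith
  qed (use \<eta> p0 x far in auto)
  then show ?thesis using that by blast
qed

text \<open>On the finite ball \<open>v\<close> is bounded below by a positive number, and for \<open>B = 0\<close> a small amplitude puts the barrier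
  below it.\<close>

lemma visit_lim_lower_crude:
  assumes K: "finite K" and pos: "\<And>x. 0 < visit_lim \<mu> \<theta> K x"
  obtains a R where "0 < a" "8 \<le> R" "\<And>x. R \<le> \<beta> x x \<Longrightarrow> a * barrier 0 (\<beta> x x) \<le> visit_lim \<mu> \<theta> K x"
proof -
  obtain M where M: "K \<subseteq> {x. \<beta> x x < M}" using ex_form_bound[OF K] .
  have half: "0 < (1 / 2 :: real)" "(1 / 2 :: real) \<le> 1" by simp_all
  have e: "0 < min (\<sigma>\<^sup>2 / 8) (1 / 2 / 12)" using variance_pos by simp
  obtain \<epsilon> where scale: "sub_scale (1 / 2) \<epsilon>" "\<epsilon> \<le> \<sigma>\<^sup>2 / 8" "\<epsilon> \<le> 1 / 2 / 12"
    using ex_sub_scale[OF half(1) e] by auto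
  then have \<epsilon>: "0 < \<epsilon>" "\<epsilon> \<le> 1 / 4" by (auto simp: sub_scale_def)
  have "eventually (\<lambda>t. 8 \<le> t \<and> M \<le> t \<and> 1 / \<epsilon> \<le> 1 * ln t \<and> 1 * ln t \<le> \<epsilon> * sqrt t) at_top"
    using \<epsilon> by (intro eventually_conj eventually_ge_at_top eventually_const_le_mult_ln eventually_mult_ln_le_sqrt) auto
  then obtain R where R: "\<And>t. R \<le> t \<Longrightarrow> 8 \<le> t \<and> M \<le> t \<and> 1 / \<epsilon> \<le> 1 * ln t \<and> 1 * ln t \<le> \<epsilon> * sqrt t"
    by (auto simp: eventually_at_top_linorder)
  have R8: "8 \<le> R" "M \<le> R" using R[of R] by auto
  define S where "S = insert 1 (visit_lim \<mu> \<theta> K ` {x. \<beta> x x \<le> R})"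
  define m where "m = Min S"
  have finS: "finite S" using finite_sublevel by (simp add: S_def)
  have "m \<in> S" unfolding m_def using finS by (intro Min_in) (auto simp: S_def)
  then have m: "0 < m" using pos by (auto simp: S_def)
  have mle: "m \<le> visit_lim \<mu> \<theta> K y" if "\<beta> y y \<le> R" for y
    unfolding m_def using finS that by (intro Min_le) (auto simp: S_def)
  define a where "a = min (2 / \<sigma>\<^sup>2) (m * ln 2)"
  have a: "0 < a" "a \<le> 2 / \<sigma>\<^sup>2" "a \<le> m * ln 2" using m variance_pos by (auto simp: a_def)
  have "a * barrier 0 (\<beta> x x) \<le> visit_lim \<mu> \<theta> K x" if x: "R \<le> \<beta> x x" for x
  proof (rule lower_barrier[where R=R, OF scale half a(1)])
    show "\<sigma>\<^sup>2 / 2 * a \<le> 2 - 2 * (1 / 2)" using a(2) variance_pos by (simp add: field_simps)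
    show "K \<subseteq> {x. \<beta> x x < R}" using M R8 by auto
    show "far \<epsilon> 0 y" if "R \<le> \<beta> y y" for y
      using R[OF that] by (simp add: far_iff)
    fix y assume y: "R / 4 \<le> \<beta> y y" "\<beta> y y < R"
    have y2: "2 \<le> \<beta> y y" using y R8 by simp
    have "1 * ln 2 \<le> \<beta> y y * ln (\<beta> y y)"
      using y2 by (intro mult_mono) auto
    then have "m * ln 2 \<le> m * (\<beta> y y * ln (\<beta> y y))" using m by (intro mult_left_mono) auto
    then have "a \<le> m * (\<beta> y y * ln (\<beta> y y))" using a by linarith
    then have "a * barrier 0 (\<beta> y y) \<le> m"
      using y2 by (simp add: barrier_def pos_divide_le_eq)
    then show "a * barrier 0 (\<beta> y y) \<le> visit_lim \<mu> \<theta> K y" using mle[of y] y by linarith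
  qed (rule x)
  with a R8 show ?thesis using that by blast
qed

text \<open>Here \<open>B = - b * ln R\<close> with \<open>b\<close> the ratio of \<open>A\<close> to the crude amplitude \<open>a1\<close>, so that
  \<open>A / (ln t - B) \<le> a1 / ln t\<close> for \<open>t \<le> R\<close>. The scale condition survives, because a multiple of
  \<open>ln R\<close> is negligible compared with the square root of \<open>R\<close>.\<close>

lemma visit_lim_lower:
  assumes K: "finite K" and pos: "\<And>x. 0 < visit_lim \<mu> \<theta> K x" and A: "0 < A" "A < 4 / \<sigma>\<^sup>2"
  obtains B R where "\<And>x. R \<le> \<beta> x x \<Longrightarrow> A * barrier B (\<beta> x x) \<le> visit_lim \<mu> \<theta> K x"
proof -
  obtain a1 R1 where a1: "0 < a1" "8 \<le> R1"
    and crude: "\<And>x. R1 \<le> \<beta> x x \<Longrightarrow> a1 * barrier 0 (\<beta> x x) \<le> visit_lim \<mu> \<theta> K x"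
    using visit_lim_lower_crude[OF K pos] by metis
  obtain M where M: "K \<subseteq> {x. \<beta> x x < M}" using ex_form_bound[OF K] .
  have \<kappa>A: "\<sigma>\<^sup>2 / 2 * A < 2" using A variance_pos by (simp add: field_simps)
  define \<eta> where "\<eta> = 1 - \<sigma>\<^sup>2 / 2 * A / 2"
  have \<eta>: "0 < \<eta>" "\<eta> \<le> 1" "\<sigma>\<^sup>2 / 2 * A \<le> 2 - 2 * \<eta>" using \<kappa>A A by (auto simp: \<eta>_def)
  have e: "0 < min (\<sigma>\<^sup>2 / 8) (\<eta> / 12)" using variance_pos \<eta> by simp
  obtain \<epsilon> where scale: "sub_scale \<eta> \<epsilon>" "\<epsilon> \<le> \<sigma>\<^sup>2 / 8" "\<epsilon> \<le> \<eta> / 12"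
    using ex_sub_scale[OF \<eta>(1) e] by auto
  then have \<epsilon>: "0 < \<epsilon>" "\<epsilon> \<le> 1 / 4" by (auto simp: sub_scale_def)
  define b where "b = A / a1"
  have b: "0 < b" "A = b * a1" using A a1 by (auto simp: b_def)
  have "eventually (\<lambda>t. 4 * R1 \<le> t \<and> M \<le> t \<and> 1 / \<epsilon> \<le> 1 * ln t \<and> (1 + b) * ln t \<le> \<epsilon> * sqrt t) at_top"
    using \<epsilon> b by (intro eventually_conj eventually_ge_at_top eventually_const_le_mult_ln eventually_mult_ln_le_sqrt) auto
  then obtain R where R: "\<And>t. R \<le> t \<Longrightarrow> 4 * R1 \<le> t \<and> M \<le> t \<and> 1 / \<epsilon> \<le> 1 * ln t \<and> (1 + b) * ln t \<le> \<epsilon> * sqrt t"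
    by (auto simp: eventually_at_top_linorder)
  note RR = R[OF order_refl]
  have Rpos: "32 \<le> R" using RR a1 by linarith
  have lR: "0 < ln R" using Rpos by simp
  define B where "B = - (b * ln R)"
  have "A * barrier B (\<beta> x x) \<le> visit_lim \<mu> \<theta> K x" if x: "R \<le> \<beta> x x" for x
  proof (rule lower_barrier[where R=R, OF scale \<eta>(1,2) A(1) \<eta>(3)])
    show "K \<subseteq> {x. \<beta> x x < R}" using M RR by auto
    show "far \<epsilon> B y" if y: "R \<le> \<beta> y y" for y
    proof -
      have "ln R \<le> ln (\<beta> y y)" using y Rpos by simp
      then have "b * ln R \<le> b * ln (\<beta> y y)" using b by simp
      then have "ln (\<beta> y y) - B \<le> \<epsilon> * sqrt (\<beta> y y)" using R[OF y] by (simp add: B_def algebra_simps)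
      moreover have "0 \<le> b * ln R" using b lR by simp
      then have "1 / \<epsilon> \<le> ln (\<beta> y y) - B" using R[OF y] by (simp add: B_def)
      ultimately show ?thesis using y Rpos by (simp add: far_iff)
    qed
    fix y assume y: "R / 4 \<le> \<beta> y y" "\<beta> y y < R"
    let ?t = "\<beta> y y"
    have t: "8 \<le> ?t" "R1 \<le> ?t" using y RR a1 by linarith+
    have lt: "0 < ln ?t" "ln ?t \<le> ln R" using t y by auto
    have sB: "0 < ln ?t - B" using lt lR b by (simp add: B_def add_pos_pos)
    have "A * ln ?t \<le> A * ln R" using lt A by simp
    also have "\<dots> \<le> a1 * (ln ?t - B)" using a1 lt b by (simp add: B_def algebra_simps)
    finally have "A / (ln ?t - B) \<le> a1 / ln ?t"
      using lt sB by (simp add: divide_simps mult.commute)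
    then have "A / (ln ?t - B) / ?t \<le> a1 / ln ?t / ?t"
      using t by (intro divide_right_mono) auto
    then have "A * barrier B ?t \<le> a1 * barrier 0 ?t"
      by (simp add: barrier_def mult.commute)
    then show "A * barrier B ?t \<le> visit_lim \<mu> \<theta> K y" using crude[OF t(2)] by linarith
  qed (rule x)
  then show ?thesis using that by blast
qed

text \<open>The factor \<open>ln (\<beta> x x / 4)\<close> is twice the logarithm of half the radius, which is the norm of the theorem;
  it is equivalent to \<open>ln (\<beta> x x) - B\<close> for every \<open>B\<close>.\<close>

lemma visit_lim_asymptotics:
  assumes K: "finite K" and pos: "\<And>x. 0 < visit_lim \<mu> \<theta> K x"
    and F: "filterlim (\<lambda>x. \<beta> x x) at_top F"
  shows "((\<lambda>x. \<beta> x x * ln (\<beta> x x / 4) * visit_lim \<mu> \<theta> K x) \<longlongrightarrow> 4 / \<sigma>\<^sup>2) F"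
proof (rule order_tendstoI)
  let ?f = "\<lambda>x. \<beta> x x * ln (\<beta> x x / 4) * visit_lim \<mu> \<theta> K x"
  have lim: "((\<lambda>x. A * barrier B (\<beta> x x) * (\<beta> x x * ln (\<beta> x x / 4))) \<longlongrightarrow> A) F" for A B
  proof -
    have "((\<lambda>t :: real. A * (1 / (t * (ln t - B))) * (t * ln (t / 4))) \<longlongrightarrow> A) at_top"
      by real_asymp
    from filterlim_compose[OF this F] show ?thesis by (simp add: barrier_def)
  qed
  have ge: "eventually (\<lambda>x. R \<le> \<beta> x x) F" for R
    using F by (auto simp: filterlim_at_top)
  show "eventually (\<lambda>x. ?f x < c) F" if c: "4 / \<sigma>\<^sup>2 < c" for c
  proof -
    obtain A where A: "4 / \<sigma>\<^sup>2 < A" "A < c" using dense[OF c] by blast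
    obtain B R where BR: "\<And>x. R \<le> \<beta> x x \<Longrightarrow> visit_lim \<mu> \<theta> K x \<le> A * barrier B (\<beta> x x)"
      using visit_lim_upper[OF K A(1)] by metis
    show ?thesis
      using ge[of R] ge[of 4] order_tendstoD(2)[OF lim[of A B] A(2)]
    proof eventually_elim
      case (elim x)
      have "?f x \<le> A * barrier B (\<beta> x x) * (\<beta> x x * ln (\<beta> x x / 4))"
        using mult_right_mono[OF BR[OF elim(1)], of "\<beta> x x * ln (\<beta> x x / 4)"] elim(2)
        by (simp add: mult.commute)
      with elim(3) show ?case by linarith
    qed
  qed
  show "eventually (\<lambda>x. c < ?f x) F" if c: "c < 4 / \<sigma>\<^sup>2" for c
  proof -
    have "max c 0 < 4 / \<sigma>\<^sup>2" using c variance_pos by simp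
    then obtain A where A: "max c 0 < A" "A < 4 / \<sigma>\<^sup>2" using dense by blast
    then have A': "c < A" "0 < A" by auto
    obtain B R where BR: "\<And>x. R \<le> \<beta> x x \<Longrightarrow> A * barrier B (\<beta> x x) \<le> visit_lim \<mu> \<theta> K x"
      using visit_lim_lower[OF K pos A'(2) A(2)] by metis
    show ?thesis
      using ge[of R] ge[of 4] order_tendstoD(1)[OF lim[of A B] A'(1)]
    proof eventually_elim
      case (elim x)
      have "A * barrier B (\<beta> x x) * (\<beta> x x * ln (\<beta> x x / 4)) \<le> ?f x"
        using mult_right_mono[OF BR[OF elim(1)], of "\<beta> x x * ln (\<beta> x x / 4)"] elim(2)
        by (simp add: mult.commute)
      with elim(3) show ?case by linarith
    qed
  qed
qed

end

section \<open>Irreducibility of centred lattice walks\<close>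

lemma real_of_int_vec_simps [simp]:
  "real_of_int_vec (x + y) = real_of_int_vec x + real_of_int_vec y"
  "real_of_int_vec 0 = 0"
  "real_of_int_vec (- x) = - real_of_int_vec x"
  "real_of_int_vec (of_nat m * x) = real m *\<^sub>R real_of_int_vec x"
  "real_of_int_vec x $ i = real_of_int (x $ i)"
  by (simp_all add: real_of_int_vec_def vec_eq_iff of_nat_index)

lemma real_of_int_vec_sum: "real_of_int_vec (\<Sum>i\<in>A. f i) = (\<Sum>i\<in>A. real_of_int_vec (f i))"
  by (induction A rule: infinite_finite_induct) simp_all

lemma int_vec_eq_0_of_norm_less_1:
  assumes "norm (real_of_int_vec x) < 1"
  shows "x = 0"
proof -
  have "\<bar>real_of_int (x $ i)\<bar> < 1" for i
    using component_le_norm_cart[of "real_of_int_vec x" i] assms by simp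
  then have "x $ i = 0" for i by (metis of_int_abs of_int_less_1_iff zabs_less_one_iff)
  then show ?thesis by (simp add: vec_eq_iff)
qed

lemma group_int_vec_group: "group (int_vec_group :: (int ^ 'n) monoid)"
  by (rule groupI) (auto simp: int_vec_group_def algebra_simps intro: exI[of _ "- _"])

lemma inv_int_vec_group: "m_inv int_vec_group x = - x" for x :: "int ^ 'n"
  using group.inv_equality[OF group_int_vec_group, of "- x" x] by (simp add: int_vec_group_def)

lemma subgroup_int_vec_group:
  fixes H :: "(int ^ 'n) set"
  assumes "0 \<in> H" "\<And>x y. x \<in> H \<Longrightarrow> y \<in> H \<Longrightarrow> x + y \<in> H" "\<And>x. x \<in> H \<Longrightarrow> - x \<in> H"
  shows "subgroup H int_vec_group"
proof (rule group.subgroupI[OF group_int_vec_group])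
  show "m_inv int_vec_group x \<in> H" if "x \<in> H" for x
    using assms(3)[OF that] by (simp add: inv_int_vec_group)
qed (use assms in \<open>auto simp: int_vec_group_def\<close>)

text \<open>The submonoid generated by a set. For the support of a jump law these are the displacements that the walk can realise.\<close>

definition list_sums :: "'a::monoid_add set \<Rightarrow> 'a set" where
  "list_sums S = {sum_list zs |zs. set zs \<subseteq> S}"

lemma list_sums_add: "x \<in> list_sums S \<Longrightarrow> y \<in> list_sums S \<Longrightarrow> x + y \<in> list_sums S"
  unfolding list_sums_def by clarify (metis Un_subset_iff set_append sum_list_append)

lemma list_sums_0: "0 \<in> list_sums S"
  unfolding list_sums_def by (auto intro!: exI[of _ "[]"])

lemma mem_list_sums: "x \<in> S \<Longrightarrow> x \<in> list_sums S"
  unfolding list_sums_def by (auto intro!: exI[of _ "[x]"])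

lemma list_sums_mult:
  fixes z :: "'a::semiring_1"
  assumes "z \<in> list_sums S"
  shows "of_nat m * z \<in> list_sums S"
proof (induction m)
  case (Suc m)
  have "of_nat (Suc m) * z = z + of_nat m * z" by (simp add: algebra_simps)
  with list_sums_add[OF assms Suc.IH] show ?case by simp
qed (simp add: list_sums_0)

lemma list_sums_sum:
  fixes f :: "'b \<Rightarrow> 'a::comm_monoid_add"
  assumes "\<And>i. i \<in> A \<Longrightarrow> f i \<in> list_sums S"
  shows "sum f A \<in> list_sums S"
  using assms by (induction A rule: infinite_finite_induct) (auto intro: list_sums_0 list_sums_add)

text \<open>Suppose that \<open>- z\<close> is a combination of elements of \<open>S\<close> with nonnegative real coefficients. Approximating
  all coefficients by rationals with a common denominator \<open>q\<close> makes \<open>q * z\<close> plus a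
  combination with natural coefficients a lattice point of norm less than \<open>1\<close>, that is, zero. Hence
  \<open>- z\<close> is the sum of \<open>(q - 1) * z\<close> and that combination.\<close>

lemma neg_in_list_sums:
  fixes S :: "(int ^ 'n) set"
  assumes z: "z \<in> S"
    and cone: "- real_of_int_vec z = (\<Sum>p\<leftarrow>l. fst p *\<^sub>R real_of_int_vec (snd p))"
    and l: "\<And>p. p \<in> set l \<Longrightarrow> 0 \<le> fst p \<and> snd p \<in> S"
  shows "- z \<in> list_sums S"
proof -
  define n where "n = length l"
  define c where "c i = fst (l ! i)" for i
  define w where "w i = snd (l ! i)" for i
  have cw: "0 \<le> c i" "w i \<in> S" if "i < n" for i
    using l[of "l ! i"] that by (auto simp: c_def w_def n_def)
  have z_eq: "- real_of_int_vec z = (\<Sum>i<n. c i *\<^sub>R real_of_int_vec (w i))"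
    unfolding cone by (simp add: sum_list_sum_nth c_def w_def n_def lessThan_atLeast0)
  obtain N :: nat where N: "(\<Sum>i<n. norm (real_of_int_vec (w i))) < N" "0 < N"
  proof -
    obtain N :: nat where "(\<Sum>i<n. norm (real_of_int_vec (w i))) < N" using reals_Archimedean2 by blast
    moreover have "0 \<le> (\<Sum>i<n. norm (real_of_int_vec (w i)))" by (simp add: sum_nonneg)
    ultimately show ?thesis using that[of N] by simp
  qed
  obtain q p where q: "0 < q" and p: "\<And>i. i < n \<Longrightarrow> \<bar>of_int q * c i - of_int (p i)\<bar> < 1 / N"
    using Dirichlet_approx_simult[OF N(2), of n c] by metis
  have p0: "0 \<le> p i" if "i < n" for i
  proof -
    have "0 \<le> of_int q * c i" using q cw[OF that] by simp
    moreover have "1 / real N \<le> 1" using N(2) by simp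
    ultimately have "- 1 < real_of_int (p i)" using p[OF that] by linarith
    then show ?thesis by linarith
  qed
  define m where "m = nat q"
  define y where "y = of_nat m * z + (\<Sum>i<n. of_nat (nat (p i)) * w i)"
  have "real_of_int_vec y = real m *\<^sub>R real_of_int_vec z + (\<Sum>i<n. real (nat (p i)) *\<^sub>R real_of_int_vec (w i))"
    by (simp add: y_def real_of_int_vec_sum del: of_nat_nat)
  also have "\<dots> = of_int q *\<^sub>R real_of_int_vec z + (\<Sum>i<n. of_int (p i) *\<^sub>R real_of_int_vec (w i))"
    using q p0 by (simp add: m_def)
  also have "of_int q *\<^sub>R real_of_int_vec z = - (of_int q *\<^sub>R (- real_of_int_vec z))" by simp
  also have "\<dots> = - (\<Sum>i<n. (of_int q * c i) *\<^sub>R real_of_int_vec (w i))"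
    unfolding z_eq by (simp add: scaleR_sum_right)
  finally have "real_of_int_vec y = - (\<Sum>i<n. (of_int q * c i - of_int (p i)) *\<^sub>R real_of_int_vec (w i))"
    by (simp add: sum_subtractf scaleR_left_diff_distrib)
  then have "norm (real_of_int_vec y) \<le> (\<Sum>i<n. \<bar>of_int q * c i - of_int (p i)\<bar> * norm (real_of_int_vec (w i)))"
    using norm_sum[of "\<lambda>i. (of_int q * c i - of_int (p i)) *\<^sub>R real_of_int_vec (w i)" "{..<n}"] by simp
  also have "\<dots> \<le> (\<Sum>i<n. 1 / N * norm (real_of_int_vec (w i)))"
    using p by (intro sum_mono mult_right_mono) (auto intro: less_imp_le)
  also have "\<dots> = (\<Sum>i<n. norm (real_of_int_vec (w i))) / N" by (simp add: sum_divide_distrib)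
  also have "\<dots> < 1" using N by simp
  finally have "y = 0" by (rule int_vec_eq_0_of_norm_less_1)
  obtain m' where m': "m = Suc m'" using q by (cases m) (auto simp: m_def)
  have "- z = of_nat m' * z + (\<Sum>i<n. of_nat (nat (p i)) * w i)"
  proof (rule minus_unique)
    show "z + (of_nat m' * z + (\<Sum>i<n. of_nat (nat (p i)) * w i)) = 0"
      using \<open>y = 0\<close> by (simp add: y_def m' algebra_simps)
  qed
  also have "\<dots> \<in> list_sums S"
    by (rule list_sums_add[OF list_sums_mult[OF mem_list_sums[OF z]]], rule list_sums_sum,
        rule list_sums_mult[OF mem_list_sums], rule cw, simp)
  finally show ?thesis .
qed

locale lattice_jumps =
  fixes \<theta> :: "(int ^ 'n::finite) pmf"
  assumes mean_zero: "mean_vec \<theta> = 0"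
    and no_subgroup: "\<And>H. subgroup H int_vec_group \<Longrightarrow> set_pmf \<theta> \<subseteq> H \<Longrightarrow> H = UNIV"
    and exp_moment: "\<exists>l>0. (\<lambda>z. pmf \<theta> z * exp (l * norm (real_of_int_vec z))) summable_on UNIV"
begin

lemma integrable_norm_power: "integrable (measure_pmf \<theta>) (\<lambda>z. norm (real_of_int_vec z) ^ k)"
proof -
  obtain l where l: "0 < l" and summ: "(\<lambda>z. pmf \<theta> z * exp (l * norm (real_of_int_vec z))) summable_on UNIV"
    using exp_moment by blast
  have "integrable (count_space UNIV) (\<lambda>z. pmf \<theta> z * exp (l * norm (real_of_int_vec z)))"
    using abs_summable_equivalent[THEN iffD1, OF summable_on_iff_abs_summable_on_real[THEN iffD1, OF summ]]
    unfolding Infinite_Set_Sum.abs_summable_on_def .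
  then have int: "integrable (measure_pmf \<theta>) (\<lambda>z. exp (l * norm (real_of_int_vec z)))"
    unfolding measure_pmf_eq_density by (subst integrable_density) auto
  show ?thesis
  proof (cases "k = 0")
    case False
    have le: "norm (real_of_int_vec z) ^ k \<le> (k / l) ^ k * exp (l * norm (real_of_int_vec z))" for z :: "int ^ 'n"
    proof -
      let ?x = "l * norm (real_of_int_vec z)"
      have "?x / k \<le> exp (?x / k)" using exp_ge_add_one_self[of "?x / k"] by linarith
      then have "(?x / k) ^ k \<le> exp (?x / k) ^ k" using l by (intro power_mono) auto
      also have "\<dots> = exp ?x" using False by (simp add: exp_of_nat_mult[symmetric])
      finally have "(k / l) ^ k * (?x / k) ^ k \<le> (k / l) ^ k * exp ?x" using l by (intro mult_left_mono) auto
      then show ?thesis using l False by (simp add: power_mult_distrib[symmetric])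
    qed
    show ?thesis
      by (rule Bochner_Integration.integrable_bound[OF integrable_mult_right[OF int, of "(k / l) ^ k"]])
        (use le l in auto)
  qed simp
qed

lemma integrable_jump: "integrable (measure_pmf \<theta>) real_of_int_vec"
  using integrable_norm_power[of 1] by (simp add: integrable_norm_iff)

lemma expectation_inner:
  "measure_pmf.expectation \<theta> (\<lambda>z. a \<bullet> real_of_int_vec z) = 0"
proof -
  have "measure_pmf.expectation \<theta> real_of_int_vec = 0" using mean_zero by (simp add: mean_vec_def)
  then show ?thesis using integral_inner_right[of a "measure_pmf \<theta>" real_of_int_vec] integrable_jump by simp
qed

text \<open>A centred variable of constant sign vanishes.\<close>

lemma inner_eq_0_of_nonneg:
  assumes "\<And>z. z \<in> set_pmf \<theta> \<Longrightarrow> 0 \<le> a \<bullet> real_of_int_vec z" "z \<in> set_pmf \<theta>"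
  shows "a \<bullet> real_of_int_vec z = 0"
proof -
  have "AE z in measure_pmf \<theta>. a \<bullet> real_of_int_vec z = 0"
    using integral_nonneg_eq_0_iff_AE[of "measure_pmf \<theta>" "\<lambda>z. a \<bullet> real_of_int_vec z"]
      expectation_inner[of a] integrable_jump assms(1) by (simp add: AE_measure_pmf_iff)
  then show ?thesis using assms(2) by (simp add: AE_measure_pmf_iff)
qed

text \<open>If \<open>- z\<close> were not in the convex cone generated by the support, a hyperplane would separate it from the cone, and the
  separating functional, having constant sign on the jumps, would vanish on all of them as their mean is zero. So
  \<open>neg_in_list_sums\<close> applies, and the monoid generated by the support is a group.\<close>

lemma list_sums_support: "list_sums (set_pmf \<theta>) = UNIV"
proof -
  let ?S = "set_pmf \<theta>"
  define D :: "(real ^ 'n) set" where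
    "D = {(\<Sum>p\<leftarrow>l. fst p *\<^sub>R real_of_int_vec (snd p)) | l. \<forall>p \<in> set l. 0 \<le> fst p \<and> snd p \<in> ?S}"
  have D_add: "x + y \<in> D" if xy: "x \<in> D" "y \<in> D" for x y
  proof -
    obtain l l' where "x = (\<Sum>p\<leftarrow>l. fst p *\<^sub>R real_of_int_vec (snd p))" "\<forall>p \<in> set l. 0 \<le> fst p \<and> snd p \<in> ?S"
      "y = (\<Sum>p\<leftarrow>l'. fst p *\<^sub>R real_of_int_vec (snd p))" "\<forall>p \<in> set l'. 0 \<le> fst p \<and> snd p \<in> ?S"
      using xy unfolding D_def by blast
    then show ?thesis unfolding D_def by (intro CollectI exI[of _ "l @ l'"]) auto
  qed
  have D_scale: "t *\<^sub>R x \<in> D" if x: "x \<in> D" "0 \<le> t" for x t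
  proof -
    obtain l where l: "x = (\<Sum>p\<leftarrow>l. fst p *\<^sub>R real_of_int_vec (snd p))" "\<forall>p \<in> set l. 0 \<le> fst p \<and> snd p \<in> ?S"
      using x unfolding D_def by blast
    have "t *\<^sub>R x = (\<Sum>p\<leftarrow>map (\<lambda>p. (t * fst p, snd p)) l. fst p *\<^sub>R real_of_int_vec (snd p))"
      unfolding l(1) by (induction l) (simp_all add: scaleR_add_right)
    then show ?thesis unfolding D_def using l(2) x(2)
      by (intro CollectI exI[of _ "map (\<lambda>p. (t * fst p, snd p)) l"]) auto
  qed
  have D_S: "real_of_int_vec z \<in> D" if "z \<in> ?S" for z
    unfolding D_def using that by (intro CollectI exI[of _ "[(1, z)]"]) simp
  have D_0: "0 \<in> D" unfolding D_def by (intro CollectI exI[of _ "[]"]) simp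
  have neg: "- z \<in> list_sums ?S" if z: "z \<in> ?S" for z
  proof -
    have "- real_of_int_vec z \<in> D"
    proof (rule ccontr)
      assume neg: "- real_of_int_vec z \<notin> D"
      let ?C = "(\<lambda>x. real_of_int_vec z + x) ` D"
      have "convex D"
        by (rule convexI) (intro D_add D_scale)
      then have "convex ?C" by (rule convex_translation)
      moreover have "?C \<noteq> {}" using D_0 by auto
      moreover have "0 \<notin> ?C" using neg by (auto simp: add_eq_0_iff)
      ultimately obtain a where a: "a \<in> span ?C" "a \<noteq> 0" "\<And>x. x \<in> ?C \<Longrightarrow> 0 \<le> a \<bullet> x"
        using separating_hyperplane_set_0_inspan[of ?C] by metis
      have "0 \<le> a \<bullet> x" if x: "x \<in> D" for x
      proof (rule ccontr)
        assume "\<not> 0 \<le> a \<bullet> x"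
        then have ax: "a \<bullet> x < 0" by simp
        \<comment> \<open>A multiple \<open>t\<close> of \<open>x\<close> so large that \<open>a\<close> is negative on \<open>z + t x\<close>.\<close>
        define t where "t = (1 + \<bar>a \<bullet> real_of_int_vec z\<bar>) / - (a \<bullet> x)"
        have "0 \<le> t" using ax by (simp add: t_def divide_nonneg_neg)
        then have "0 \<le> a \<bullet> (real_of_int_vec z + t *\<^sub>R x)" using D_scale[OF x] by (intro a(3)) auto
        then have "0 \<le> a \<bullet> real_of_int_vec z + t * (a \<bullet> x)" by (simp add: inner_add_right)
        moreover have "t * (a \<bullet> x) = - (1 + \<bar>a \<bullet> real_of_int_vec z\<bar>)" using ax by (simp add: t_def)
        ultimately show False by linarith
      qed
      then have a0: "a \<bullet> real_of_int_vec w = 0" if "w \<in> ?S" for w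
        using inner_eq_0_of_nonneg[OF _ that] D_S by blast
      have aD: "a \<bullet> x = 0" if x: "x \<in> D" for x
      proof -
        obtain l where l: "x = (\<Sum>p\<leftarrow>l. fst p *\<^sub>R real_of_int_vec (snd p))" "\<forall>p \<in> set l. 0 \<le> fst p \<and> snd p \<in> ?S"
          using x unfolding D_def by blast
        show ?thesis unfolding l(1) using l(2) by (induction l) (simp_all add: inner_add_right a0)
      qed
      have "a \<bullet> x = 0" if "x \<in> span ?C" for x
        using that
      proof (induction rule: span_induct)
        case base
        show ?case by (simp add: subspace_hyperplane)
      next
        case (step x)
        then show ?case using aD a0[OF z] by (auto simp: inner_add_right)
      qed
      then have "a \<bullet> a = 0" using a(1) by blast
      with a(2) show False by simp
    qed
    then obtain l where "- real_of_int_vec z = (\<Sum>p\<leftarrow>l. fst p *\<^sub>R real_of_int_vec (snd p))"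
      "\<forall>p \<in> set l. 0 \<le> fst p \<and> snd p \<in> ?S"
      unfolding D_def by blast
    then show ?thesis by (intro neg_in_list_sums[OF z]) auto
  qed
  have inv: "- x \<in> list_sums ?S" if "x \<in> list_sums ?S" for x
  proof -
    obtain zs where zs: "x = sum_list zs" "set zs \<subseteq> ?S" using \<open>x \<in> list_sums ?S\<close> unfolding list_sums_def by blast
    show ?thesis unfolding zs(1) using zs(2)
    proof (induction zs)
      case (Cons z zs)
      then have "- z + - sum_list zs \<in> list_sums ?S" using neg[of z] by (intro list_sums_add) auto
      then show ?case by (simp add: algebra_simps)
    qed (simp add: list_sums_0)
  qed
  have "subgroup (list_sums ?S) int_vec_group"
    by (intro subgroup_int_vec_group list_sums_0 list_sums_add inv)
  moreover have "?S \<subseteq> list_sums ?S"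
    by (auto intro: mem_list_sums)
  ultimately show ?thesis by (intro no_subgroup)
qed

end

lemma (in critical_offspring) visit_fun_pos:
  assumes "0 < p" "p \<le> 1"
  shows "0 < visit_fun \<mu> p"
proof -
  define q where "q = min p (1 / \<sigma>\<^sup>2)"
  have q: "0 < q" "q \<le> p" "\<sigma>\<^sup>2 * q \<le> 1"
    using assms variance_pos by (auto simp: q_def min_def field_simps)
  have "\<sigma>\<^sup>2 / 2 * q\<^sup>2 = \<sigma>\<^sup>2 * q * (q / 2)" by (simp add: power2_eq_square)
  also have "\<dots> \<le> 1 * (q / 2)" using q by (intro mult_right_mono) auto
  finally have "q / 2 \<le> q - \<sigma>\<^sup>2 / 2 * q\<^sup>2" by simp
  also have "\<dots> \<le> visit_fun \<mu> q" using q assms by (intro visit_fun_ge) auto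
  also have "\<dots> \<le> visit_fun \<mu> p" using q assms by (intro visit_fun_mono) auto
  finally show ?thesis using q by linarith
qed

lemma (in critical_offspring) visit_lim_pos_step:
  assumes z: "z \<in> set_pmf \<theta>" and pos: "0 < visit_lim \<mu> \<theta> K (x + z)"
  shows "0 < visit_lim \<mu> \<theta> K x"
proof (cases "x \<in> K")
  case False
  let ?v = "visit_lim \<mu> \<theta> K"
  have int: "integrable (measure_pmf \<theta>) (\<lambda>z. ?v (x + z))"
    by (rule measure_pmf.integrable_const_bound[where B=1]) (auto simp: visit_lim_bounds)
  have "jump_mean \<theta> ?v x \<noteq> 0"
  proof
    assume "jump_mean \<theta> ?v x = 0"
    then have "AE z in measure_pmf \<theta>. ?v (x + z) = 0"
      unfolding jump_mean_def
      by (subst (asm) integral_nonneg_eq_0_iff_AE) (auto simp: visit_lim_bounds int)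
    with z pos show False by (auto simp: AE_measure_pmf_iff)
  qed
  then have "0 < visit_fun \<mu> (jump_mean \<theta> ?v x)"
    using jump_mean_bounds[of ?v \<theta> x, OF visit_lim_bounds] by (intro visit_fun_pos) auto
  with visit_lim_ge[OF False, of \<theta>] show ?thesis by linarith
qed (simp add: visit_lim_on)

lemma (in critical_offspring) visit_lim_pos:
  fixes \<theta> :: "'a::ab_group_add pmf"
  assumes "list_sums (set_pmf \<theta>) = UNIV" "K \<noteq> {}"
  shows "0 < visit_lim \<mu> \<theta> K x"
proof -
  obtain y where y: "y \<in> K" using assms by blast
  have "y - x \<in> list_sums (set_pmf \<theta>)" by (simp add: assms(1))
  then obtain zs where zs: "y - x = sum_list zs" "set zs \<subseteq> set_pmf \<theta>"
    unfolding list_sums_def by blast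
  have "x + sum_list zs \<in> K" using y by (simp add: zs(1)[symmetric])
  then show ?thesis using zs(2)
  proof (induction zs arbitrary: x)
    case (Cons z zs)
    then have "0 < visit_lim \<mu> \<theta> K (x + z)" by (intro Cons.IH) (auto simp: add.assoc)
    with Cons.prems visit_lim_pos_step[of z \<theta> K x] show ?case by auto
  qed (simp add: visit_lim_on)
qed

section \<open>The inverse covariance form\<close>

context lattice_jumps
begin

definition form :: "int ^ 'n \<Rightarrow> int ^ 'n \<Rightarrow> real" where
  "form x y = real_of_int_vec x \<bullet> (matrix_inv (cov_matrix \<theta>) *v real_of_int_vec y)"

lemma integrable_inner_mult:
  "integrable (measure_pmf \<theta>) (\<lambda>z. (a \<bullet> real_of_int_vec z) * (b \<bullet> real_of_int_vec z))"
proof (rule Bochner_Integration.integrable_bound)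
  show "integrable (measure_pmf \<theta>) (\<lambda>z. norm a * norm b * norm (real_of_int_vec z) ^ 2)"
    by (intro integrable_mult_right integrable_norm_power)
  have le: "\<bar>(a \<bullet> w) * (b \<bullet> w)\<bar> \<le> norm a * norm b * norm w ^ 2" for w :: "real ^ 'n"
    using mult_mono[OF Cauchy_Schwarz_ineq2[of a w] Cauchy_Schwarz_ineq2[of b w]]
    by (simp add: abs_mult power2_eq_square mult_ac)
  show "AE z in measure_pmf \<theta>. norm ((a \<bullet> real_of_int_vec z) * (b \<bullet> real_of_int_vec z))
      \<le> norm (norm a * norm b * norm (real_of_int_vec z) ^ 2)"
    unfolding real_norm_def by (intro AE_I2 order_trans[OF le abs_ge_self])
qed simp

lemma cov_matrix_component:
  "cov_matrix \<theta> $ i $ j = measure_pmf.expectation \<theta> (\<lambda>z. real_of_int (z $ i) * real_of_int (z $ j))"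
  by (simp add: cov_matrix_def mean_zero)

lemma integrable_components:
  "integrable (measure_pmf \<theta>) (\<lambda>z. real_of_int (z $ i) * real_of_int (z $ j))"
  using integrable_inner_mult[of "axis i 1" "axis j 1"] by (simp add: inner_axis')

lemma inner_cov_matrix:
  "a \<bullet> (cov_matrix \<theta> *v b)
    = measure_pmf.expectation \<theta> (\<lambda>z. (a \<bullet> real_of_int_vec z) * (b \<bullet> real_of_int_vec z))"
proof -
  have "a \<bullet> (cov_matrix \<theta> *v b) = (\<Sum>i\<in>UNIV. \<Sum>j\<in>UNIV. a $ i * b $ j * cov_matrix \<theta> $ i $ j)"
    by (simp add: inner_vec_def matrix_vector_mult_def sum_distrib_left mult_ac)
  also have "\<dots> = measure_pmf.expectation \<theta> (\<lambda>z. \<Sum>i\<in>UNIV. \<Sum>j\<in>UNIV.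
      a $ i * b $ j * (real_of_int (z $ i) * real_of_int (z $ j)))"
    by (simp add: cov_matrix_component Bochner_Integration.integral_sum integrable_components)
  also have "(\<lambda>z. \<Sum>i\<in>UNIV. \<Sum>j\<in>UNIV. a $ i * b $ j * (real_of_int (z $ i) * real_of_int (z $ j)))
      = (\<lambda>z. (a \<bullet> real_of_int_vec z) * (b \<bullet> real_of_int_vec z))"
    by (simp add: inner_vec_def sum_product mult_ac)
  finally show ?thesis .
qed

text \<open>A direction in which the jumps have no variance is orthogonal to the subgroup that they generate.\<close>

lemma cov_matrix_pos_def:
  assumes "a \<bullet> (cov_matrix \<theta> *v a) = 0"
  shows "a = 0"
proof -
  have "AE z in measure_pmf \<theta>. (a \<bullet> real_of_int_vec z) * (a \<bullet> real_of_int_vec z) = 0"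
    using assms unfolding inner_cov_matrix
    by (subst (asm) integral_nonneg_eq_0_iff_AE) (auto intro: integrable_inner_mult)
  then have *: "set_pmf \<theta> \<subseteq> {z. a \<bullet> real_of_int_vec z = 0}"
    by (auto simp: AE_measure_pmf_iff)
  have "subgroup {z :: int ^ 'n. a \<bullet> real_of_int_vec z = 0} int_vec_group"
    by (rule subgroup_int_vec_group) (auto simp: inner_add_right)
  from no_subgroup[OF this *] have all: "a \<bullet> real_of_int_vec z = 0" for z by blast
  have "a $ i = 0" for i
  proof -
    have "real_of_int_vec (axis i 1) = axis i (1 :: real)"
      by (simp add: real_of_int_vec_def axis_def vec_eq_iff)
    with all[of "axis i 1"] show ?thesis by (simp add: inner_axis)
  qed
  then show ?thesis by (simp add: vec_eq_iff)
qed

lemma cov_matrix_inverse: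
  "cov_matrix \<theta> ** matrix_inv (cov_matrix \<theta>) = mat 1" (is ?l)
  "matrix_inv (cov_matrix \<theta>) ** cov_matrix \<theta> = mat 1" (is ?r)
proof -
  have "invertible (cov_matrix \<theta>)"
    unfolding invertible_left_inverse matrix_left_invertible_ker
    using cov_matrix_pos_def by auto
  then have "\<exists>B. cov_matrix \<theta> ** B = mat 1 \<and> B ** cov_matrix \<theta> = mat 1"
    by (simp add: invertible_def)
  from someI_ex[OF this] show ?l ?r by (auto simp: matrix_inv_def)
qed

text \<open>Every point is \<open>Q\<close> times its dual, and \<open>Q\<close> is an expectation by \<open>inner_cov_matrix\<close>. So the form of the inverse
  matrix is an expectation as well, and inherits symmetry and positivity.\<close>

abbreviation (input) dual :: "real ^ 'n \<Rightarrow> real ^ 'n" where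
  "dual x \<equiv> matrix_inv (cov_matrix \<theta>) *v x"

lemma cov_dual [simp]: "cov_matrix \<theta> *v dual x = x" "dual (cov_matrix \<theta> *v x) = x"
  by (simp_all add: matrix_vector_mul_assoc cov_matrix_inverse)

lemma inner_dual_eq_expectation:
  "x \<bullet> dual y = measure_pmf.expectation \<theta> (\<lambda>z. (dual x \<bullet> real_of_int_vec z) * (dual y \<bullet> real_of_int_vec z))"
  using inner_cov_matrix[of "dual y" "dual x"] by (simp add: inner_commute mult.commute)

lemma inner_dual_commute: "x \<bullet> dual y = y \<bullet> dual x"
  unfolding inner_dual_eq_expectation by (simp add: mult.commute)

lemma inner_dual_nonneg: "0 \<le> x \<bullet> dual x"
  unfolding inner_dual_eq_expectation by (simp add: integral_nonneg_AE)

lemma inner_dual_eq_0: "x \<bullet> dual x = 0 \<Longrightarrow> x = 0"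
  using cov_matrix_pos_def[of "dual x"] by (metis cov_dual(1) inner_commute matrix_vector_mult_0_right)

lemma inner_dual_Cauchy_Schwarz: "\<bar>x \<bullet> dual y\<bar> \<le> sqrt (x \<bullet> dual x) * sqrt (y \<bullet> dual y)"
proof (cases "y = 0")
  case False
  let ?c = "y \<bullet> dual y" and ?b = "x \<bullet> dual y"
  have c: "0 < ?c" using inner_dual_nonneg[of y] inner_dual_eq_0[of y] False by fastforce
  have "0 \<le> (x - (?b / ?c) *\<^sub>R y) \<bullet> dual (x - (?b / ?c) *\<^sub>R y)" by (rule inner_dual_nonneg)
  also have "\<dots> = x \<bullet> dual x - 2 * (?b / ?c) * ?b + (?b / ?c)\<^sup>2 * ?c"
    using inner_dual_commute[of y x]
    by (simp add: inner_diff_left inner_diff_right matrix_vector_mult_diff_distrib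
        matrix_vector_mult_scaleR power2_eq_square algebra_simps)
  also have "\<dots> = x \<bullet> dual x - ?b\<^sup>2 / ?c" using c by (simp add: power2_eq_square field_simps)
  finally have "?b\<^sup>2 \<le> (x \<bullet> dual x) * ?c" using c by (simp add: field_simps)
  then have "sqrt (?b\<^sup>2) \<le> sqrt ((x \<bullet> dual x) * ?c)" by (rule real_sqrt_le_mono)
  then show ?thesis by (simp add: real_sqrt_mult)
qed simp

text \<open>The lower bound is the Cauchy-Schwarz inequality of the form, applied to \<open>x\<close> and \<open>Q x\<close>.\<close>

lemma inner_dual_bounds:
  obtains C where "0 < C" "\<And>x. x \<bullet> dual x \<le> C * (norm x)\<^sup>2" "\<And>x. (norm x)\<^sup>2 \<le> C * (x \<bullet> dual x)"
proof -
  have bl: "bounded_linear ((*v) A)" for A :: "real ^ 'n ^ 'n"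
    by (rule matrix_vector_mul_bounded_linear)
  obtain C1 where C1: "0 < C1" "\<And>x. norm (dual x) \<le> norm x * C1"
    using bounded_linear.pos_bounded[OF bl] by blast
  obtain C2 where C2: "0 < C2" "\<And>x. norm (cov_matrix \<theta> *v x) \<le> norm x * C2"
    using bounded_linear.pos_bounded[OF bl] by blast
  have 1: "x \<bullet> dual x \<le> C1 * (norm x)\<^sup>2" for x
  proof -
    have "x \<bullet> dual x \<le> norm x * norm (dual x)" by (rule norm_cauchy_schwarz)
    also have "\<dots> \<le> norm x * (norm x * C1)" using C1(2) by (intro mult_left_mono) auto
    finally show ?thesis by (simp add: power2_eq_square mult_ac)
  qed
  have 2: "(norm x)\<^sup>2 \<le> C2 * (x \<bullet> dual x)" for x
  proof (cases "x = 0")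
    case False
    let ?Qx = "cov_matrix \<theta> *v x"
    have "(norm x)\<^sup>2 = \<bar>x \<bullet> dual ?Qx\<bar>" by (simp add: power2_norm_eq_inner)
    also have "\<dots> \<le> sqrt (x \<bullet> dual x) * sqrt (?Qx \<bullet> dual ?Qx)" by (rule inner_dual_Cauchy_Schwarz)
    finally have "((norm x)\<^sup>2)\<^sup>2 \<le> (sqrt (x \<bullet> dual x) * sqrt (?Qx \<bullet> dual ?Qx))\<^sup>2"
      by (intro power_mono) auto
    also have "\<dots> = (x \<bullet> dual x) * (?Qx \<bullet> x)"
      using inner_dual_nonneg[of x] inner_dual_nonneg[of ?Qx] by (simp add: power_mult_distrib)
    also have "\<dots> \<le> (x \<bullet> dual x) * (C2 * (norm x)\<^sup>2)"
    proof (intro mult_left_mono inner_dual_nonneg)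
      have "?Qx \<bullet> x \<le> norm ?Qx * norm x" by (rule norm_cauchy_schwarz)
      also have "\<dots> \<le> (norm x * C2) * norm x" using C2(2) by (intro mult_right_mono) auto
      finally show "?Qx \<bullet> x \<le> C2 * (norm x)\<^sup>2" by (simp add: power2_eq_square mult_ac)
    qed
    finally have "(norm x)\<^sup>2 * (norm x)\<^sup>2 \<le> (C2 * (x \<bullet> dual x)) * (norm x)\<^sup>2"
      by (simp add: power2_eq_square mult_ac)
    then show ?thesis by (rule mult_right_le_imp_le) (use False in simp)
  qed (use C2 in simp)
  show ?thesis
  proof
    show "0 < C1 + C2" using C1 C2 by simp
    show "x \<bullet> dual x \<le> (C1 + C2) * (norm x)\<^sup>2" for x
      using 1[of x] C2(1) by (simp add: algebra_simps add_increasing2)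
    show "(norm x)\<^sup>2 \<le> (C1 + C2) * (x \<bullet> dual x)" for x
      using 2[of x] mult_nonneg_nonneg[OF less_imp_le[OF C1(1)] inner_dual_nonneg[of x]]
      by (simp add: algebra_simps)
  qed
qed

lemma finite_bounded_int_vec: "finite {x :: int ^ 'n. norm (real_of_int_vec x) \<le> c}"
proof -
  have "{x :: int ^ 'n. norm (real_of_int_vec x) \<le> c} \<subseteq> vec_lambda ` (UNIV \<rightarrow>\<^sub>E {- \<lceil>c\<rceil>..\<lceil>c\<rceil>})"
  proof
    fix x :: "int ^ 'n" assume "x \<in> {x. norm (real_of_int_vec x) \<le> c}"
    then have "\<bar>real_of_int (x $ i)\<bar> \<le> c" for i
      using component_le_norm_cart[of "real_of_int_vec x" i] by simp
    then have "\<bar>x $ i\<bar> \<le> \<lceil>c\<rceil>" for i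
      by (metis le_of_int_ceiling of_int_abs of_int_le_iff order_trans)
    then have "vec_nth x \<in> UNIV \<rightarrow>\<^sub>E {- \<lceil>c\<rceil>..\<lceil>c\<rceil>}" by (auto simp: abs_le_iff minus_le_iff)
    then show "x \<in> vec_lambda ` (UNIV \<rightarrow>\<^sub>E {- \<lceil>c\<rceil>..\<lceil>c\<rceil>})" by (metis image_eqI vec_nth_inverse)
  qed
  then show ?thesis by (rule finite_subset) (auto intro!: finite_PiE)
qed

lemma expectation_form_trace: "measure_pmf.expectation \<theta> (\<lambda>z. form z z) = real CARD('n)"
proof -
  let ?P = "matrix_inv (cov_matrix \<theta>)"
  have "measure_pmf.expectation \<theta> (\<lambda>z. form z z)
      = measure_pmf.expectation \<theta> (\<lambda>z. \<Sum>i\<in>UNIV. \<Sum>j\<in>UNIV. ?P $ i $ j * (real_of_int (z $ j) * real_of_int (z $ i)))"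
    by (simp add: form_def inner_vec_def matrix_vector_mult_def sum_distrib_left mult_ac)
  also have "\<dots> = (\<Sum>i\<in>UNIV. \<Sum>j\<in>UNIV. ?P $ i $ j * cov_matrix \<theta> $ j $ i)"
    by (simp add: cov_matrix_component Bochner_Integration.integral_sum integrable_components)
  also have "\<dots> = (\<Sum>i\<in>UNIV. (?P ** cov_matrix \<theta>) $ i $ i)"
    by (simp add: matrix_matrix_mult_def)
  also have "\<dots> = real CARD('n)" by (simp add: cov_matrix_inverse mat_def)
  finally show ?thesis .
qed

lemma walk_form_form:
  assumes "CARD('n) = 4"
  shows "walk_form \<theta> form"
proof -
  obtain C where C: "0 < C" "\<And>x. x \<bullet> dual x \<le> C * (norm x)\<^sup>2" "\<And>x. (norm x)\<^sup>2 \<le> C * (x \<bullet> dual x)"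
    using inner_dual_bounds by metis
  have form_dual: "form x z = dual (real_of_int_vec x) \<bullet> real_of_int_vec z" for x z
    unfolding form_def using inner_dual_commute by (simp add: inner_commute)
  show ?thesis
  proof
    fix x z :: "int ^ 'n" and M :: real and k :: nat
    show "form (x + z) (x + z) = form x x + 2 * form x z + form z z"
      using inner_dual_commute[of "real_of_int_vec x" "real_of_int_vec z"]
      by (simp add: form_def matrix_vector_right_distrib inner_add_left inner_add_right)
    show "0 \<le> form x x" by (simp add: form_def inner_dual_nonneg)
    show "\<bar>form x z\<bar> \<le> sqrt (form x x) * sqrt (form z z)"
      by (simp add: form_def inner_dual_Cauchy_Schwarz)
    show "finite {x. form x x \<le> M}"
    proof (rule finite_subset[OF _ finite_bounded_int_vec[of "sqrt (C * M)"]], safe)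
      fix x :: "int ^ 'n" assume x: "form x x \<le> M"
      have "(norm (real_of_int_vec x))\<^sup>2 \<le> C * form x x"
        using C(3)[of "real_of_int_vec x"] by (simp add: form_def)
      also have "\<dots> \<le> C * M" using x C(1) by simp
      finally show "norm (real_of_int_vec x) \<le> sqrt (C * M)" by (rule real_le_rsqrt)
    qed
    show "integrable (measure_pmf \<theta>) (\<lambda>z. sqrt (form z z) ^ k)"
    proof (rule Bochner_Integration.integrable_bound)
      show "integrable (measure_pmf \<theta>) (\<lambda>z. sqrt C ^ k * norm (real_of_int_vec z) ^ k)"
        by (intro integrable_mult_right integrable_norm_power)
      have "sqrt (form z z) ^ k \<le> (sqrt C * norm (real_of_int_vec z)) ^ k" for z
      proof (rule power_mono)
        have "sqrt (form z z) \<le> sqrt (C * (norm (real_of_int_vec z))\<^sup>2)"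
          unfolding form_def by (intro real_sqrt_le_mono C)
        then show "sqrt (form z z) \<le> sqrt C * norm (real_of_int_vec z)" by (simp add: real_sqrt_mult)
      qed (simp add: form_def inner_dual_nonneg)
      then show "AE z in measure_pmf \<theta>. norm (sqrt (form z z) ^ k) \<le> norm (sqrt C ^ k * norm (real_of_int_vec z) ^ k)"
        using C(1) by (auto simp: power_mult_distrib form_def inner_dual_nonneg abs_mult)
    qed simp
    show "integrable (measure_pmf \<theta>) (form x)"
      unfolding form_dual[abs_def] using integrable_jump by simp
    show "measure_pmf.expectation \<theta> (form x) = 0"
      unfolding form_dual[abs_def] by (rule expectation_inner)
    show "integrable (measure_pmf \<theta>) (\<lambda>z. (form x z)\<^sup>2)"
      unfolding form_dual power2_eq_square by (rule integrable_inner_mult)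
    show "measure_pmf.expectation \<theta> (\<lambda>z. (form x z)\<^sup>2) = form x x"
      unfolding form_dual power2_eq_square inner_cov_matrix[symmetric] by (simp add: inner_commute)
    show "measure_pmf.expectation \<theta> (\<lambda>z. form z z) = 4"
      by (simp add: expectation_form_trace assms)
  qed
qed

lemma filterlim_form: "filterlim (\<lambda>x. form x x) at_top (filtercomap real_of_int_vec at_infinity)"
proof -
  obtain C where C: "0 < C" "\<And>x. (norm x)\<^sup>2 \<le> C * (x \<bullet> dual x)"
    using inner_dual_bounds by metis
  have "filterlim (\<lambda>x :: real ^ 'n. 1 / C * (norm x)\<^sup>2) at_top at_infinity"
    using C by (intro filterlim_tendsto_pos_mult_at_top[OF tendsto_const] filterlim_pow_at_top filterlim_norm_at_top) auto
  then have "filterlim (\<lambda>x :: real ^ 'n. x \<bullet> dual x) at_top at_infinity"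
    by (rule filterlim_at_top_mono) (use C in \<open>auto simp: field_simps\<close>)
  then have "filterlim ((\<lambda>x. x \<bullet> dual x) \<circ> real_of_int_vec) at_top (filtercomap real_of_int_vec at_infinity)"
    unfolding comp_def by (rule filterlim_compose[OF _ filterlim_filtercomap])
  then show ?thesis by (simp add: comp_def form_def)
qed

end

section \<open>The visiting probability of a critical snake\<close>

theorem theorem1p1:
  fixes \<mu> :: "nat pmf" and \<theta> :: "(int ^ 4) pmf" and \<sigma> :: real and K :: "(int ^ 4) set"
  assumes mu_integrable: "integrable (measure_pmf \<mu>) real"
    and mu_mean: "measure_pmf.expectation \<mu> real = 1"
    and mu_square_integrable: "integrable (measure_pmf \<mu>) (\<lambda>k. (real k)\<^sup>2)"
    and mu_variance: "measure_pmf.variance \<mu> real = \<sigma>\<^sup>2"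
    and sigma_pos: "\<sigma>\<^sup>2 > 0"
    and theta_mean: "mean_vec \<theta> = 0"
    and theta_subgroup: "\<And>H. subgroup H int_vec_group \<Longrightarrow> set_pmf \<theta> \<subseteq> H \<Longrightarrow> H = UNIV"
    and theta_exp_moment:
      "\<exists>l>0. (\<lambda>z. pmf \<theta> z * exp (l * norm (real_of_int_vec z))) summable_on UNIV"
    and K: "finite K" "K \<noteq> {}"
  shows "((\<lambda>x. (cov_norm \<theta> x)\<^sup>2 * ln (cov_norm \<theta> x) *
            \<P>(\<omega> in snake_measure \<mu> \<theta>. snake_visits x (fst \<omega>) (snd \<omega>) K))
          \<longlongrightarrow> 1 / (2 * \<sigma>\<^sup>2)) (filtercomap real_of_int_vec at_infinity)"
proof -
  interpret offspring: critical_offspring \<mu> \<sigma>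
    by unfold_locales (fact mu_integrable mu_mean mu_square_integrable mu_variance sigma_pos)+
  interpret jumps: lattice_jumps \<theta>
    by unfold_locales (fact theta_mean theta_subgroup theta_exp_moment)+
  interpret walk_form \<theta> jumps.form
    by (rule jumps.walk_form_form) simp
  interpret critical_snake \<mu> \<sigma> \<theta> jumps.form ..
  let ?F = "filtercomap real_of_int_vec at_infinity :: (int ^ 4) filter"
  have visit: "\<P>(\<omega> in snake_measure \<mu> \<theta>. snake_visits x (fst \<omega>) (snd \<omega>) K) = visit_lim \<mu> \<theta> K x" for x
    by (rule LIMSEQ_unique[OF visit_iter_tendsto_visit_prob offspring.visit_iter_LIMSEQ])
  have pos: "0 < visit_lim \<mu> \<theta> K x" for x
    by (rule offspring.visit_lim_pos[OF jumps.list_sums_support K(2)])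
  have "((\<lambda>x. 1 / 8 * (jumps.form x x * ln (jumps.form x x / 4) * visit_lim \<mu> \<theta> K x)) \<longlongrightarrow> 1 / 8 * (4 / \<sigma>\<^sup>2)) ?F"
    by (intro tendsto_mult tendsto_const visit_lim_asymptotics K(1) pos jumps.filterlim_form)
  also have "1 / 8 * (4 / \<sigma>\<^sup>2) = 1 / (2 * \<sigma>\<^sup>2)" by simp
  finally show ?thesis
  proof (rule Lim_transform_eventually)
    have "eventually (\<lambda>x. 1 \<le> jumps.form x x) ?F"
      using jumps.filterlim_form by (auto simp: filterlim_at_top)
    then show "eventually (\<lambda>x. 1 / 8 * (jumps.form x x * ln (jumps.form x x / 4) * visit_lim \<mu> \<theta> K x)
        = (cov_norm \<theta> x)\<^sup>2 * ln (cov_norm \<theta> x) * \<P>(\<omega> in snake_measure \<mu> \<theta>. snake_visits x (fst \<omega>) (snd \<omega>) K)) ?F"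
    proof eventually_elim
      case (elim x)
      have c: "cov_norm \<theta> x = sqrt (jumps.form x x / 4)"
        by (simp add: cov_norm_def jumps.form_def real_sqrt_divide)
      show ?case unfolding visit c using elim by (simp add: ln_sqrt)
    qed
  qed
qed

end
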